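(* Let $W$ be a Coxeter group. For $0<t<\rho_W$ we have $b^0_t(W)=\chi_t(W)=\dfrac{1}{W(t)}$ and $b^i_t(W)=0$ for all $i>0$.
   Context: $W(x)=\sum_{w\in W}x^{d(w)}$ is the growth series, with radius of convergence $\rho_W$, and $\chi_t=\sum_i(-1)^ib^i_t$. $b^i_t$ is the weighted $L^2$-Betti number of the Davis complex of $W$, defined as follows. Let $d$ be the word length. ${\bf C}_t[W]$ has basis $\{\delta_w\}$, inner product $\langle\delta_w,\delta_v\rangle_t=t^{d(w)}$ if $w=v$ and $0$ otherwise, and Hecke multiplication $\delta_w\delta_s=\delta_{ws}$ if $d(ws)>d(w)$, $t\delta_{ws}+(t-1)\delta_w$ otherwise. $L^2_t$ is its completion, and $V_t$ is the von Neumann algebra of right multiplications. The trace of right multiplication by $b$ is the $\delta_1$-coefficient of $b$, summed over diagonal entries. In the Davis complex $\Sigma=W\times D/\sim$ (with $D$ the Davis chamber and faces $D_T$), each simplex $\sigma$ has $d(\sigma)=\min\{d(w):\sigma\subseteq wD\}$. $L^2_tC^i(\Sigma)$ consists of cochains square-summable for weight $t^{d(\sigma)}$, with coboundary $\delta$ and adjoint $\partial^tf(\eta)=\sum_{\sigma\supset\eta}[\eta:\sigma]t^{d(\sigma)-d(\eta)}f(\sigma)$. Then $b^i_t$ is the trace of the projection onto the harmonic cochains $\ker\delta\cap\ker\partial^t$, embedded in $\bigoplus_{\sigma\in D^{(i)}}L^2_t$ via $f\mapsto W_{T(\sigma)}(t)^{-1/2}\sum_wf(w\sigma)\delta_w$.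 Here $T(\sigma)$ is the largest $T$ with $\sigma\subseteq D_T$, and $W_T(x)=\sum_{u\in W_T}x^{d(u)}$. *)

theory Defs
  imports "HOL-Analysis.Analysis" "HOL-Library.Extended_Nat"
begin

text \<open>A Coxeter system with finite generating set S and Coxeter matrix M
 (entries in enat; infinity means no relation).\<close>

definition coxeter_matrix :: "'s set \<Rightarrow> ('s \<Rightarrow> 's \<Rightarrow> enat) \<Rightarrow> bool" where
  "coxeter_matrix S M \<longleftrightarrow> finite S \<and> (\<forall>s\<in>S. M s s = 1) \<and>
     (\<forall>s\<in>S. \<forall>t\<in>S. s \<noteq> t \<longrightarrow> M s t = M t s \<and> M s t \<ge> 2)"

text \<open>Relators (st)^m with m = M s t finite (for s = t this is s s).\<close>
definition cox_rel :: "'s set \<Rightarrow> ('s \<Rightarrow> 's \<Rightarrow> enat) \<Rightarrow> 's list \<Rightarrow> bool" where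
  "cox_rel S M r \<longleftrightarrow> (\<exists>s\<in>S. \<exists>t\<in>S. \<exists>m. M s t = enat m \<and> r = concat (replicate m [s, t]))"

inductive cox_equiv :: "'s set \<Rightarrow> ('s \<Rightarrow> 's \<Rightarrow> enat) \<Rightarrow> 's list \<Rightarrow> 's list \<Rightarrow> bool"
  for S M where
  refl: "set u \<subseteq> S \<Longrightarrow> cox_equiv S M u u"
| ins: "cox_equiv S M u (v @ w) \<Longrightarrow> cox_rel S M r \<Longrightarrow> cox_equiv S M u (v @ r @ w)"
| del: "cox_equiv S M u (v @ r @ w) \<Longrightarrow> cox_rel S M r \<Longrightarrow> cox_equiv S M u (v @ w)"

definition cox_class :: "'s set \<Rightarrow> ('s \<Rightarrow> 's \<Rightarrow> enat) \<Rightarrow> 's list \<Rightarrow> 's list set" where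
  "cox_class S M u = {v. cox_equiv S M u v}"

definition cox_group :: "'s set \<Rightarrow> ('s \<Rightarrow> 's \<Rightarrow> enat) \<Rightarrow> 's list set set" where
  "cox_group S M = {cox_class S M u | u. set u \<subseteq> S}"

definition cox_one :: "'s set \<Rightarrow> ('s \<Rightarrow> 's \<Rightarrow> enat) \<Rightarrow> 's list set" where
  "cox_one S M = cox_class S M []"

definition word_length :: "'s set \<Rightarrow> ('s \<Rightarrow> 's \<Rightarrow> enat) \<Rightarrow> 's list set \<Rightarrow> nat" where
  "word_length S M w = (LEAST n. \<exists>u\<in>w. length u = n)"

definition cox_coset :: "'s set \<Rightarrow> ('s \<Rightarrow> 's \<Rightarrow> enat) \<Rightarrow> 's list set \<Rightarrow> 's set \<Rightarrow> 's list set set" where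
  "cox_coset S M w T = {cox_class S M (u @ v) | u v. u \<in> w \<and> set v \<subseteq> T}"

definition special_subgroup :: "'s set \<Rightarrow> ('s \<Rightarrow> 's \<Rightarrow> enat) \<Rightarrow> 's set \<Rightarrow> 's list set set" where
  "special_subgroup S M T = {cox_class S M v | v. set v \<subseteq> T}"

definition spherical :: "'s set \<Rightarrow> ('s \<Rightarrow> 's \<Rightarrow> enat) \<Rightarrow> 's set \<Rightarrow> bool" where
  "spherical S M T \<longleftrightarrow> T \<subseteq> S \<and> finite (special_subgroup S M T)"

definition poincare :: "'s set \<Rightarrow> ('s \<Rightarrow> 's \<Rightarrow> enat) \<Rightarrow> 's set \<Rightarrow> real \<Rightarrow> real" where
  "poincare S M T x = (\<Sum>u\<in>special_subgroup S M T. x ^ word_length S M u)"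

definition growth_series :: "'s set \<Rightarrow> ('s \<Rightarrow> 's \<Rightarrow> enat) \<Rightarrow> real \<Rightarrow> real" where
  "growth_series S M x = (\<Sum>\<^sub>\<infinity>w\<in>cox_group S M. x ^ word_length S M w)"

definition growth_radius :: "'s set \<Rightarrow> ('s \<Rightarrow> 's \<Rightarrow> enat) \<Rightarrow> ereal" where
  "growth_radius S M =
     conv_radius (\<lambda>n. real (card {w\<in>cox_group S M. word_length S M w = n}))"

text \<open>D is the geometric realisation of the poset of spherical subsets; its
 i-simplices are strictly increasing chains T0 < ... < Ti of spherical subsets.
 The simplex given by a chain c lies in D_T iff T is contained in hd c, so
 T(sigma) = hd c.\<close>
definition chamber_simplices :: "'s set \<Rightarrow> ('s \<Rightarrow> 's \<Rightarrow> enat) \<Rightarrow> nat \<Rightarrow> 's set list set" where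
  "chamber_simplices S M i =
     {c. length c = Suc i \<and> (\<forall>T\<in>set c. spherical S M T) \<and> sorted_wrt (\<subset>) c}"

type_synonym 's dsimplex = "'s list set set \<times> 's set list"

text \<open>The i-simplices of Sigma: w sigma is represented by (w W_{T(sigma)}, sigma);
 w sigma = v sigma iff w^{-1} v is in W_{T(sigma)}.\<close>
definition davis_simplices :: "'s set \<Rightarrow> ('s \<Rightarrow> 's \<Rightarrow> enat) \<Rightarrow> nat \<Rightarrow> 's dsimplex set" where
  "davis_simplices S M i =
     {(cox_coset S M w (hd c), c) | w c. w \<in> cox_group S M \<and> c \<in> chamber_simplices S M i}"

text \<open>d(sigma) = min of d(w) over w with sigma contained in wD, i.e. over the coset.\<close>
definition simplex_length :: "'s set \<Rightarrow> ('s \<Rightarrow> 's \<Rightarrow> enat) \<Rightarrow> 's dsimplex \<Rightarrow> nat" where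
  "simplex_length S M \<sigma> = (LEAST n. \<exists>w\<in>fst \<sigma>. word_length S M w = n)"

text \<open>j-th face (delete the j-th vertex of the chain; orientation by chain order).\<close>
definition face :: "'s set \<Rightarrow> ('s \<Rightarrow> 's \<Rightarrow> enat) \<Rightarrow> nat \<Rightarrow> 's dsimplex \<Rightarrow> 's dsimplex" where
  "face S M j \<sigma> =
     ((if j = 0 then (\<Union>w\<in>fst \<sigma>. cox_coset S M w (snd \<sigma> ! 1)) else fst \<sigma>),
      take j (snd \<sigma>) @ drop (Suc j) (snd \<sigma>))"

definition incidence :: "'s set \<Rightarrow> ('s \<Rightarrow> 's \<Rightarrow> enat) \<Rightarrow> 's dsimplex \<Rightarrow> 's dsimplex \<Rightarrow> complex" where
  "incidence S M \<eta> \<sigma> = (\<Sum>j<length (snd \<sigma>). if face S M j \<sigma> = \<eta> then (-1) ^ j else 0)"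

definition coboundary ::
  "'s set \<Rightarrow> ('s \<Rightarrow> 's \<Rightarrow> enat) \<Rightarrow> ('s dsimplex \<Rightarrow> complex) \<Rightarrow> 's dsimplex \<Rightarrow> complex" where
  "coboundary S M f \<sigma> = (\<Sum>j<length (snd \<sigma>). (-1) ^ j * f (face S M j \<sigma>))"

definition adjoint_t :: "'s set \<Rightarrow> ('s \<Rightarrow> 's \<Rightarrow> enat) \<Rightarrow> real \<Rightarrow> nat \<Rightarrow>
     ('s dsimplex \<Rightarrow> complex) \<Rightarrow> 's dsimplex \<Rightarrow> complex" where
  "adjoint_t S M t k f \<eta> =
     (\<Sum>\<sigma>\<in>{\<sigma>\<in>davis_simplices S M (Suc k). \<exists>j<length (snd \<sigma>). face S M j \<sigma> = \<eta>}.
        incidence S M \<eta> \<sigma> *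
        complex_of_real (t ^ simplex_length S M \<sigma> / t ^ simplex_length S M \<eta>) * f \<sigma>)"

definition cochain_L2 :: "'s set \<Rightarrow> ('s \<Rightarrow> 's \<Rightarrow> enat) \<Rightarrow> real \<Rightarrow> nat \<Rightarrow> ('s dsimplex \<Rightarrow> complex) set" where
  "cochain_L2 S M t i = {f. (\<forall>\<sigma>. \<sigma> \<notin> davis_simplices S M i \<longrightarrow> f \<sigma> = 0) \<and>
     (\<lambda>\<sigma>. (norm (f \<sigma>))^2 * t ^ simplex_length S M \<sigma>) summable_on davis_simplices S M i}"

definition harmonic_cochains :: "'s set \<Rightarrow> ('s \<Rightarrow> 's \<Rightarrow> enat) \<Rightarrow> real \<Rightarrow> nat \<Rightarrow> ('s dsimplex \<Rightarrow> complex) set" where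
  "harmonic_cochains S M t i = {f \<in> cochain_L2 S M t i.
     (\<forall>\<sigma>\<in>davis_simplices S M (Suc i). coboundary S M f \<sigma> = 0) \<and>
     (\<forall>k \<eta>. i = Suc k \<and> \<eta> \<in> davis_simplices S M k \<longrightarrow> adjoint_t S M t k f \<eta> = 0)}"

definition L2sum_ip :: "'s set \<Rightarrow> ('s \<Rightarrow> 's \<Rightarrow> enat) \<Rightarrow> real \<Rightarrow> nat \<Rightarrow>
    ('s set list \<times> 's list set \<Rightarrow> complex) \<Rightarrow> ('s set list \<times> 's list set \<Rightarrow> complex) \<Rightarrow> complex" where
  "L2sum_ip S M t i F G =
     (\<Sum>\<^sub>\<infinity>x\<in>chamber_simplices S M i \<times> cox_group S M.
        F x * cnj (G x) * complex_of_real (t ^ word_length S M (snd x)))"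

definition davis_embed :: "'s set \<Rightarrow> ('s \<Rightarrow> 's \<Rightarrow> enat) \<Rightarrow> real \<Rightarrow> nat \<Rightarrow>
    ('s dsimplex \<Rightarrow> complex) \<Rightarrow> ('s set list \<times> 's list set \<Rightarrow> complex)" where
  "davis_embed S M t i f = (\<lambda>(c, w).
     if c \<in> chamber_simplices S M i \<and> w \<in> cox_group S M
     then complex_of_real (poincare S M (hd c) t powr (-1/2)) * f (cox_coset S M w (hd c), c)
     else 0)"

definition orth_proj :: "(('a \<Rightarrow> complex) \<Rightarrow> ('a \<Rightarrow> complex) \<Rightarrow> complex) \<Rightarrow> ('a \<Rightarrow> complex) set \<Rightarrow>
    ('a \<Rightarrow> complex) \<Rightarrow> ('a \<Rightarrow> complex)" where
  "orth_proj ip V x = (THE y. y \<in> V \<and> (\<forall>v\<in>V. ip (\<lambda>z. x z - y z) v = 0))"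

definition unit_vec :: "'s set \<Rightarrow> ('s \<Rightarrow> 's \<Rightarrow> enat) \<Rightarrow> 's set list \<Rightarrow> ('s set list \<times> 's list set \<Rightarrow> complex)" where
  "unit_vec S M c = (\<lambda>(c', w). if c' = c \<and> w = cox_one S M then 1 else 0)"

text \<open>b^i_t: trace (sum of delta_1-coefficients of the diagonal entries) of the
 projection onto the image of the harmonic cochains.\<close>
definition weighted_betti :: "'s set \<Rightarrow> ('s \<Rightarrow> 's \<Rightarrow> enat) \<Rightarrow> real \<Rightarrow> nat \<Rightarrow> complex" where
  "weighted_betti S M t i =
     (\<Sum>c\<in>chamber_simplices S M i.
        L2sum_ip S M t i
          (orth_proj (L2sum_ip S M t i) (davis_embed S M t i ` harmonic_cochains S M t i)
             (unit_vec S M c))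
          (unit_vec S M c))"

text \<open>chi_t = sum_i (-1)^i b^i_t; there are no i-simplices for i > card S.\<close>
definition weighted_euler_char :: "'s set \<Rightarrow> ('s \<Rightarrow> 's \<Rightarrow> enat) \<Rightarrow> real \<Rightarrow> complex" where
  "weighted_euler_char S M t = (\<Sum>i\<le>card S. (-1) ^ i * weighted_betti S M t i)"

end

theory Submission
  imports Defs "HOL-Library.Poly_Mapping"
begin

text \<open>A harmonic cochain \<open>f\<close> of positive degree vanishes as soon as \<open>f = \<delta> h\<close> for some
  square-summable \<open>h\<close>, because then \<open>\<langle>f, f\<rangle>\<^sub>t = \<langle>h, \<partial>\<^sup>t f\<rangle>\<^sub>t = 0\<close>.  To find \<open>h\<close>, contract the Davis
  complex along ShortLex normal forms.  By Brink and Howlett there are only finitely many elementary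
  roots, so the normal forms of \<open>w\<close> and \<open>w h\<close> stay within distance \<open>R d(h)\<close> of each other.  As the
  Davis complex is acyclic, one can move a simplex \<open>w \<sigma>\<close> along the prefixes of the normal form of \<open>w\<close>
  by chain homotopies which, up to translation by the prefix, take finitely many values.  Hence
  \<open>\<bar>h (w \<sigma>)\<bar>\<close> is bounded by a sum over the prefixes \<open>u\<close> of \<open>w\<close> of values of \<open>f\<close> near \<open>u\<close>, and for
  \<open>1 < \<kappa>\<close> with \<open>\<kappa>\<^sup>2 t < \<rho>\<^sub>W\<close> the Cauchy-Schwarz inequality with weights \<open>\<kappa>\<^sup>n\<close> bounds the norm of \<open>h\<close>
  by that of \<open>f\<close> times \<open>W(\<kappa>\<^sup>2 t)\<close>.  In degree zero the harmonic cochains are the constants.\<close>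

section \<open>The Coxeter group as a group of words\<close>

text \<open>Acyclicity alone gives a primitive of a harmonic cochain without any control of its
  size, so square-summability is the obstacle. It calls for homotopies with uniformly bounded
  coefficients, hence for finitely many local patterns up to translation, hence for normal forms of
  neighbouring elements that stay close at every time. Arbitrary geodesics can drift apart; ShortLex
  words cannot, since the reflection by which two of them differ has an elementary root. Splitting
  \<open>w\<close> at a prefix into u v with d(w) = d(u) + d(v) then turns the sum over all
  \<open>w\<close> and all prefixes into a product: a sum over \<open>u\<close>, which is the norm
  of the cochain, and a sum over \<open>v\<close>, which is a value of the growth series. This is
  where t < rho_W enters; the geometric weights that absorb the number of prefixes cost a slight
  increase of t, for which the strict inequality leaves room. In degree zero the constants embed as
  a line. Its squared norm is W(t) times the sum of 1/W_T(t) over the vertices of the chamber, and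
  the trace has the same sum as its numerator, which leaves 1/W(t).\<close>

lemma cox_rel_subset: "cox_rel S M r \<Longrightarrow> set r \<subseteq> S"
  unfolding cox_rel_def by (auto split: if_splits)

lemma cox_equiv_subset:
  assumes "cox_equiv S M u v" shows "set u \<subseteq> S \<and> set v \<subseteq> S"
  using assms by induction (auto dest: cox_rel_subset)

lemma cox_equiv_trans:
  assumes "cox_equiv S M v w" "cox_equiv S M u v" shows "cox_equiv S M u w"
  using assms by (induction arbitrary: u) (auto intro: cox_equiv.intros)

lemma cox_equiv_sym:
  assumes "cox_equiv S M u v" shows "cox_equiv S M v u"
  using assms
proof induction
  case (refl u)
  then show ?case by (rule cox_equiv.refl)
next
  case (ins u v w r)
  have "set (v @ r @ w) \<subseteq> S"
    using cox_equiv_subset[OF ins.IH] cox_rel_subset[OF ins.hyps(2)] by auto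
  then have "cox_equiv S M (v @ r @ w) (v @ w)"
    by (intro cox_equiv.del[OF cox_equiv.refl] ins.hyps)
  then show ?case using ins.IH cox_equiv_trans by blast
next
  case (del u v r w)
  have "set (v @ w) \<subseteq> S"
    using cox_equiv_subset[OF del.IH] by auto
  then have "cox_equiv S M (v @ w) (v @ r @ w)"
    by (intro cox_equiv.ins[OF cox_equiv.refl] del.hyps)
  then show ?case using del.IH cox_equiv_trans by blast
qed

lemma cox_equiv_append_left:
  assumes "cox_equiv S M u v" "set a \<subseteq> S" shows "cox_equiv S M (a @ u) (a @ v)"
  using assms
proof induction
  case (refl u) then show ?case by (simp add: cox_equiv.refl)
next
  case (ins u v w r) then show ?case using cox_equiv.ins[of S M "a @ u" "a @ v" w r] by simp
next
  case (del u v r w) then show ?case using cox_equiv.del[of S M "a @ u" "a @ v" r w] by simp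
qed

lemma cox_equiv_append_right:
  assumes "cox_equiv S M u v" "set a \<subseteq> S" shows "cox_equiv S M (u @ a) (v @ a)"
  using assms
proof induction
  case (refl u) then show ?case by (simp add: cox_equiv.refl)
next
  case (ins u v w r) then show ?case using cox_equiv.ins[of S M "u @ a" "v" "w @ a" r] by simp
next
  case (del u v r w) then show ?case using cox_equiv.del[of S M "u @ a" "v" r "w @ a"] by simp
qed

lemma cox_rel_even_length: "cox_rel S M r \<Longrightarrow> even (length r)"
  unfolding cox_rel_def by (auto simp: length_concat sum_list_replicate)

text \<open>Relators have even length, so the parity of a word is an invariant of its class. This is
  what excludes \<open>len (x \<odot> g s) = len x\<close>.\<close>

lemma cox_equiv_parity:
  assumes "cox_equiv S M u v" shows "even (length u) = even (length v)"
  using assms by induction (auto dest: cox_rel_even_length)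

section \<open>Alternating words and Chebyshev polynomials\<close>

lemma concat_replicate_snoc: "concat (replicate (Suc k) xs) = concat (replicate k xs) @ xs"
  by (induction k) auto

text \<open>The alternating word is anchored at its last letter \<open>t\<close>, since that letter
  acts first on a vector; \<open>alt_word_cheb\<close> peels it off.\<close>

fun alt_word :: "'s \<Rightarrow> 's \<Rightarrow> nat \<Rightarrow> 's list" where
  "alt_word s t 0 = []"
| "alt_word s t (Suc n) = alt_word t s n @ [t]"

lemma alt_word_Suc_left:
  "alt_word s t (Suc n) = (if even n then t else s) # alt_word s t n"
  by (induction n arbitrary: s t) auto

lemma length_alt_word [simp]: "length (alt_word s t n) = n"
  by (induction n arbitrary: s t) auto

lemma set_alt_word: "set (alt_word s t n) \<subseteq> {s, t}"
proof (induction n arbitrary: s t)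
  case (Suc n) then show ?case using Suc[of t s] by auto
qed simp

lemma alt_word_add:
  "alt_word s t (i + j) = (if even j then alt_word s t i else alt_word t s i) @ alt_word s t j"
  by (induction j arbitrary: s t) auto

lemma alt_word_double: "alt_word s t (2 * k) = concat (replicate k [s, t])"
proof (induction k)
  case (Suc k)
  have "alt_word s t (2 * Suc k) = alt_word s t (2 * k) @ [s, t]" by simp
  then show ?case unfolding concat_replicate_snoc Suc.IH by simp
qed simp

lemma rev_alt_word: "rev (alt_word s t n) = (if even n then alt_word t s n else alt_word s t n)"
proof (induction n arbitrary: s t)
  case (Suc n)
  have "rev (alt_word s t (Suc n)) = t # rev (alt_word t s n)" by simp
  also have "\<dots> = (if even (Suc n) then alt_word t s (Suc n) else alt_word s t (Suc n))"
    unfolding Suc.IH[of t s] alt_word_Suc_left by simp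
  finally show ?case .
qed simp

text \<open>The Chebyshev polynomial U_(n-1) at k/2, that is sin(n x)/sin x for k = 2 cos x. These
  numbers are the coordinates of the roots of a dihedral group.\<close>

fun cheb :: "real \<Rightarrow> nat \<Rightarrow> real" where
  "cheb k 0 = 0"
| "cheb k (Suc 0) = 1"
| "cheb k (Suc (Suc n)) = k * cheb k (Suc n) - cheb k n"

lemma cheb_2: "cheb 2 n = real n"
  by (induction "2::real" n rule: cheb.induct) auto

lemma cheb_sin: "cheb (2 * cos x) n * sin x = sin (real n * x)"
proof (induction "2 * cos x" n rule: cheb.induct)
  case (3 n)
  have a: "real (Suc (Suc n)) * x = real (Suc n) * x + x" "real n * x = real (Suc n) * x - x"
    by (simp_all add: algebra_simps)
  have "sin (real (Suc (Suc n)) * x) = 2 * cos x * sin (real (Suc n) * x) - sin (real n * x)"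
    unfolding a sin_add sin_diff by simp
  also have "\<dots> = 2 * cos x * (cheb (2 * cos x) (Suc n) * sin x) - cheb (2 * cos x) n * sin x"
    by (simp only: 3)
  finally show ?case by (simp add: algebra_simps)
qed auto

definition posv :: "('s \<Rightarrow> real) \<Rightarrow> bool" where
  "posv x \<longleftrightarrow> (\<forall>t. x t \<ge> 0) \<and> (\<exists>t. x t > 0)"

definition negv :: "('s \<Rightarrow> real) \<Rightarrow> bool" where
  "negv x \<longleftrightarrow> (\<forall>t. x t \<le> 0) \<and> (\<exists>t. x t < 0)"

lemma not_posv_negv: "posv x \<Longrightarrow> negv x \<Longrightarrow> False"
  unfolding posv_def negv_def by (meson not_le)

lemma posv_neg: "posv (\<lambda>t. - x t) \<longleftrightarrow> negv x" and negv_neg: "negv (\<lambda>t. - x t) \<longleftrightarrow> posv x"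
  unfolding posv_def negv_def by auto

locale coxeter =
  fixes S :: "'s set" and M :: "'s \<Rightarrow> 's \<Rightarrow> enat"
  assumes cm: "coxeter_matrix S M"
begin

lemma finite_S: "finite S" and M_diag: "s \<in> S \<Longrightarrow> M s s = 1"
  and M_sym: "s \<in> S \<Longrightarrow> t \<in> S \<Longrightarrow> M s t = M t s"
  and M_ge2: "s \<in> S \<Longrightarrow> t \<in> S \<Longrightarrow> s \<noteq> t \<Longrightarrow> M s t \<ge> 2"
proof -
  have c: "finite S \<and> (\<forall>s\<in>S. M s s = 1) \<and> (\<forall>s\<in>S. \<forall>t\<in>S. s \<noteq> t \<longrightarrow> M s t = M t s \<and> M s t \<ge> 2)"
    using cm unfolding coxeter_matrix_def .
  show "finite S" "s \<in> S \<Longrightarrow> M s s = 1" using c by auto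
  show "s \<in> S \<Longrightarrow> t \<in> S \<Longrightarrow> M s t = M t s" using c by (cases "s = t") auto
  show "s \<in> S \<Longrightarrow> t \<in> S \<Longrightarrow> s \<noteq> t \<Longrightarrow> M s t \<ge> 2" using c by auto
qed

section \<open>The group law on classes of words\<close>

abbreviation cls :: "'s list \<Rightarrow> 's list set" where "cls \<equiv> cox_class S M"
abbreviation W :: "'s list set set" where "W \<equiv> cox_group S M"
abbreviation e :: "'s list set" where "e \<equiv> cox_one S M"
abbreviation len :: "'s list set \<Rightarrow> nat" where "len \<equiv> word_length S M"
abbreviation g :: "'s \<Rightarrow> 's list set" where "g s \<equiv> cls [s]"

lemma cls_eq_iff: assumes u: "set u \<subseteq> S" shows "cls u = cls v \<longleftrightarrow> cox_equiv S M u v"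
proof
  assume a: "cls u = cls v"
  have "u \<in> cls u" using u by (simp add: cox_class_def cox_equiv.refl)
  then have "cox_equiv S M v u" unfolding a by (simp add: cox_class_def)
  then show "cox_equiv S M u v" by (rule cox_equiv_sym)
next
  assume a: "cox_equiv S M u v"
  have "cox_equiv S M u x \<longleftrightarrow> cox_equiv S M v x" for x
    using cox_equiv_trans[OF _ a] cox_equiv_trans[OF _ cox_equiv_sym[OF a]] by blast
  then show "cls u = cls v" unfolding cox_class_def by (intro Collect_cong)
qed

lemma in_cls_iff: "v \<in> cls u \<longleftrightarrow> cox_equiv S M u v"
  by (simp add: cox_class_def)

lemma cls_self: "set u \<subseteq> S \<Longrightarrow> u \<in> cls u"
  by (simp add: in_cls_iff cox_equiv.refl)

lemma cls_in_W: "set u \<subseteq> S \<Longrightarrow> cls u \<in> W"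
  unfolding cox_group_def by auto

lemma g_in_W [simp]: "s \<in> S \<Longrightarrow> g s \<in> W" by (simp add: cls_in_W)

lemma e_in_W [simp]: "e \<in> W" by (simp add: cls_in_W cox_one_def)

lemma W_cases: assumes "x \<in> W" obtains u where "set u \<subseteq> S" "x = cls u"
  using assms unfolding cox_group_def by auto

definition rp :: "'s list set \<Rightarrow> 's list" where
  "rp x = (SOME u. set u \<subseteq> S \<and> x = cls u)"

lemma rp: assumes "x \<in> W" shows "set (rp x) \<subseteq> S" "cls (rp x) = x"
proof -
  obtain u where "set u \<subseteq> S \<and> x = cls u" using assms by (elim W_cases) auto
  then have "set (rp x) \<subseteq> S \<and> x = cls (rp x)" unfolding rp_def by (rule someI)
  then show "set (rp x) \<subseteq> S" "cls (rp x) = x" by auto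
qed

definition mul :: "'s list set \<Rightarrow> 's list set \<Rightarrow> 's list set" (infixl "\<odot>" 70) where
  "x \<odot> y = cls (rp x @ rp y)"

definition iv :: "'s list set \<Rightarrow> 's list set" where
  "iv x = cls (rev (rp x))"

lemma mul_cls: assumes "set u \<subseteq> S" "set v \<subseteq> S" shows "cls u \<odot> cls v = cls (u @ v)"
proof -
  have r: "set (rp (cls x)) \<subseteq> S \<and> cox_equiv S M (rp (cls x)) x" if "set x \<subseteq> S" for x
    using rp[OF cls_in_W[OF that]] cls_eq_iff by blast
  have a: "set (rp (cls u)) \<subseteq> S" "cox_equiv S M (rp (cls u)) u"
          "set (rp (cls v)) \<subseteq> S" "cox_equiv S M (rp (cls v)) v"
    using r[OF assms(1)] r[OF assms(2)] by auto
  have "cox_equiv S M (rp (cls u) @ rp (cls v)) (u @ v)"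
    using cox_equiv_append_right[OF a(2,3)] cox_equiv_append_left[OF a(4) assms(1)]
      cox_equiv_trans by blast
  then show ?thesis unfolding mul_def using a by (subst cls_eq_iff) auto
qed

lemma cox_equiv_rev_cancel: "set u \<subseteq> S \<Longrightarrow> cox_equiv S M (u @ rev u) []"
proof (induction u)
  case Nil then show ?case by (simp add: cox_equiv.refl)
next
  case (Cons s u)
  then have s: "s \<in> S" by simp
  have "cox_equiv S M (s # (u @ rev u) @ [s]) [s, s]"
    using cox_equiv_append_left[OF cox_equiv_append_right[OF Cons.IH, of "[s]"], of "[s]"] Cons.prems
    by simp
  moreover have "cox_rel S M [s, s]"
    unfolding cox_rel_def using s M_diag[OF s]
    by (intro bexI[OF _ s] exI[of _ 1]) (simp add: one_enat_def)
  ultimately show ?case using cox_equiv.del[of S M _ "[]" "[s,s]" "[]"] by simp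
qed

lemma mul_closed [simp]: "x \<in> W \<Longrightarrow> y \<in> W \<Longrightarrow> x \<odot> y \<in> W"
  unfolding mul_def by (intro cls_in_W) (simp add: rp)

lemma iv_closed [simp]: "x \<in> W \<Longrightarrow> iv x \<in> W"
  unfolding iv_def by (intro cls_in_W) (simp add: rp)

lemma mul_assoc: "x \<in> W \<Longrightarrow> y \<in> W \<Longrightarrow> z \<in> W \<Longrightarrow> x \<odot> y \<odot> z = x \<odot> (y \<odot> z)"
  by (elim W_cases) (simp add: mul_cls)

lemma e_mul [simp]: "x \<in> W \<Longrightarrow> e \<odot> x = x" and mul_e [simp]: "x \<in> W \<Longrightarrow> x \<odot> e = x"
  by (elim W_cases, simp add: mul_cls cox_one_def)+

lemma mul_iv [simp]: assumes "x \<in> W" shows "x \<odot> iv x = e"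
proof -
  have "cls (rp x) \<odot> cls (rev (rp x)) = cls []"
    using cox_equiv_rev_cancel[OF rp(1)[OF assms]] rp(1)[OF assms] mul_cls by (simp add: cls_eq_iff)
  then show ?thesis using rp(2)[OF assms] by (simp add: iv_def cox_one_def)
qed

lemma iv_mul [simp]: assumes "x \<in> W" shows "iv x \<odot> x = e"
proof -
  have r: "set (rp x) \<subseteq> S" by (rule rp(1)[OF assms])
  have "cls (rev (rp x)) \<odot> cls (rp x) = cls []"
    using cox_equiv_rev_cancel[of "rev (rp x)"] r by (simp add: cls_eq_iff mul_cls)
  then show ?thesis using rp(2)[OF assms] by (simp add: iv_def cox_one_def)
qed

lemma iv_mul_cancel [simp]: "x \<in> W \<Longrightarrow> y \<in> W \<Longrightarrow> iv x \<odot> (x \<odot> y) = y"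
  and mul_iv_cancel [simp]: "x \<in> W \<Longrightarrow> y \<in> W \<Longrightarrow> x \<odot> (iv x \<odot> y) = y"
  by (simp_all flip: mul_assoc)

lemma iv_unique: assumes "x \<in> W" "y \<in> W" "x \<odot> y = e" shows "iv x = y"
  by (metis assms iv_closed iv_mul_cancel mul_e)

lemma iv_iv [simp]: "x \<in> W \<Longrightarrow> iv (iv x) = x"
  by (rule iv_unique) auto

lemma iv_e [simp]: "iv e = e"
  by (rule iv_unique) auto

lemma iv_mul_distrib: assumes "x \<in> W" "y \<in> W" shows "iv (x \<odot> y) = iv y \<odot> iv x"
  by (rule iv_unique) (use assms in \<open>simp_all add: mul_assoc\<close>)

lemma g_g [simp]: assumes "s \<in> S" shows "g s \<odot> g s = e"
  using cox_equiv_rev_cancel[of "[s]"] assms by (simp add: mul_cls cox_one_def cls_eq_iff)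

lemma iv_g [simp]: "s \<in> S \<Longrightarrow> iv (g s) = g s"
  by (rule iv_unique) auto

lemma mul_g_g [simp]: "x \<in> W \<Longrightarrow> s \<in> S \<Longrightarrow> x \<odot> g s \<odot> g s = x"
  by (simp add: mul_assoc)

lemma g_g_mul [simp]: "x \<in> W \<Longrightarrow> s \<in> S \<Longrightarrow> g s \<odot> (g s \<odot> x) = x"
  by (simp flip: mul_assoc)

lemma cls_Cons: "s \<in> S \<Longrightarrow> set u \<subseteq> S \<Longrightarrow> cls (s # u) = g s \<odot> cls u"
  by (simp add: mul_cls)

lemma cls_snoc: "s \<in> S \<Longrightarrow> set u \<subseteq> S \<Longrightarrow> cls (u @ [s]) = cls u \<odot> g s"
  by (simp add: mul_cls)

lemma iv_cls: assumes "set u \<subseteq> S" shows "iv (cls u) = cls (rev u)"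
proof (rule iv_unique)
  show "cls u \<odot> cls (rev u) = e"
    using cox_equiv_rev_cancel[OF assms] assms by (simp add: mul_cls cls_eq_iff cox_one_def)
qed (use assms in \<open>simp_all add: cls_in_W\<close>)

section \<open>The word length\<close>

lemma in_W_subset: "x \<in> W \<Longrightarrow> u \<in> x \<Longrightarrow> set u \<subseteq> S \<and> cls u = x"
  by (elim W_cases) (use cls_eq_iff cox_equiv_subset in_cls_iff in blast)

lemma len_le: "x \<in> W \<Longrightarrow> u \<in> x \<Longrightarrow> len x \<le> length u"
  unfolding word_length_def by (rule Least_le) auto

lemma len_cls_le: "set u \<subseteq> S \<Longrightarrow> len (cls u) \<le> length u"
  using len_le cls_in_W cls_self by blast

lemma reduced_word: assumes "x \<in> W" obtains u where "set u \<subseteq> S" "cls u = x" "length u = len x"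
proof -
  obtain v where "v \<in> x" using assms by (elim W_cases) (use cls_self in blast)
  then have "\<exists>u\<in>x. length u = len x"
    unfolding word_length_def using LeastI_ex[of "\<lambda>n. \<exists>u\<in>x. length u = n"] by blast
  then show ?thesis using that in_W_subset[OF assms] by blast
qed

lemma len_e [simp]: "len e = 0"
  using len_cls_le[of "[]"] by (simp add: cox_one_def)

lemma len_0_iff: assumes x: "x \<in> W" shows "len x = 0 \<longleftrightarrow> x = e"
proof
  assume l: "len x = 0"
  obtain u where "cls u = x" "length u = len x" using reduced_word[OF x] by blast
  then show "x = e" using l by (simp add: cox_one_def)
qed simp

lemma len_mul_le: assumes "x \<in> W" "y \<in> W" shows "len (x \<odot> y) \<le> len x + len y"
proof -
  obtain u where "set u \<subseteq> S" "cls u = x" "length u = len x" by (rule reduced_word[OF assms(1)])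
  moreover obtain v where "set v \<subseteq> S" "cls v = y" "length v = len y" by (rule reduced_word[OF assms(2)])
  ultimately show ?thesis using len_cls_le[of "u @ v"] mul_cls[of u v] by auto
qed

lemma len_iv [simp]: assumes "x \<in> W" shows "len (iv x) = len x"
proof -
  have *: "len (iv y) \<le> len y" if "y \<in> W" for y
  proof -
    obtain u where "set u \<subseteq> S" "cls u = y" "length u = len y" by (rule reduced_word[OF \<open>y \<in> W\<close>])
    then show ?thesis using iv_cls[of u] len_cls_le[of "rev u"] by auto
  qed
  show ?thesis using *[OF assms] *[of "iv x"] assms by simp
qed

lemma len_g_le: "s \<in> S \<Longrightarrow> len (g s) \<le> 1"
  using len_cls_le[of "[s]"] by simp

lemma len_parity: assumes "x \<in> W" "s \<in> S" shows "even (len (x \<odot> g s)) \<noteq> even (len x)"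
proof -
  obtain u where u: "set u \<subseteq> S" "cls u = x" "length u = len x" by (rule reduced_word[OF assms(1)])
  obtain v where v: "set v \<subseteq> S" "cls v = x \<odot> g s" "length v = len (x \<odot> g s)"
    by (rule reduced_word[of "x \<odot> g s"]) (use assms in auto)
  have "cls v = cls (u @ [s])" using u v assms by (simp add: cls_snoc)
  then have "even (length v) = even (length (u @ [s]))"
    using v cls_eq_iff cox_equiv_parity by blast
  then show ?thesis using u v by simp
qed

lemma len_mul_g: assumes "x \<in> W" "s \<in> S"
  shows "len (x \<odot> g s) = Suc (len x) \<or> Suc (len (x \<odot> g s)) = len x"
proof -
  have "len (x \<odot> g s) \<le> len x + 1" using len_mul_le[of x "g s"] len_g_le assms by fastforce
  moreover have "len x \<le> len (x \<odot> g s) + 1"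
    using len_mul_le[of "x \<odot> g s" "g s"] len_g_le assms by fastforce
  moreover have "len (x \<odot> g s) \<noteq> len x" using len_parity assms by metis
  ultimately show ?thesis by linarith
qed

lemma len_g_mul: assumes "x \<in> W" "s \<in> S"
  shows "len (g s \<odot> x) = Suc (len x) \<or> Suc (len (g s \<odot> x)) = len x"
  using len_mul_g[of "iv x" s] len_iv[of "g s \<odot> x"] assms by (simp add: iv_mul_distrib)

lemma len_g [simp]: "s \<in> S \<Longrightarrow> len (g s) = 1"
  using len_mul_g[of e s] by simp

lemma ex_right_descent: assumes "x \<in> W" "x \<noteq> e" obtains s where "s \<in> S" "Suc (len (x \<odot> g s)) = len x"
proof -
  obtain u where u: "set u \<subseteq> S" "cls u = x" "length u = len x" by (rule reduced_word[OF assms(1)])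
  then obtain v s where v: "u = v @ [s]" using assms len_0_iff by (cases u rule: rev_cases) auto
  then have "x \<odot> g s = cls v" using u by (auto simp: cls_snoc cls_in_W)
  then have "len (x \<odot> g s) < len x" using len_cls_le[of v] u v by auto
  then show ?thesis using that[of s] len_mul_g[of x s] u v assms by auto
qed

section \<open>The geometric representation\<close>

text \<open>Vectors are arbitrary functions \<open>'s \<Rightarrow> real\<close>; coordinates outside \<open>S\<close> are ignored by the form.\<close>

definition bm :: "'s \<Rightarrow> 's \<Rightarrow> real" where
  "bm s t = (case M s t of enat m \<Rightarrow> - cos (pi / real m) | \<infinity> \<Rightarrow> -1)"

text \<open>The Tits form, with Gram matrix \<open>bm\<close>, paired with the simple root of
  \<open>s\<close>; only these pairings enter the simple reflections.\<close>

definition bl :: "('s \<Rightarrow> real) \<Rightarrow> 's \<Rightarrow> real" where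
  "bl x s = (\<Sum>r\<in>S. x r * bm r s)"

definition al :: "'s \<Rightarrow> 's \<Rightarrow> real" where
  "al s = (\<lambda>t. if t = s then 1 else 0)"

definition refl :: "'s \<Rightarrow> ('s \<Rightarrow> real) \<Rightarrow> 's \<Rightarrow> real" where
  "refl s x = (\<lambda>t. x t - 2 * bl x s * al s t)"

fun wact :: "'s list \<Rightarrow> ('s \<Rightarrow> real) \<Rightarrow> 's \<Rightarrow> real" where
  "wact [] x = x"
| "wact (s # u) x = refl s (wact u x)"

lemma bm_diag [simp]: "s \<in> S \<Longrightarrow> bm s s = 1"
  by (simp add: bm_def M_diag one_enat_def)

lemma bm_sym: "s \<in> S \<Longrightarrow> t \<in> S \<Longrightarrow> bm s t = bm t s"
  by (simp add: bm_def M_sym)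

lemma bl_lin: "bl (\<lambda>t. p * x t + q * y t) s = p * bl x s + q * bl y s"
  unfolding bl_def by (simp add: sum.distrib sum_distrib_left algebra_simps)

lemma bl_al: "r \<in> S \<Longrightarrow> bl (al r) s = bm r s"
proof -
  assume r: "r \<in> S"
  have "bl (al r) s = (\<Sum>x\<in>S. if x = r then bm x s else 0)"
    unfolding bl_def al_def by (intro sum.cong) auto
  then show ?thesis using r finite_S by simp
qed

lemma refl_lin: "refl s (\<lambda>t. p * x t + q * y t) = (\<lambda>t. p * refl s x t + q * refl s y t)"
  unfolding refl_def bl_lin by (simp add: algebra_simps fun_eq_iff)

lemma wact_lin: "wact u (\<lambda>t. p * x t + q * y t) = (\<lambda>t. p * wact u x t + q * wact u y t)"
  by (induction u) (simp_all add: refl_lin)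

lemma wact_append: "wact (u @ v) x = wact u (wact v x)"
  by (induction u) simp_all

lemma refl_refl: assumes "s \<in> S" shows "refl s (refl s x) = x"
proof -
  have "bl (refl s x) s = - bl x s"
    using bl_lin[of 1 x "- 2 * bl x s" "al s" s] bl_al[OF assms, of s] assms
    by (simp add: refl_def algebra_simps)
  then show ?thesis by (simp add: refl_def fun_eq_iff)
qed

section \<open>Rank two: the Coxeter relations hold in the representation\<close>

definition vec :: "'s \<Rightarrow> 's \<Rightarrow> real \<Rightarrow> real \<Rightarrow> 's \<Rightarrow> real" where
  "vec s t p q = (\<lambda>r. p * al s r + q * al t r)"

lemma vec_swap: "vec s t p q = vec t s q p" by (simp add: vec_def fun_eq_iff)

lemma refl_vec: assumes "s \<in> S" "t \<in> S"
  shows "refl t (vec s t p q) = vec s t p (- 2 * bm s t * p - q)"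
  using assms bl_lin[of p "al s" q "al t" t]
  by (simp add: refl_def vec_def bl_al fun_eq_iff algebra_simps)

lemma al_vec: "al s = vec s t 1 0" "al t = vec s t 0 1"
  by (simp_all add: vec_def fun_eq_iff)

text \<open>By \<open>refl_vec\<close> a reflection replaces the coordinates (p, q) by (p, -2 B p -
  q) with B = \<open>bm s t\<close>, which is the Chebyshev recurrence with argument -2 B. Each
  letter therefore advances the index by one.\<close>

lemma alt_word_cheb:
  assumes "s \<in> S" "t \<in> S"
  shows "wact (alt_word s t n) (vec s t (cheb (- 2 * bm s t) (Suc k)) (cheb (- 2 * bm s t) k)) =
     (if even n then vec s t else vec t s)
       (cheb (- 2 * bm s t) (Suc (n + k))) (cheb (- 2 * bm s t) (n + k))"
  using assms
proof (induction n arbitrary: s t k)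
  case (Suc n)
  let ?c = "cheb (- 2 * bm s t)"
  have sym: "bm t s = bm s t" using bm_sym Suc.prems by auto
  have "wact (alt_word s t (Suc n)) (vec s t (?c (Suc k)) (?c k))
      = wact (alt_word t s n) (refl t (vec s t (?c (Suc k)) (?c k)))"
    by (simp add: wact_append)
  also have "refl t (vec s t (?c (Suc k)) (?c k)) = vec t s (?c (Suc (Suc k))) (?c (Suc k))"
    using Suc.prems by (simp add: refl_vec vec_swap[of t s])
  also have "wact (alt_word t s n) \<dots> = (if even n then vec t s else vec s t)
       (?c (Suc (n + Suc k))) (?c (n + Suc k))"
    using Suc.IH[of t s "Suc k"] Suc.prems sym by simp
  finally show ?case by simp
qed simp

lemma bm_finite: assumes "s \<in> S" "t \<in> S" "s \<noteq> t" "M s t = enat m"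
  shows "m \<ge> 2" "- 2 * bm s t = 2 * cos (pi / m)" "sin (pi / m) > 0"
proof -
  show m: "m \<ge> 2" using M_ge2[OF assms(1-3)] assms(4) by (simp add: numeral_eq_enat)
  show "- 2 * bm s t = 2 * cos (pi / m)" using assms by (simp add: bm_def)
  show "sin (pi / m) > 0" using m by (intro sin_gt_zero) (auto simp: field_simps)
qed

text \<open>The index 2m corresponds to the angle 2 pi, so the sequence starts again there.\<close>

lemma cheb_m: assumes "s \<in> S" "t \<in> S" "s \<noteq> t" "M s t = enat m"
  shows "cheb (- 2 * bm s t) (2 * m) = 0" "cheb (- 2 * bm s t) (Suc (2 * m)) = 1"
proof -
  note b = bm_finite[OF assms]
  have m: "real m > 0" using b by simp
  have "cheb (- 2 * bm s t) (2 * m) * sin (pi / m) = sin (real (2 * m) * (pi / m))"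
    unfolding b(2) by (rule cheb_sin)
  also have "real (2 * m) * (pi / m) = 2 * pi" using m by simp
  finally show "cheb (- 2 * bm s t) (2 * m) = 0" using b by simp
  have "cheb (- 2 * bm s t) (Suc (2 * m)) * sin (pi / m) = sin (real (Suc (2 * m)) * (pi / m))"
    unfolding b(2) by (rule cheb_sin)
  also have "real (Suc (2 * m)) * (pi / m) = pi / m + 2 * pi" using m by (simp add: field_simps)
  also have "sin \<dots> = sin (pi / m)" by (rule sin_periodic)
  finally show "cheb (- 2 * bm s t) (Suc (2 * m)) = 1" using b by simp
qed

lemma wact_rel_al: assumes "s \<in> S" "t \<in> S" "s \<noteq> t" "M s t = enat m"
  shows "wact (alt_word s t (2 * m)) (al s) = al s"
  using alt_word_cheb[OF assms(1,2), of "2 * m" 0] cheb_m[OF assms]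
  by (simp add: al_vec(1)[of s t])

lemma wact_rel_al': assumes "s \<in> S" "t \<in> S" "s \<noteq> t" "M s t = enat m"
  shows "wact (alt_word s t (2 * m)) (al t) = al t"
proof -
  have m: "m \<ge> 2" using bm_finite[OF assms] by simp
  let ?c = "cheb (- 2 * bm s t)"
  have "refl t (al t) = vec t s (-1) 0"
    using assms refl_vec[of s t 0 1] by (simp add: al_vec(2)[of t s] vec_swap)
  also have "\<dots> = (\<lambda>r. (-1) * vec t s (?c (Suc 0)) (?c 0) r + 0 * al t r)"
    by (simp add: vec_def fun_eq_iff)
  finally have 1: "refl t (al t) = (\<lambda>r. (-1) * vec t s (?c (Suc 0)) (?c 0) r + 0 * al t r)" .
  have mm: "2 * m = Suc (2 * m - 1)" using m by simp
  have "wact (alt_word s t (2 * m)) (al t) = wact (alt_word t s (2 * m - 1)) (refl t (al t))"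
    by (subst mm) (simp add: wact_append)
  also have "\<dots> = (\<lambda>r. (-1) * wact (alt_word t s (2 * m - 1)) (vec t s (?c (Suc 0)) (?c 0)) r
        + 0 * wact (alt_word t s (2 * m - 1)) (al t) r)"
    unfolding 1 wact_lin ..
  also have "\<dots> = (\<lambda>r. - vec s t (?c (2 * m)) (?c (2 * m - 1)) r)"
    using alt_word_cheb[of t s "2 * m - 1" 0] assms m mm bm_sym[of s t] by simp
  \<comment> \<open>The recurrence is read backwards from the two values in
    \<open>cheb_m\<close>.\<close>
  also have "?c (2 * m - 1) = -1"
  proof -
    have "?c (Suc (Suc (2 * m - 1))) = - 2 * bm s t * ?c (Suc (2 * m - 1)) - ?c (2 * m - 1)" by simp
    then show ?thesis using cheb_m[OF assms] mm by simp
  qed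
  finally show ?thesis using cheb_m[OF assms] by (simp add: vec_def fun_eq_iff)
qed

lemma refl_fix: "bl x s = 0 \<Longrightarrow> refl s x = x"
  by (simp add: refl_def fun_eq_iff)

lemma wact_fix: "\<forall>s\<in>set u. bl x s = 0 \<Longrightarrow> wact u x = x"
  by (induction u) (simp_all add: refl_fix)

text \<open>For distinct letters the Gram determinant 1 - B^2 = sin(pi/m)^2 is nonzero. A vector
  thus splits into a combination of the two simple roots, which (st)^m fixes by the dihedral
  computation, and a vector orthogonal to both, which each letter fixes.\<close>

lemma wact_rel: assumes "cox_rel S M r" shows "wact r x = x"
proof -
  obtain s t m where st: "s \<in> S" "t \<in> S" "M s t = enat m" "r = concat (replicate m [s, t])"
    using assms unfolding cox_rel_def by auto
  show ?thesis
  proof (cases "s = t")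
    case True
    then have "m = 1" using st M_diag[of s] by (simp add: one_enat_def)
    then show ?thesis using st True by (simp add: refl_refl)
  next
    case False
    note b = bm_finite[OF st(1,2) False st(3)]
    have "bm s t = - cos (pi / m)" using b(2) by simp
    then have "bm s t ^ 2 = cos (pi / m) ^ 2" by simp
    then have d: "1 - bm s t ^ 2 \<noteq> 0"
      using b(3) sin_squared_eq[of "pi / m"] by auto
    \<comment> \<open>Cramer's rule for the component in the span of the two simple roots.\<close>
    define p where "p = (bl x s - bm s t * bl x t) / (1 - bm s t ^ 2)"
    define q where "q = (bl x t - bm s t * bl x s) / (1 - bm s t ^ 2)"
    define y where "y = (\<lambda>r. 1 * x r + (-1) * vec s t p q r)"
    have v: "bl (vec s t p q) u = p * bm s u + q * bm t u" for u
      unfolding vec_def bl_lin using st by (simp add: bl_al)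
    have pq: "p + q * bm s t = bl x s" "p * bm s t + q = bl x t"
      using d unfolding p_def q_def by (simp_all add: divide_simps) (simp_all add: algebra_simps power2_eq_square)
    have "bl y s = 0" "bl y t = 0"
      unfolding y_def bl_lin v using pq st False bm_sym[of s t] by simp_all
    moreover have r: "r = alt_word s t (2 * m)" using st alt_word_double by metis
    ultimately have 1: "wact r y = y"
      using set_alt_word[of s t "2 * m"] by (intro wact_fix) auto
    have 2: "wact r (vec s t p q) = vec s t p q"
      unfolding vec_def wact_lin r wact_rel_al[OF st(1,2) False st(3)] wact_rel_al'[OF st(1,2) False st(3)] ..
    have "x = (\<lambda>r. 1 * y r + 1 * vec s t p q r)" by (simp add: y_def)
    then show ?thesis using 1 2 wact_lin[of r 1 y 1 "vec s t p q"] by simp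
  qed
qed

lemma wact_equiv: assumes "cox_equiv S M u v" shows "wact u x = wact v x"
  using assms by induction (simp_all add: wact_append wact_rel)

section \<open>The action of the group\<close>

definition act :: "'s list set \<Rightarrow> ('s \<Rightarrow> real) \<Rightarrow> 's \<Rightarrow> real" where
  "act x = wact (rp x)"

lemma act_cls: assumes "set u \<subseteq> S" shows "act (cls u) = wact u"
proof -
  have "cox_equiv S M (rp (cls u)) u"
    using rp[OF cls_in_W[OF assms]] by (simp flip: cls_eq_iff)
  then show ?thesis unfolding act_def using wact_equiv by blast
qed

lemma act_mul: "x \<in> W \<Longrightarrow> y \<in> W \<Longrightarrow> act (x \<odot> y) v = act x (act y v)"
  by (elim W_cases) (simp add: mul_cls act_cls wact_append)

lemma act_e [simp]: "act e v = v" by (simp add: cox_one_def act_cls)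

lemma act_g [simp]: "s \<in> S \<Longrightarrow> act (g s) v = refl s v" by (simp add: act_cls)

lemma act_lin: "act w (\<lambda>t. p * x t + q * y t) = (\<lambda>t. p * act w x t + q * act w y t)"
  unfolding act_def by (rule wact_lin)

lemma act_uminus: "act w (\<lambda>t. - x t) = (\<lambda>t. - act w x t)"
  using act_lin[of w "-1" x 0 x] by simp

lemma act_iv_act [simp]: "w \<in> W \<Longrightarrow> act (iv w) (act w v) = v"
  and act_act_iv [simp]: "w \<in> W \<Longrightarrow> act w (act (iv w) v) = v"
  by (simp_all flip: act_mul)

lemma refl_al_self: "s \<in> S \<Longrightarrow> refl s (al s) = (\<lambda>t. - al s t)"
  by (simp add: refl_def bl_al fun_eq_iff)

section \<open>Descents and the signs of roots\<close>

lemma posv_comb: assumes "posv x" "posv y" "p \<ge> 0" "q \<ge> 0" "p > 0 \<or> q > 0"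
  shows "posv (\<lambda>t. p * x t + q * y t)"
proof -
  from assms obtain t t' where t: "x t > 0" "y t' > 0" unfolding posv_def by blast
  have n: "x t \<ge> 0" "y t \<ge> 0" for t using assms unfolding posv_def by auto
  have "\<exists>t. p * x t + q * y t > 0"
    using assms(5)
  proof
    assume "p > 0" then have "p * x t + q * y t > 0" using t n assms by (intro add_pos_nonneg) auto
    then show ?thesis by blast
  next
    assume "q > 0" then have "p * x t' + q * y t' > 0" using t n assms by (intro add_nonneg_pos) auto
    then show ?thesis by blast
  qed
  then show ?thesis unfolding posv_def using assms n by auto
qed

lemma posv_al [simp]: "posv (al s)"
  unfolding posv_def al_def by auto

text \<open>Cut (st)^m = 1 in the middle: the two halves are inverse to each other, and inversion
  reverses an alternating word.\<close>

lemma cls_braid: assumes "s \<in> S" "t \<in> S" "s \<noteq> t" "M s t = enat m"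
  shows "cls (alt_word s t m) = cls (alt_word t s m)"
proof -
  have sub: "set (alt_word s t n) \<subseteq> S" "set (alt_word t s n) \<subseteq> S" for n
    using set_alt_word[of s t n] set_alt_word[of t s n] assms by auto
  have "cox_rel S M (alt_word s t (2 * m))"
    unfolding cox_rel_def alt_word_double using assms by blast
  then have "cox_equiv S M [] (alt_word s t (2 * m))"
    using cox_equiv.ins[of S M "[]" "[]" "[]"] by (simp add: cox_equiv.refl)
  then have e: "cls (alt_word s t (m + m)) = e"
    using cox_equiv_sym by (auto simp: cox_one_def mult_2 cls_eq_iff sub)
  have w: "cls (alt_word s t m) \<in> W" "cls (alt_word t s m) \<in> W" by (simp_all add: cls_in_W sub)
  show ?thesis
  proof (cases "even m")
    case True
    then have "cls (alt_word s t m) \<odot> cls (alt_word s t m) = e"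
      using e sub by (simp add: alt_word_add mul_cls)
    then have "iv (cls (alt_word s t m)) = cls (alt_word s t m)" using w iv_unique by blast
    moreover have "iv (cls (alt_word s t m)) = cls (alt_word t s m)"
      using True sub by (simp add: iv_cls rev_alt_word)
    ultimately show ?thesis by simp
  next
    case False
    then have "cls (alt_word t s m) \<odot> cls (alt_word s t m) = e"
      using e sub by (simp add: alt_word_add mul_cls)
    then have "iv (cls (alt_word t s m)) = cls (alt_word s t m)" using w iv_unique by blast
    moreover have "iv (cls (alt_word t s m)) = cls (alt_word t s m)"
      using False sub by (simp add: iv_cls rev_alt_word)
    ultimately show ?thesis by simp
  qed
qed

text \<open>For k < m the angles k pi/m and (k+1) pi/m lie in [0, pi], where the sine is
  nonnegative. With an infinite label the sequence is just \<open>n\<close>.\<close>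

lemma cheb_nonneg: assumes "s \<in> S" "t \<in> S" "s \<noteq> t" "k \<ge> 1" and k: "\<And>m. M s t = enat m \<Longrightarrow> k < m"
  shows "cheb (- 2 * bm s t) k > 0 \<and> cheb (- 2 * bm s t) (Suc k) \<ge> 0"
proof (cases "M s t")
  case (enat m)
  note b = bm_finite[OF assms(1-3) enat]
  have km: "k < m" using k enat by auto
  have "real k * (pi / m) < pi" using km b by (simp add: field_simps)
  then have "sin (real k * (pi / m)) > 0" using assms(4) km by (intro sin_gt_zero) auto
  then have 1: "cheb (- 2 * bm s t) k * sin (pi / m) > 0" unfolding b(2) cheb_sin .
  have "real (Suc k) \<le> real m" using km by simp
  then have "real (Suc k) * (pi / m) \<le> pi" using b by (simp add: divide_le_eq mult.commute[of pi])
  then have "sin (real (Suc k) * (pi / m)) \<ge> 0" by (intro sin_ge_zero) auto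
  then have "cheb (- 2 * bm s t) (Suc k) * sin (pi / m) \<ge> 0" unfolding b(2) cheb_sin .
  then show ?thesis using 1 b(3) by (simp add: zero_less_mult_iff zero_le_mult_iff)
next
  case infinity
  then have "- 2 * bm s t = 2" by (simp add: bm_def)
  then show ?thesis using assms(4) by (simp add: cheb_2)
qed

text \<open>The classical argument of Tits. Take a right descent \<open>t\<close> and split off the
  longest alternating suffix in \<open>s\<close> and \<open>t\<close> that ends in \<open>t\<close>.
  The rest \<open>v\<close> is shorter and has neither letter as a descent, hence keeps both simple
  roots positive; the suffix contributes nonnegative Chebyshev coefficients.\<close>

lemma act_al_pos: assumes "w \<in> W" "s \<in> S" "len (w \<odot> g s) > len w" shows "posv (act w (al s))"
  using assms
proof (induction "len w" arbitrary: w s rule: less_induct)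
  case less
  show ?case
  proof (cases "w = e")
    case False
    obtain t where t: "t \<in> S" "Suc (len (w \<odot> g t)) = len w"
      by (rule ex_right_descent[OF less.prems(1) False])
    have st: "s \<noteq> t" using t less.prems by auto
    have sub: "set (alt_word s t n) \<subseteq> S" for n using set_alt_word[of s t n] t less.prems by auto
    define K where "K = {k. \<exists>v\<in>W. w = v \<odot> cls (alt_word s t k) \<and> len v + k = len w}"
    have "K \<subseteq> {..len w}" unfolding K_def by auto
    then have fK: "finite K" by (rule finite_subset) simp
    have K1: "1 \<in> K" unfolding K_def using t less.prems by (auto intro!: bexI[of _ "w \<odot> g t"])
    define k where "k = Max K"
    have "K \<noteq> {}" using K1 by auto
    then have kK: "k \<in> K" "1 \<le> k" unfolding k_def using Max_in[OF fK] Max_ge[OF fK K1] by auto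
    have kmax: "Suc k \<notin> K" using Max_ge[OF fK, of "Suc k"] by (auto simp: k_def)
    obtain v where v: "v \<in> W" "w = v \<odot> cls (alt_word s t k)" "len v + k = len w"
      using kK unfolding K_def by auto
    have aw: "alt_word s t k = (if even k then s else t) # alt_word s t (k - 1)"
      using alt_word_Suc_left[of s t "k - 1"] kK(2) by (cases k) auto
    define x where "x = (if even k then t else s)"
    define y where "y = (if even k then s else t)"
    have xy: "x \<in> S" "y \<in> S" "{x, y} = {s, t}" using t less.prems by (auto simp: x_def y_def)
    \<comment> \<open>The letter \<open>x\<close> would extend the alternating suffix, so a descent
      of \<open>v\<close> at \<open>x\<close> contradicts the maximality of \<open>k\<close>. A
      descent at the other letter \<open>y\<close> would cancel against the first letter of the
      suffix.\<close>
    have 1: "len (v \<odot> g x) > len v"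
    proof (rule ccontr)
      assume "\<not> ?thesis"
      then have "Suc (len (v \<odot> g x)) = len v" using len_mul_g[OF v(1) xy(1)] by auto
      moreover have "cls (alt_word s t (Suc k)) = g x \<odot> cls (alt_word s t k)"
        unfolding alt_word_Suc_left x_def[symmetric] by (rule cls_Cons[OF xy(1) sub])
      then have "w = (v \<odot> g x) \<odot> cls (alt_word s t (Suc k))"
        using v(1) xy(1) sub[of k] by (simp add: v(2) cls_in_W mul_assoc)
      ultimately have "v \<odot> g x \<in> W \<and> w = (v \<odot> g x) \<odot> cls (alt_word s t (Suc k)) \<and>
          len (v \<odot> g x) + Suc k = len w"
        using v(1) xy(1) v(3) by (simp del: alt_word.simps)
      then have "Suc k \<in> K" unfolding K_def by blast
      then show False using kmax by simp
    qed
    have 2: "len (v \<odot> g y) > len v"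
    proof (rule ccontr)
      assume "\<not> ?thesis"
      then have l: "Suc (len (v \<odot> g y)) = len v" using len_mul_g[OF v(1) xy(2)] by auto
      have "cls (alt_word s t k) = g y \<odot> cls (alt_word s t (k - 1))"
        unfolding aw y_def[symmetric] by (rule cls_Cons[OF xy(2) sub])
      then have "w = (v \<odot> g y) \<odot> cls (alt_word s t (k - 1))"
        using v(1) xy(2) sub[of "k - 1"] by (simp add: v(2) cls_in_W mul_assoc)
      then have "len w \<le> len (v \<odot> g y) + len (cls (alt_word s t (k - 1)))"
        using len_mul_le[of "v \<odot> g y" "cls (alt_word s t (k - 1))"] v(1) xy(2) sub[of "k - 1"]
        by (simp add: cls_in_W)
      also have "\<dots> \<le> len (v \<odot> g y) + (k - 1)" using len_cls_le[OF sub[of "k - 1"]] by simp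
      finally show False using l v kK by linarith
    qed
    have lv: "len v < len w" using v kK by simp
    have "posv (act v (al x))" "posv (act v (al y))"
      using less.hyps[OF lv v(1) xy(1) 1] less.hyps[OF lv v(1) xy(2) 2] .
    then have p: "posv (act v (al s))" "posv (act v (al t))"
      by (cases "even k"; simp add: x_def y_def)+
    \<comment> \<open>If the suffix had length at least m, the braid relation would make it end in
      \<open>s\<close>, and \<open>s\<close> would shorten \<open>w\<close>.\<close>
    have km: "k < m" if m: "M s t = enat m" for m
    proof (rule ccontr)
      assume "\<not> k < m"
      then obtain j where j: "k = j + m" by (metis add.commute le_Suc_ex not_less)
      have sub': "set (alt_word t s n) \<subseteq> S" for n using set_alt_word[of t s n] t less.prems by auto
      have m2: "m \<ge> 2" using bm_finite less.prems t st m by auto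
      let ?p = "if even m then alt_word s t j else alt_word t s j"
      have "cls (alt_word s t k) = cls ?p \<odot> cls (alt_word s t m)"
        unfolding j alt_word_add using sub sub' by (simp add: mul_cls)
      also have "cls (alt_word s t m) = cls (alt_word t s m)"
        using cls_braid less.prems t st m by blast
      also have "\<dots> = cls (alt_word s t (m - 1)) \<odot> g s"
        using m2 sub less.prems by (cases m) (auto simp: cls_snoc)
      finally have "w \<odot> g s = v \<odot> cls ?p \<odot> cls (alt_word s t (m - 1))"
        using v sub sub' less.prems by (simp add: cls_in_W mul_assoc)
      then have "w \<odot> g s = v \<odot> cls (?p @ alt_word s t (m - 1))"
        using v sub sub' by (simp add: cls_in_W mul_assoc mul_cls)
      then have "len (w \<odot> g s) \<le> len v + length (?p @ alt_word s t (m - 1))"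
        using len_mul_le[of v "cls (?p @ alt_word s t (m - 1))"]
          len_cls_le[of "?p @ alt_word s t (m - 1)"] v sub sub' by (force simp: cls_in_W)
      also have "\<dots> < len w" using v j m2 by (auto split: if_splits)
      finally show False using less.prems by simp
    qed
    let ?c = "cheb (- 2 * bm s t)"
    have c: "?c k > 0" "?c (Suc k) \<ge> 0" using cheb_nonneg[OF less.prems(2) t(1) st kK(2) km] by auto
    have eq: "act w (al s) = act v (wact (alt_word s t k) (al s))"
      using v sub by (simp add: act_mul act_cls cls_in_W)
    have "wact (alt_word s t k) (al s) = (if even k then vec s t else vec t s) (?c (Suc k)) (?c k)"
      using alt_word_cheb[OF less.prems(2) t(1), of k 0] by (simp add: al_vec(1)[of s t])
    then have "act w (al s) = (if even k
       then (\<lambda>r. ?c (Suc k) * act v (al s) r + ?c k * act v (al t) r)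
       else (\<lambda>r. ?c (Suc k) * act v (al t) r + ?c k * act v (al s) r))"
      unfolding eq vec_def by (simp add: act_lin)
    moreover have "posv (\<lambda>r. ?c (Suc k) * act v (al s) r + ?c k * act v (al t) r)"
      "posv (\<lambda>r. ?c (Suc k) * act v (al t) r + ?c k * act v (al s) r)"
      using c by (auto intro!: posv_comb p)
    ultimately show ?thesis by presburger
  qed simp
qed

lemma act_al_neg: assumes "w \<in> W" "s \<in> S" "len (w \<odot> g s) < len w" shows "negv (act w (al s))"
proof -
  have "posv (act (w \<odot> g s) (al s))" using act_al_pos[of "w \<odot> g s" s] assms by simp
  moreover have "act (w \<odot> g s) (al s) = (\<lambda>t. - act w (al s) t)"
    using assms by (simp add: act_mul refl_al_self act_uminus)
  ultimately show ?thesis by (simp add: posv_neg)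
qed

lemma act_al_pos_iff: assumes "w \<in> W" "s \<in> S"
  shows "posv (act w (al s)) \<longleftrightarrow> len (w \<odot> g s) = Suc (len w)"
    and "negv (act w (al s)) \<longleftrightarrow> Suc (len (w \<odot> g s)) = len w"
proof -
  consider "len (w \<odot> g s) = Suc (len w)" "posv (act w (al s))"
    | "Suc (len (w \<odot> g s)) = len w" "negv (act w (al s))"
    using act_al_pos[OF assms] act_al_neg[OF assms] len_mul_g[OF assms] by fastforce
  then have "(posv (act w (al s)) \<longleftrightarrow> len (w \<odot> g s) = Suc (len w)) \<and>
     (negv (act w (al s)) \<longleftrightarrow> Suc (len (w \<odot> g s)) = len w)"
    by cases (use not_posv_negv in auto)
  then show "posv (act w (al s)) \<longleftrightarrow> len (w \<odot> g s) = Suc (len w)"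
    "negv (act w (al s)) \<longleftrightarrow> Suc (len (w \<odot> g s)) = len w" by auto
qed

text \<open>A nontrivial element has a right descent and so makes a simple root negative.
  Faithfulness serves to identify a reflection by its root.\<close>

lemma act_faithful: assumes "w \<in> W" "v \<in> W" "\<And>s. s \<in> S \<Longrightarrow> act w (al s) = act v (al s)" shows "w = v"
proof (rule ccontr)
  assume "w \<noteq> v"
  have z: "iv v \<odot> w \<in> W" "iv v \<odot> w \<noteq> e"
    using assms \<open>w \<noteq> v\<close> iv_unique[of "iv v" w] by auto
  obtain s where s: "s \<in> S" "Suc (len (iv v \<odot> w \<odot> g s)) = len (iv v \<odot> w)"
    by (rule ex_right_descent[OF z])
  then have "negv (act (iv v \<odot> w) (al s))" using act_al_pos_iff z by blast
  moreover have "act (iv v \<odot> w) (al s) = al s" using assms s by (simp add: act_mul)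
  ultimately show False using not_posv_negv posv_al by metis
qed

end

section \<open>Dominance of roots\<close>

lemma cheb_incr: assumes "k \<ge> 2" shows "cheb k n \<ge> 0 \<and> cheb k (Suc n) - cheb k n \<ge> 1"
proof (induction n)
  case (Suc n)
  have 1: "cheb k (Suc n) \<ge> 0" using Suc by linarith
  have 2: "2 * cheb k (Suc n) \<le> k * cheb k (Suc n)" by (rule mult_right_mono[OF assms 1])
  show ?case using 1 2 Suc unfolding cheb.simps(3) by linarith
qed simp

context coxeter
begin

definition bf :: "('s \<Rightarrow> real) \<Rightarrow> ('s \<Rightarrow> real) \<Rightarrow> real" where
  "bf x y = (\<Sum>s\<in>S. y s * bl x s)"

definition ht :: "('s \<Rightarrow> real) \<Rightarrow> real" where
  "ht x = (\<Sum>s\<in>S. x s)"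

lemma bf_lin1: "bf (\<lambda>t. p * x t + q * y t) z = p * bf x z + q * bf y z"
  unfolding bf_def bl_lin by (simp add: sum.distrib sum_distrib_left algebra_simps)

lemma bf_lin2: "bf z (\<lambda>t. p * x t + q * y t) = p * bf z x + q * bf z y"
  unfolding bf_def by (simp add: sum.distrib sum_distrib_left algebra_simps)

lemma bf_sym: "bf x y = bf y x"
proof -
  have "bf x y = (\<Sum>s\<in>S. \<Sum>r\<in>S. y s * (x r * bm r s))"
    unfolding bf_def bl_def by (simp add: sum_distrib_left)
  also have "\<dots> = (\<Sum>r\<in>S. \<Sum>s\<in>S. y s * (x r * bm r s))" by (rule sum.swap)
  also have "\<dots> = (\<Sum>r\<in>S. \<Sum>s\<in>S. x r * (y s * bm s r))"
    using bm_sym by (intro sum.cong) auto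
  also have "\<dots> = bf y x" unfolding bf_def bl_def by (simp add: sum_distrib_left)
  finally show ?thesis .
qed

lemma bf_al: assumes "s \<in> S" shows "bf x (al s) = bl x s"
proof -
  have "bf x (al s) = (\<Sum>r\<in>S. if r = s then bl x r else 0)"
    unfolding bf_def al_def by (intro sum.cong) auto
  then show ?thesis using assms finite_S by simp
qed

lemma bf_al': "s \<in> S \<Longrightarrow> bf (al s) x = bl x s"
  using bf_al bf_sym by metis

lemma ht_lin: "ht (\<lambda>t. p * x t + q * y t) = p * ht x + q * ht y"
  unfolding ht_def by (simp add: sum.distrib sum_distrib_left)

text \<open>The factor 1 gives \<open>refl\<close> the shape p x + q y to which the linearity rules
  apply; \<open>rfl\<close> is written in the same way.\<close>

lemma refl_alt: "refl s x = (\<lambda>t. 1 * x t + (- 2 * bl x s) * al s t)"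
  by (simp add: refl_def)

lemma bf_refl: assumes "s \<in> S" shows "bf (refl s x) (refl s y) = bf x y"
  unfolding refl_alt bf_lin1 bf_lin2 using assms
  by (simp add: bf_al bf_al' bl_al algebra_simps)

lemma bf_wact: "set u \<subseteq> S \<Longrightarrow> bf (wact u x) (wact u y) = bf x y"
  by (induction u) (simp_all add: bf_refl)

lemma bf_act: "w \<in> W \<Longrightarrow> bf (act w x) (act w y) = bf x y"
  unfolding act_def by (rule bf_wact) (rule rp)

section \<open>The root system and inversions\<close>

definition roots :: "('s \<Rightarrow> real) set" where
  "roots = {act w (al s) | w s. w \<in> W \<and> s \<in> S}"

definition posr :: "('s \<Rightarrow> real) set" where
  "posr = {x \<in> roots. posv x}"

lemma rootsI: "w \<in> W \<Longrightarrow> s \<in> S \<Longrightarrow> act w (al s) \<in> roots"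
  unfolding roots_def by auto

lemma roots_al [simp]: "s \<in> S \<Longrightarrow> al s \<in> roots"
  using rootsI[of e s] by simp

lemma posr_al [simp]: "s \<in> S \<Longrightarrow> al s \<in> posr"
  unfolding posr_def by simp

lemma act_roots: assumes "w \<in> W" "x \<in> roots" shows "act w x \<in> roots"
proof -
  obtain v s where "v \<in> W" "s \<in> S" "x = act v (al s)" using assms unfolding roots_def by auto
  then have "act w x = act (w \<odot> v) (al s)" "w \<odot> v \<in> W" "s \<in> S" using assms by (simp_all add: act_mul)
  then show ?thesis using rootsI by simp
qed

lemma refl_roots: "s \<in> S \<Longrightarrow> x \<in> roots \<Longrightarrow> refl s x \<in> roots"
  using act_roots[of "g s" x] by simp

lemma roots_uminus: assumes "x \<in> roots" shows "(\<lambda>t. - x t) \<in> roots"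
proof -
  obtain v s where v: "v \<in> W" "s \<in> S" "x = act v (al s)" using assms unfolding roots_def by auto
  have "(\<lambda>t. - x t) = act (v \<odot> g s) (al s)"
    using v by (simp add: act_mul refl_al_self act_uminus)
  then show ?thesis using rootsI[of "v \<odot> g s" s] v by simp
qed

lemma roots_norm: "x \<in> roots \<Longrightarrow> bf x x = 1"
  unfolding roots_def by (auto simp: bf_act bf_al bl_al)

lemma roots_cases: assumes "x \<in> roots" obtains "posv x" | "negv x"
proof -
  obtain v s where v: "v \<in> W" "s \<in> S" "x = act v (al s)" using assms unfolding roots_def by auto
  then show ?thesis using that len_mul_g[of v s] act_al_pos_iff[of v s] by auto
qed

lemma wact_support: "t \<notin> S \<Longrightarrow> set u \<subseteq> S \<Longrightarrow> wact u x t = x t"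
  by (induction u) (auto simp: refl_def al_def)

lemma roots_support: assumes "x \<in> roots" "t \<notin> S" shows "x t = 0"
proof -
  obtain v s where v: "v \<in> W" "s \<in> S" "x = act v (al s)" using assms unfolding roots_def by auto
  then have "x t = al s t" unfolding act_def using wact_support[OF assms(2)] rp by simp
  then show ?thesis using v assms by (auto simp: al_def)
qed

lemma posrD: "x \<in> posr \<Longrightarrow> x \<in> roots" "x \<in> posr \<Longrightarrow> posv x"
  by (simp_all add: posr_def)

lemma posr_uminus: "x \<in> roots \<Longrightarrow> negv x \<Longrightarrow> (\<lambda>t. - x t) \<in> posr"
  by (simp add: posr_def roots_uminus posv_neg)

lemma ht_pos: assumes "x \<in> roots" shows "posv x \<longleftrightarrow> ht x > 0" "negv x \<longleftrightarrow> ht x < 0"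
proof -
  have 1: "ht x > 0" if x: "x \<in> roots" "posv x" for x
  proof -
    obtain t where t: "x t > 0" using x unfolding posv_def by auto
    then have "t \<in> S" using roots_support[OF x(1), of t] by auto
    then show ?thesis unfolding ht_def
      using x t by (intro sum_pos2[OF finite_S, of t]) (auto simp: posv_def)
  qed
  have 2: "ht x < 0" if "negv x"
    using 1[OF roots_uminus[OF assms]] that ht_lin[of "-1" x 0 x] by (simp add: posv_neg)
  have "posv x \<or> negv x" using assms by (rule roots_cases) auto
  then show "posv x \<longleftrightarrow> ht x > 0" "negv x \<longleftrightarrow> ht x < 0"
    using 1[OF assms] 2 by linarith+
qed

lemma root_multiple: assumes "x \<in> roots" "y \<in> roots" "x = (\<lambda>t. c * y t)" "c \<ge> 0" shows "x = y"
proof -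
  have "bf x x = c * c * bf y y"
    unfolding assms(3) using bf_lin1[of c y 0 y] bf_lin2[of _ c y 0 y] by simp
  then have "c * c = 1" using roots_norm assms(1,2) by simp
  then have "c\<^sup>2 = 1" by (simp add: power2_eq_square)
  then have "c = 1" using assms(4) by (auto simp: power2_eq_1_iff)
  then show ?thesis using assms(3) by simp
qed

text \<open>The reflection changes only the coordinate at \<open>s\<close>. A positive root other
  than \<open>al s\<close> has a positive coordinate elsewhere, and roots have no mixed
  signs.\<close>

lemma refl_posr: assumes "x \<in> posr" "s \<in> S" "x \<noteq> al s" shows "refl s x \<in> posr"
proof -
  have x: "x \<in> roots" "posv x" using assms posrD by auto
  have r: "refl s x \<in> roots" using x assms refl_roots by simp
  have "\<exists>t. t \<noteq> s \<and> x t > 0"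
  proof (rule ccontr)
    assume n: "\<not> ?thesis"
    have "x t = x s * al s t" for t
    proof (cases "t = s")
      case False
      then have "x t \<le> 0" "x t \<ge> 0" using n x(2) unfolding posv_def by (auto simp: not_less)
      then show ?thesis using False by (simp add: al_def)
    qed (simp add: al_def)
    then have "x = (\<lambda>t. x s * al s t)" by (rule ext)
    moreover have "x s \<ge> 0" using x(2) by (simp add: posv_def)
    ultimately have "x = al s" using root_multiple[OF x(1) roots_al[OF assms(2)], of "x s"] by simp
    then show False using assms by simp
  qed
  then obtain t where "t \<noteq> s" "x t > 0" by auto
  then have "refl s x t > 0" by (simp add: refl_def al_def)
  then have "\<not> negv (refl s x)" unfolding negv_def by (auto simp: not_le)
  then show ?thesis using r roots_cases[OF r] by (auto simp: posr_def)
qed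

lemma refl_neg_iff: assumes "x \<in> posr" "s \<in> S" "negv (refl s x)" shows "x = al s"
  using refl_posr[OF assms(1,2)] assms(3) posrD(2) not_posv_negv by blast

definition Ninv :: "'s list set \<Rightarrow> ('s \<Rightarrow> real) set" where
  "Ninv w = {x \<in> posr. negv (act w x)}"

text \<open>By \<open>refl_posr\<close> a further letter creates at most one new inversion.\<close>

lemma finite_Ninv_word: "set u \<subseteq> S \<Longrightarrow> finite {x \<in> posr. negv (wact u x)}"
proof (induction u rule: rev_induct)
  case Nil
  have "{x \<in> posr. negv (wact [] x)} = {}" using posrD not_posv_negv by auto
  then show ?case by (metis finite.emptyI)
next
  case (snoc s u)
  then have s: "s \<in> S" and u: "set u \<subseteq> S" by auto
  have "{x \<in> posr. negv (wact (u @ [s]) x)} \<subseteq> insert (al s) (refl s ` {x \<in> posr. negv (wact u x)})"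
  proof
    fix x assume x: "x \<in> {x \<in> posr. negv (wact (u @ [s]) x)}"
    show "x \<in> insert (al s) (refl s ` {x \<in> posr. negv (wact u x)})"
    proof (cases "x = al s")
      case False
      then have "refl s x \<in> posr" using x s refl_posr by auto
      moreover have "negv (wact u (refl s x))" using x by (simp add: wact_append)
      moreover have "x = refl s (refl s x)" using refl_refl s by simp
      ultimately show ?thesis by blast
    qed simp
  qed
  then show ?case using snoc.IH[OF u] finite_subset by blast
qed

lemma finite_Ninv: "w \<in> W \<Longrightarrow> finite (Ninv w)"
  unfolding Ninv_def act_def by (rule finite_Ninv_word) (rule rp)

section \<open>Reflections in arbitrary roots, and dominance\<close>

definition rfl :: "('s \<Rightarrow> real) \<Rightarrow> ('s \<Rightarrow> real) \<Rightarrow> 's \<Rightarrow> real" where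
  "rfl y x = (\<lambda>t. 1 * x t + (- 2 * bf x y) * y t)"

lemma act_reflection: assumes "w \<in> W" "s \<in> S"
  shows "act (w \<odot> g s \<odot> iv w) x = rfl (act w (al s)) x"
proof -
  have "act (w \<odot> g s \<odot> iv w) x = act w (refl s (act (iv w) x))" using assms by (simp add: act_mul)
  also have "\<dots> = (\<lambda>t. 1 * x t + (- 2 * bl (act (iv w) x) s) * act w (al s) t)"
    unfolding refl_alt act_lin using assms by simp
  also have "bl (act (iv w) x) s = bf (act w (act (iv w) x)) (act w (al s))"
    unfolding bf_act[OF assms(1)] bf_al[OF assms(2)] ..
  finally show ?thesis using assms by (simp add: rfl_def)
qed

lemma rfl_roots: assumes "y \<in> roots" "x \<in> roots" shows "rfl y x \<in> roots"
proof -
  obtain v s where v: "v \<in> W" "s \<in> S" "y = act v (al s)" using assms unfolding roots_def by auto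
  then have "rfl y x = act (v \<odot> g s \<odot> iv v) x" using act_reflection by simp
  then show ?thesis using act_roots v assms by simp
qed

text \<open>Both conjugates act as the reflection in the same root, and the representation is
  faithful.\<close>

lemma reflection_eqI: assumes "w \<in> W" "s \<in> S" "v \<in> W" "t \<in> S" "act w (al s) = act v (al t)"
  shows "w \<odot> g s \<odot> iv w = v \<odot> g t \<odot> iv v"
  by (rule act_faithful) (use assms act_reflection in simp_all)

text \<open>The dominance order of Brink and Howlett, expressed through signs.\<close>

definition dom :: "('s \<Rightarrow> real) \<Rightarrow> ('s \<Rightarrow> real) \<Rightarrow> bool" where
  "dom x y \<longleftrightarrow> (\<forall>w\<in>W. negv (act w x) \<longrightarrow> negv (act w y))"

text \<open>If \<open>x\<close> did not dominate \<open>y\<close>, infinitely many of the roots \<open>U\<^sub>n x - U\<^sub>n\<^sub>-\<^sub>1 y\<close>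
  of the infinite dihedral group generated by the two reflections would be inversions
  of a single element.\<close>

lemma dom_of_height: assumes x: "x \<in> posr" and y: "y \<in> posr" and B: "bf x y \<ge> 1" and h: "ht y \<le> ht x"
  shows "dom x y"
proof (rule ccontr)
  assume "\<not> dom x y"
  then obtain w where w: "w \<in> W" "negv (act w x)" "\<not> negv (act w y)" unfolding dom_def by auto
  have R: "x \<in> roots" "y \<in> roots" using x y posrD by auto
  have py: "posv (act w y)" using w(3) act_roots[OF w(1) R(2)] by (auto elim: roots_cases)
  have ne: "x \<noteq> y" using w by auto
  let ?c = "cheb (2 * bf x y)"
  have c: "?c n \<ge> 0" "?c (Suc n) - ?c n \<ge> 1" for n using cheb_incr[of "2 * bf x y" n] B by auto
  define r where "r n = (\<lambda>t. ?c (Suc n) * x t + (- ?c n) * y t)" for n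
  define r' where "r' n = (\<lambda>t. ?c (Suc n) * y t + (- ?c n) * x t)" for n
  have n1: "bf x x = 1" "bf y y = 1" "bf y x = bf x y" using roots_norm R bf_sym by auto
  have r1: "rfl y (r n) = (\<lambda>t. - r' (Suc n) t)" for n
    unfolding rfl_def r_def r'_def bf_lin1 using n1 by (simp add: algebra_simps)
  have r2: "rfl x (r' n) = (\<lambda>t. - r (Suc n) t)" for n
    unfolding rfl_def r_def r'_def bf_lin1 using n1 by (simp add: algebra_simps)
  \<comment> \<open>Up to sign the two reflections lead from \<open>r\<close> to \<open>r'\<close>
    and back, each time raising the index.\<close>
  have "r n \<in> roots \<and> r' n \<in> roots" for n
  proof (induction n)
    case 0 then show ?case using R by (simp add: r_def r'_def)
  next
    case (Suc n)
    have "r (Suc n) = (\<lambda>t. - rfl x (r' n) t)" "r' (Suc n) = (\<lambda>t. - rfl y (r n) t)"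
      unfolding r1 r2 by simp_all
    then show ?case using Suc R rfl_roots roots_uminus by simp
  qed
  then have rr: "r n \<in> roots" for n by blast
  have hx: "ht x > 0" using ht_pos R x posrD by blast
  \<comment> \<open>Here the comparison of heights enters: with B at least 1 the sequence grows by
    at least 1 at each step, so the multiple of \<open>x\<close> outweighs that of
    \<open>y\<close>.\<close>
  have "ht (r n) > 0" for n
  proof -
    have "?c n * ht y \<le> ?c n * ht x" using c h by (intro mult_left_mono) auto
    then have "ht (r n) \<ge> (?c (Suc n) - ?c n) * ht x" unfolding r_def ht_lin by (simp add: algebra_simps)
    moreover have "(?c (Suc n) - ?c n) * ht x > 0" using c[of n] hx by (intro mult_pos_pos) linarith+
    ultimately show ?thesis by linarith
  qed
  then have pr: "r n \<in> posr" for n using rr ht_pos posr_def by blast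
  have "negv (act w (r n))" for n
  proof -
    have "act w (r n) t \<le> 0" for t
    proof -
      have "?c (Suc n) * act w x t \<le> 0" using w(2) c[of n] by (intro mult_nonneg_nonpos) (auto simp: negv_def)
      moreover have "?c n * act w y t \<ge> 0" using py c by (intro mult_nonneg_nonneg) (auto simp: posv_def)
      ultimately show ?thesis unfolding r_def act_lin by simp
    qed
    then have "\<not> posv (act w (r n))" unfolding posv_def by (meson not_le)
    then show ?thesis using act_roots[OF w(1) rr] by (auto elim: roots_cases)
  qed
  then have sub: "range r \<subseteq> Ninv w" using pr by (auto simp: Ninv_def)
  have "inj r"
  proof (rule linorder_injI)
    fix m n :: nat assume mn: "m < n"
    have mono: "?c i < ?c j" if "i < j" for i j
      using that by (rule strict_monoD[OF strict_monoI_Suc, rotated]) (use c in \<open>smt (verit)\<close>)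
    show "r m \<noteq> r n"
    proof
      assume eq: "r m = r n"
      have d: "?c (Suc n) - ?c (Suc m) > 0" "?c n - ?c m > 0" using mono[of "Suc m" "Suc n"] mono[OF mn] mn by auto
      have "(?c (Suc n) - ?c (Suc m)) * x t = (?c n - ?c m) * y t" for t
        using fun_cong[OF eq, of t] unfolding r_def by (simp add: algebra_simps)
      then have "x = (\<lambda>t. (?c n - ?c m) / (?c (Suc n) - ?c (Suc m)) * y t)"
        using d by (auto simp: field_simps)
      then have "x = y" by (rule root_multiple[OF R]) (use d in simp)
      then show False using ne by simp
    qed
  qed
  then have "infinite (range r)" by (rule range_inj_infinite)
  then show False using finite_subset[OF sub finite_Ninv[OF w(1)]] by blast
qed

section \<open>Inner products in finite parabolic root systems\<close>

definition Rsub :: "'s set \<Rightarrow> ('s \<Rightarrow> real) set" where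
  "Rsub T = {x \<in> roots. \<forall>t. t \<notin> T \<longrightarrow> x t = 0}"

text \<open>The finiteness of this set turns the inner products in (-1, 1) into a finite alphabet
  for the pigeonhole argument in \<open>elem_dp_bounded\<close>.\<close>

definition Evals :: "real set" where
  "Evals = {bf a b | a b T. T \<subseteq> S \<and> finite (Rsub T) \<and> a \<in> Rsub T \<and> b \<in> Rsub T}"

lemma finite_Evals: "finite Evals"
proof -
  have "Evals \<subseteq> (\<Union>T\<in>{T\<in>Pow S. finite (Rsub T)}. (\<lambda>(a,b). bf a b) ` (Rsub T \<times> Rsub T))"
    unfolding Evals_def by auto
  moreover have "finite \<dots>" using finite_S by auto
  ultimately show ?thesis by (rule finite_subset)
qed

lemma linear_expand:
  assumes L: "\<And>p q x y. L (\<lambda>t. p * x t + q * y t) = p * L x + q * (L y :: real)"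
    and x: "\<And>t. t \<notin> S \<Longrightarrow> x t = 0"
  shows "L x = (\<Sum>s\<in>S. x s * L (al s))"
proof -
  have "\<forall>x. (\<forall>t. t \<notin> A \<longrightarrow> x t = 0) \<longrightarrow> L x = (\<Sum>s\<in>A. x s * L (al s))" if "finite A" for A
    using that
  proof (induction A)
    case empty
    show ?case
    proof (intro allI impI)
      fix x :: "'s \<Rightarrow> real" assume "\<forall>t. t \<notin> {} \<longrightarrow> x t = 0"
      then have "x = (\<lambda>t. 0)" by auto
      then show "L x = (\<Sum>s\<in>{}. x s * L (al s))" using L[of 0 "\<lambda>t. 0" 0 "\<lambda>t. 0"] by simp
    qed
  next
    case (insert a A)
    show ?case
    proof (intro allI impI)
      fix x :: "'s \<Rightarrow> real" assume x: "\<forall>t. t \<notin> insert a A \<longrightarrow> x t = 0"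
      define y where "y = x(a := 0)"
      have "x = (\<lambda>t. 1 * y t + x a * al a t)" by (auto simp: y_def al_def)
      then have "L x = L y + x a * L (al a)" using L[of 1 y "x a" "al a"] by simp
      also have "L y = (\<Sum>s\<in>A. y s * L (al s))" using insert.IH x by (auto simp: y_def)
      also have "\<dots> = (\<Sum>s\<in>A. x s * L (al s))" using insert.hyps by (intro sum.cong) (auto simp: y_def)
      finally show "L x = (\<Sum>s\<in>insert a A. x s * L (al s))" using insert.hyps by simp
    qed
  qed
  then show ?thesis using finite_S x by blast
qed

text \<open>A nonnegative combination of points of chambers lies in some closed chamber, so
  two roots vanishing on it are conjugate into a finite parabolic root system.\<close>

lemma bf_in_Evals:
  assumes R: "x \<in> roots" "y \<in> roots" and h: "h \<in> W" "h' \<in> W" "c \<ge> 0"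
    and p0: "ht x + c * ht (act h x) + ht (act h' x) = 0" "ht y + c * ht (act h y) + ht (act h' y) = 0"
  shows "bf x y \<in> Evals"
proof -
  \<comment> \<open>The functional \<open>ht\<close> is positive on simple roots, so it is an
    interior point of the fundamental chamber. As \<open>p\<close> adds nonnegative multiples of
    translates of it, \<open>p\<close> lies in the Tits cone and is nonpositive on finitely many
    positive roots only.\<close>
  define p where "p z = ht z + c * ht (act h z) + ht (act h' z)" for z
  have plin: "p (\<lambda>t. a * z t + b * z' t) = a * p z + b * p z'" for a b z z'
    unfolding p_def act_lin ht_lin by (simp add: algebra_simps)
  have puminus: "p (\<lambda>t. - z t) = - p z" for z using plin[of "-1" z 0 z] by simp
  have "{z \<in> posr. p z \<le> 0} \<subseteq> Ninv h \<union> Ninv h'"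
  proof
    fix z assume z: "z \<in> {z \<in> posr. p z \<le> 0}"
    then have zr: "z \<in> roots" "ht z > 0" using posrD ht_pos by auto
    show "z \<in> Ninv h \<union> Ninv h'"
    proof (rule ccontr)
      assume n: "z \<notin> Ninv h \<union> Ninv h'"
      then have "ht (act h z) \<ge> 0" "ht (act h' z) \<ge> 0"
        using z ht_pos(2)[OF act_roots[OF h(1) zr(1)]] ht_pos(2)[OF act_roots[OF h(2) zr(1)]]
        by (auto simp: Ninv_def)
      then have "c * ht (act h z) \<ge> 0" using h by simp
      then show False using z zr \<open>ht (act h' z) \<ge> 0\<close> by (auto simp: p_def)
    qed
  qed
  then have F: "finite {z \<in> posr. p z \<le> 0}" using finite_Ninv h by (meson finite_UnI finite_subset)
  have Fu: "finite {z \<in> posr. p (act u z) \<le> 0}" if u: "u \<in> W" for u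
  proof -
    have "{z \<in> posr. p (act u z) \<le> 0} \<subseteq> act (iv u) ` {z \<in> posr. p z \<le> 0} \<union> Ninv u"
    proof
      fix z assume z: "z \<in> {z \<in> posr. p (act u z) \<le> 0}"
      then have "act u z \<in> roots" using act_roots u posrD by auto
      then show "z \<in> act (iv u) ` {z \<in> posr. p z \<le> 0} \<union> Ninv u"
      proof (cases rule: roots_cases)
        case 1
        then have "act u z \<in> {z \<in> posr. p z \<le> 0}" using z \<open>act u z \<in> roots\<close> by (simp add: posr_def)
        then have "act (iv u) (act u z) \<in> act (iv u) ` {z \<in> posr. p z \<le> 0}" by (rule imageI)
        then show ?thesis using u by simp
      next
        case 2 then show ?thesis using z by (simp add: Ninv_def)
      qed
    qed
    then show ?thesis using F finite_Ninv[OF u] by (meson finite_UnI finite_imageI finite_subset)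
  qed
  define F where "F u = {z \<in> posr. p (act u z) < 0}" for u
  have fF: "finite (F u)" if "u \<in> W" for u
    using Fu[OF that] by (rule finite_subset[rotated]) (auto simp: F_def)
  \<comment> \<open>Fewest walls between the moved point and the fundamental chamber: the point then
    lies in the closed chamber, since a simple root with a negative value could be removed from the
    count by one more reflection.\<close>
  obtain u where u: "u \<in> W" "\<And>v. v \<in> W \<Longrightarrow> card (F u) \<le> card (F v)"
    using ex_has_least_nat[of "\<lambda>u. u \<in> W" e "\<lambda>u. card (F u)"] by auto
  have dominant: "p (act u (al s)) \<ge> 0" if s: "s \<in> S" for s
  proof (rule ccontr)
    assume "\<not> ?thesis"
    then have neg: "p (act u (al s)) < 0" by simp
    then have a: "al s \<in> F u" using s by (simp add: F_def)
    have "F (u \<odot> g s) \<subseteq> refl s ` (F u - {al s})"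
    proof
      fix z assume z: "z \<in> F (u \<odot> g s)"
      then have z': "z \<in> posr" "p (act u (refl s z)) < 0" using u s by (auto simp: F_def act_mul)
      have "z \<noteq> al s"
        using z' neg s by (auto simp: refl_al_self act_uminus puminus)
      then have 1: "refl s z \<in> posr" using refl_posr z' s by blast
      have "refl s z \<noteq> al s"
      proof
        assume "refl s z = al s"
        then have "z = (\<lambda>t. - al s t)" using refl_refl[OF s, of z] refl_al_self[OF s] by simp
        then have "negv z" by (simp add: negv_neg)
        then show False using z' posrD not_posv_negv by blast
      qed
      then have "refl s z \<in> F u - {al s}" using 1 z' by (simp add: F_def)
      then have "refl s (refl s z) \<in> refl s ` (F u - {al s})" by (rule imageI)
      then show "z \<in> refl s ` (F u - {al s})" using refl_refl[OF s, of z] by simp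
    qed
    then have "card (F (u \<odot> g s)) \<le> card (F u - {al s})"
      using fF[OF u(1)] by (meson card_image_le card_mono finite_Diff finite_imageI le_trans)
    also have "\<dots> < card (F u)" using a fF[OF u(1)] by (meson card_Diff1_less)
    finally show False using u(2)[of "u \<odot> g s"] u(1) s by simp
  qed
  have expand: "p (act u z) = (\<Sum>s\<in>S. z s * p (act u (al s)))" if "z \<in> roots" for z
    by (rule linear_expand[of "\<lambda>z. p (act u z)"]) (use that roots_support in \<open>auto simp: act_lin plin\<close>)
  \<comment> \<open>The walls of the chamber on which the moved point lies. All values
    \<open>p (act u (al s))\<close> are nonnegative, so a root that vanishes at the point is
    supported on \<open>T\<close>.\<close>
  define T where "T = {s \<in> S. p (act u (al s)) = 0}"
  have sup1: "z \<in> Rsub T" if z: "z \<in> posr" "p (act u z) = 0" for z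
  proof -
    have "(\<Sum>s\<in>S. z s * p (act u (al s))) = 0" using expand[OF posrD(1)[OF z(1)]] z(2) by simp
    then have "\<forall>s\<in>S. z s * p (act u (al s)) = 0"
      using sum_nonneg_eq_0_iff[OF finite_S, of "\<lambda>s. z s * p (act u (al s))"] dominant posrD(2)[OF z(1)]
      by (auto simp: posv_def)
    then show ?thesis using roots_support posrD(1)[OF z(1)] by (auto simp: Rsub_def T_def)
  qed
  have sup: "z \<in> Rsub T" if z: "z \<in> roots" "p (act u z) = 0" for z
    using z(1)
  proof (cases rule: roots_cases)
    case 1 then show ?thesis using sup1 z by (simp add: posr_def)
  next
    case 2
    then have "(\<lambda>t. - z t) \<in> Rsub T" using sup1[OF posr_uminus[OF z(1)]] z(2)
      by (simp add: act_uminus puminus)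
    then show ?thesis using z by (auto simp: Rsub_def)
  qed
  have fin: "finite (Rsub T)"
  proof -
    let ?Z = "{z \<in> posr. p (act u z) \<le> 0}"
    have "Rsub T \<subseteq> ?Z \<union> (\<lambda>z t. - z t) ` ?Z"
    proof
      fix z assume z: "z \<in> Rsub T"
      then have zr: "z \<in> roots" by (simp add: Rsub_def)
      have "p (act u z) = 0" unfolding expand[OF zr] using z
        by (intro sum.neutral) (auto simp: Rsub_def T_def)
      then have pz: "p (act u z) = 0" "p (act u (\<lambda>t. - z t)) = 0" by (simp_all add: act_uminus puminus)
      from zr show "z \<in> ?Z \<union> (\<lambda>z t. - z t) ` ?Z"
      proof (cases rule: roots_cases)
        case 1 then show ?thesis using pz zr by (simp add: posr_def)
      next
        case 2
        then have "(\<lambda>t. - z t) \<in> ?Z" using pz posr_uminus[OF zr] by simp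
        then have "(\<lambda>t. - (- z t)) \<in> (\<lambda>z t. - z t) ` ?Z" by (rule imageI)
        then show ?thesis by simp
      qed
    qed
    then show ?thesis using Fu[OF u(1)] by (meson finite_UnI finite_imageI finite_subset)
  qed
  have "act (iv u) x \<in> Rsub T" "act (iv u) y \<in> Rsub T"
    using sup[of "act (iv u) x"] sup[of "act (iv u) y"] R u p0 act_roots by (simp_all add: p_def)
  moreover have "bf x y = bf (act (iv u) x) (act (iv u) y)" using u by (simp add: bf_act)
  moreover have "T \<subseteq> S" by (auto simp: T_def)
  ultimately show ?thesis unfolding Evals_def using fin by blast
qed

end

section \<open>Finiteness of the set of elementary roots\<close>

text \<open>The map sends 2 cos x to 2 cos 2x. As long as the values stay positive, the distance to
  2 at least doubles, which cannot go on.\<close>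

lemma doubling_nonpos:
  fixes \<tau> :: real assumes "\<tau> < 2"
  shows "\<exists>k. ((\<lambda>x. x\<^sup>2 - 2) ^^ k) \<tau> \<le> 0"
proof (rule ccontr)
  assume n: "\<not> ?thesis"
  let ?f = "\<lambda>k. ((\<lambda>x. x\<^sup>2 - 2) ^^ k) \<tau>"
  have pos: "?f k > 0" for k using n by (auto simp: not_le)
  have "2 - ?f k \<ge> 2 ^ k * (2 - \<tau>)" for k
  proof (induction k)
    case (Suc k)
    have "0 \<le> 2 ^ k * (2 - \<tau>)" using assms by simp
    then have "2 * (2 - ?f k) \<le> (2 + ?f k) * (2 - ?f k)"
      using Suc pos[of k] by (intro mult_right_mono) auto
    also have "\<dots> = 2 - ?f (Suc k)" by (simp add: power2_eq_square algebra_simps)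
    finally show ?case using Suc by simp
  qed simp
  then have "2 ^ k * (2 - \<tau>) < 2" for k using pos[of k] by (smt (verit))
  moreover obtain k where "2 ^ k > 2 / (2 - \<tau>)" using real_arch_pow[of 2 "2 / (2 - \<tau>)"] by auto
  ultimately show False using assms by (smt (verit) divide_less_eq)
qed

context coxeter
begin

section \<open>Rotations in the plane of two roots\<close>

definition plane :: "('s \<Rightarrow> real) \<Rightarrow> ('s \<Rightarrow> real) \<Rightarrow> ('s \<Rightarrow> real) set" where
  "plane x y = {\<lambda>t. p * x t + q * y t | p q. True}"

text \<open>The characteristic equation of a plane map with determinant 1 and trace \<tau>; by
  \<open>quad_square\<close> squaring the map doubles the angle.\<close>

definition quad :: "('s \<Rightarrow> real) set \<Rightarrow> 's list set \<Rightarrow> real \<Rightarrow> bool" where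
  "quad P w \<tau> \<longleftrightarrow> (\<forall>z\<in>P. act w z \<in> P \<and> act w (act w z) = (\<lambda>t. \<tau> * act w z t - z t))"

lemma quad_square: assumes w: "w \<in> W" and q: "quad P w \<tau>" shows "quad P (w \<odot> w) (\<tau>\<^sup>2 - 2)"
  unfolding quad_def
proof (intro ballI conjI)
  fix z assume z: "z \<in> P"
  have A: "act w v \<in> P" "act w (act w v) = (\<lambda>t. \<tau> * act w v t + (-1) * v t)" if "v \<in> P" for v
    using q that by (simp_all add: quad_def)
  show "act (w \<odot> w) z \<in> P" using A(1)[OF A(1)[OF z]] w by (simp add: act_mul)
  define z1 z2 z3 z4 where "z1 = act w z" and "z2 = act w z1" and "z3 = act w z2" and "z4 = act w z3"
  have P: "z1 \<in> P" "z2 \<in> P" using A(1) z by (auto simp: z1_def z2_def)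
  have e2: "z2 t = \<tau> * z1 t - z t" for t using A(2)[OF z] by (simp add: z1_def z2_def)
  have e3: "z3 t = \<tau> * z2 t - z1 t" for t using A(2)[OF P(1)] by (simp add: z2_def z3_def)
  have e4: "z4 t = \<tau> * z3 t - z2 t" for t using A(2)[OF P(2)] by (simp add: z3_def z4_def)
  have "z4 t = (\<tau>\<^sup>2 - 2) * z2 t - z t" for t
    unfolding e4 e3 using e2[of t] by (simp add: power2_eq_square algebra_simps)
  moreover have "act (w \<odot> w) z = z2" "act (w \<odot> w) z2 = z4"
    using w by (simp_all add: act_mul z1_def z2_def z3_def z4_def)
  ultimately show "act (w \<odot> w) (act (w \<odot> w) z) = (\<lambda>t. (\<tau>\<^sup>2 - 2) * act (w \<odot> w) z t - z t)"
    by presburger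
qed

text \<open>The product of the two reflections acts on the plane of \<open>x\<close> and
  \<open>y\<close> with trace 4c^2 - 2 < 2, where c = B(x, y). A suitable iterated square
  \<open>h\<close> has trace \<tau> at most 0, so z - \<tau> h z + h^2 z = 0 has nonnegative
  coefficients. Applying \<open>ht\<close> gives a point as in \<open>bf_in_Evals\<close> at which
  both roots vanish.\<close>

lemma bf_finite_values: assumes x: "x \<in> roots" and y: "y \<in> roots" and b: "\<bar>bf x y\<bar> < 1"
  shows "bf x y \<in> Evals"
proof -
  obtain u s where u: "u \<in> W" "s \<in> S" "x = act u (al s)" using x unfolding roots_def by auto
  obtain v r where v: "v \<in> W" "r \<in> S" "y = act v (al r)" using y unfolding roots_def by auto
  define w where "w = (u \<odot> g s \<odot> iv u) \<odot> (v \<odot> g r \<odot> iv v)"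
  have w: "w \<in> W" using u v by (simp add: w_def)
  have aw: "act w z = rfl x (rfl y z)" for z
    using u v by (simp add: w_def act_mul[of "u \<odot> g s \<odot> iv u"] act_reflection)
  define c where "c = bf x y"
  have n: "bf x x = 1" "bf y y = 1" "bf x y = c" "bf y x = c"
    using roots_norm x y bf_sym by (auto simp: c_def)
  have wpl: "act w (\<lambda>t. p * x t + q * y t) =
     (\<lambda>t. ((4 * c\<^sup>2 - 1) * p + 2 * c * q) * x t + (- 2 * c * p - q) * y t)" for p q
    unfolding aw rfl_def bf_lin1 n by (simp add: fun_eq_iff algebra_simps power2_eq_square)
  have q0: "quad (plane x y) w (4 * c\<^sup>2 - 2)"
    unfolding quad_def
  proof (intro ballI conjI)
    fix z assume "z \<in> plane x y"
    then obtain p q where z: "z = (\<lambda>t. p * x t + q * y t)" by (auto simp: plane_def)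
    show "act w z \<in> plane x y" unfolding z wpl plane_def by blast
    show "act w (act w z) = (\<lambda>t. (4 * c\<^sup>2 - 2) * act w z t - z t)"
      unfolding z wpl by (simp add: fun_eq_iff algebra_simps power2_eq_square)
  qed
  have iter: "\<exists>h\<in>W. quad (plane x y) h (((\<lambda>x. x\<^sup>2 - 2) ^^ k) (4 * c\<^sup>2 - 2))" for k
  proof (induction k)
    case 0 then show ?case using q0 w by auto
  next
    case (Suc k)
    then obtain h where h: "h \<in> W" "quad (plane x y) h (((\<lambda>x. x\<^sup>2 - 2) ^^ k) (4 * c\<^sup>2 - 2))" by blast
    then show ?case using quad_square[OF h] by (intro bexI[of _ "h \<odot> h"]) simp_all
  qed
  have "c\<^sup>2 < 1" using b unfolding c_def by (simp add: abs_square_less_1)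
  then obtain k where k: "((\<lambda>x. x\<^sup>2 - 2) ^^ k) (4 * c\<^sup>2 - 2) \<le> 0" using doubling_nonpos[of "4 * c\<^sup>2 - 2"] by auto
  obtain h where h: "h \<in> W" "quad (plane x y) h (((\<lambda>x. x\<^sup>2 - 2) ^^ k) (4 * c\<^sup>2 - 2))"
    using iter by blast
  define \<tau> where "\<tau> = ((\<lambda>x. x\<^sup>2 - 2) ^^ k) (4 * c\<^sup>2 - 2)"
  have z0: "ht z + (- \<tau>) * ht (act h z) + ht (act (h \<odot> h) z) = 0" if z: "z \<in> plane x y" for z
  proof -
    have "act (h \<odot> h) z = (\<lambda>t. \<tau> * act h z t + (-1) * z t)"
      using h z by (simp add: quad_def act_mul \<tau>_def)
    then show ?thesis by (simp only: ht_lin)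
  qed
  have "x \<in> plane x y" unfolding plane_def by (rule CollectI, rule exI[of _ 1], rule exI[of _ 0]) simp
  moreover have "y \<in> plane x y" unfolding plane_def by (rule CollectI, rule exI[of _ 0], rule exI[of _ 1]) simp
  ultimately show ?thesis
    using bf_in_Evals[OF x y h(1) mul_closed[OF h(1) h(1)], of "- \<tau>"] z0 k by (simp add: \<tau>_def)
qed

section \<open>Elementary roots and depth\<close>

definition elem :: "('s \<Rightarrow> real) \<Rightarrow> bool" where
  "elem x \<longleftrightarrow> x \<in> posr \<and> (\<forall>y\<in>posr. dom x y \<longrightarrow> y = x)"

definition dp :: "('s \<Rightarrow> real) \<Rightarrow> nat" where
  "dp x = (LEAST k. \<exists>w\<in>W. len w = k \<and> negv (act w x))"

lemma dp_le: "w \<in> W \<Longrightarrow> negv (act w x) \<Longrightarrow> dp x \<le> len w"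
  unfolding dp_def by (rule Least_le) auto

lemma dp_witness: assumes "x \<in> posr" obtains w where "w \<in> W" "len w = dp x" "negv (act w x)"
proof -
  obtain v s where v: "v \<in> W" "s \<in> S" "x = act v (al s)" using posrD(1)[OF assms] unfolding roots_def by auto
  have "negv (act (g s \<odot> iv v) x)" using v by (simp add: act_mul refl_al_self negv_neg)
  then have "\<exists>w\<in>W. len w = len (g s \<odot> iv v) \<and> negv (act w x)" using v by (intro bexI[of _ "g s \<odot> iv v"]) auto
  then have "\<exists>k. \<exists>w\<in>W. len w = k \<and> negv (act w x)" by blast
  from LeastI_ex[OF this] show ?thesis using that unfolding dp_def by blast
qed

lemma dp_pos: assumes "x \<in> posr" shows "dp x \<ge> 1"
proof -
  obtain w where w: "w \<in> W" "len w = dp x" "negv (act w x)" by (rule dp_witness[OF assms])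
  have "w \<noteq> e" using w posrD(2)[OF assms] not_posv_negv by auto
  then show ?thesis using w len_0_iff by (cases "dp x") auto
qed

text \<open>The letter \<open>s\<close> is the last one of a shortest element that makes
  \<open>x\<close> negative. Reflecting by it lowers the depth, and a root dominated by
  \<open>refl s x\<close> is reflected to one dominated by \<open>x\<close>, so being elementary is
  inherited.\<close>

lemma descend: assumes x: "x \<in> posr"
  obtains s where "s \<in> S" "bl x s > 0" "x = al s \<or> (refl s x \<in> posr \<and> Suc (dp (refl s x)) = dp x
      \<and> (elem x \<longrightarrow> elem (refl s x)))"
proof -
  obtain w where w: "w \<in> W" "len w = dp x" "negv (act w x)" by (rule dp_witness[OF x])
  have "w \<noteq> e" using w posrD(2)[OF x] not_posv_negv by auto
  obtain s where s: "s \<in> S" "Suc (len (w \<odot> g s)) = len w"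
    by (rule ex_right_descent[OF w(1) \<open>w \<noteq> e\<close>])
  define v where "v = w \<odot> g s"
  have v: "v \<in> W" "w = v \<odot> g s" "Suc (len v) = dp x" using w s by (auto simp: v_def)
  have va: "posv (act v (al s))" using act_al_pos_iff(1)[OF v(1) s(1)] v w by simp
  have vn: "negv (act v (refl s x))" using w v s by (simp add: act_mul)
  \<comment> \<open>Otherwise \<open>act v x\<close> lies below \<open>act v (refl s x)\<close> in
    every coordinate, and the shorter element \<open>v\<close> already makes \<open>x\<close>
    negative.\<close>
  have "bl x s > 0"
  proof (rule ccontr)
    assume n: "\<not> ?thesis"
    have "act v x = (\<lambda>t. 1 * act v (refl s x) t + (2 * bl x s) * act v (al s) t)"
      unfolding refl_alt act_lin by (simp add: fun_eq_iff)
    moreover have "bl x s * act v (al s) t \<le> 0" for t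
      using n va by (intro mult_nonpos_nonneg) (auto simp: posv_def)
    ultimately have "act v x t \<le> act v (refl s x) t" for t by (simp add: mult.assoc)
    then have "negv (act v x)" using vn unfolding negv_def by (meson order_trans le_less_trans)
    then show False using dp_le[OF v(1)] v by fastforce
  qed
  moreover have "refl s x \<in> posr \<and> Suc (dp (refl s x)) = dp x \<and> (elem x \<longrightarrow> elem (refl s x))"
    if ne: "x \<noteq> al s"
  proof (intro conjI impI)
    show p: "refl s x \<in> posr" using refl_posr[OF x s(1) ne] .
    obtain u where u: "u \<in> W" "len u = dp (refl s x)" "negv (act u (refl s x))" by (rule dp_witness[OF p])
    have "dp x \<le> len (u \<odot> g s)" using u s by (intro dp_le) (auto simp: act_mul)
    also have "\<dots> \<le> Suc (dp (refl s x))" using len_mul_le[of u "g s"] u s by simp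
    finally show "Suc (dp (refl s x)) = dp x" using dp_le[OF v(1) vn] v by linarith
    assume el: "elem x"
    show "elem (refl s x)" unfolding elem_def
    proof (intro conjI ballI impI)
      show "refl s x \<in> posr" by (rule p)
      fix y assume y: "y \<in> posr" and d: "dom (refl s x) y"
      have "negv (act v y)" using d vn v(1) by (auto simp: dom_def)
      then have "y \<noteq> al s" using va not_posv_negv by blast
      then have py: "refl s y \<in> posr" using refl_posr y s by blast
      have "dom x (refl s y)" unfolding dom_def
      proof (intro ballI impI)
        fix h assume h: "h \<in> W" "negv (act h x)"
        then have "negv (act (h \<odot> g s) (refl s x))" using s by (simp add: act_mul refl_refl)
        then have "negv (act (h \<odot> g s) y)" using d h s unfolding dom_def by (meson g_in_W mul_closed)
        then show "negv (act h (refl s y))" using h s by (simp add: act_mul)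
      qed
      then have "refl s y = x" using el py by (auto simp: elem_def)
      then show "y = refl s x" using refl_refl[OF s(1)] by metis
    qed
  qed
  ultimately show ?thesis using that[of s] s by blast
qed

lemma dp_al: "s \<in> S \<Longrightarrow> dp (al s) = 1"
  using dp_le[of "g s" "al s"] dp_pos[of "al s"] by (simp add: refl_al_self negv_neg)

text \<open>It bounds the length of the reflection in a root by its depth, which is how bounded
  depth becomes a bounded distance in the group.\<close>

lemma root_of_dp: assumes "x \<in> posr" shows "\<exists>v\<in>W. \<exists>s\<in>S. x = act v (al s) \<and> len v < dp x"
  using assms
proof (induction "dp x" arbitrary: x rule: less_induct)
  case less
  obtain s where s: "s \<in> S" "x = al s \<or> (refl s x \<in> posr \<and> Suc (dp (refl s x)) = dp x)"
    by (rule descend[OF less.prems]) auto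
  show ?case
  proof (cases "x = al s")
    case True then show ?thesis using s dp_al by (intro bexI[of _ e] bexI[of _ s]) auto
  next
    case False
    then obtain v r where v: "v \<in> W" "r \<in> S" "refl s x = act v (al r)" "len v < dp (refl s x)"
      using less.hyps[of "refl s x"] s by auto
    have "x = act (g s \<odot> v) (al r)" using v s refl_refl[OF s(1), of x] by (simp add: act_mul)
    moreover have "len (g s \<odot> v) \<le> Suc (len v)" using len_mul_le[of "g s" v] v s by simp
    ultimately show ?thesis using v s False by (intro bexI[of _ "g s \<odot> v"] bexI[of _ r]) auto
  qed
qed

text \<open>If the inner product were at least 1, then by \<open>dom_of_height\<close> the higher of
  the two roots would dominate the other. But an elementary root dominates no other root, and
  \<open>al s\<close> does not dominate \<open>x\<close> because \<open>g s\<close> makes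
  \<open>al s\<close> negative and no other positive root.\<close>

lemma elem_bl_less: assumes x: "elem x" "dp x \<ge> 2" and s: "s \<in> S" shows "bl x s < 1"
proof (rule ccontr)
  assume n: "\<not> ?thesis"
  have xp: "x \<in> posr" using x by (simp add: elem_def)
  have ne: "x \<noteq> al s" using x dp_al s by auto
  have b: "bf x (al s) \<ge> 1" "bf (al s) x \<ge> 1" using n s by (simp_all add: bf_al bf_al')
  show False
  proof (cases "ht (al s) \<le> ht x")
    case True
    then have "dom x (al s)" using dom_of_height xp s b by auto
    then show False using x ne s by (auto simp: elem_def)
  next
    case False
    then have "dom (al s) x" using dom_of_height xp s b by auto
    moreover have "negv (act (g s) (al s))" using s by (simp add: refl_al_self negv_neg)
    ultimately have "negv (refl s x)" using s unfolding dom_def by (metis act_g g_in_W)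
    then show False using refl_neg_iff[OF xp s] ne by simp
  qed
qed

text \<open>Iterates \<open>descend\<close> down to depth 1; a letter is recorded only while another
  root follows.\<close>

lemma elem_chain: assumes "elem x" "dp x = k"
  shows "\<exists>f a. f 0 = x \<and> (\<forall>i<k. elem (f i) \<and> dp (f i) = k - i) \<and>
     (\<forall>i. Suc i < k \<longrightarrow> a i \<in> S \<and> bl (f i) (a i) > 0 \<and> f (Suc i) = refl (a i) (f i))"
  using assms
proof (induction k arbitrary: x)
  case 0
  then show ?case by (intro exI[of _ "\<lambda>_. x"]) auto
next
  case (Suc k)
  have xp: "x \<in> posr" using Suc.prems by (simp add: elem_def)
  obtain s where s: "s \<in> S" "bl x s > 0" "x = al s \<or> (refl s x \<in> posr \<and> Suc (dp (refl s x)) = dp x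
      \<and> (elem x \<longrightarrow> elem (refl s x)))" by (rule descend[OF xp])
  show ?case
  proof (cases "x = al s")
    case True
    then have "k = 0" using Suc.prems dp_al s by simp
    then show ?thesis using Suc.prems by (intro exI[of _ "\<lambda>_. x"]) auto
  next
    case False
    then have "elem (refl s x)" "dp (refl s x) = k" using s Suc.prems by auto
    from Suc.IH[OF this] obtain f a where fa: "f 0 = refl s x" "\<And>i. i < k \<Longrightarrow> elem (f i) \<and> dp (f i) = k - i"
      "\<And>i. Suc i < k \<Longrightarrow> a i \<in> S \<and> bl (f i) (a i) > 0 \<and> f (Suc i) = refl (a i) (f i)" by blast
    define f' where "f' i = (case i of 0 \<Rightarrow> x | Suc j \<Rightarrow> f j)" for i
    define a' where "a' i = (case i of 0 \<Rightarrow> s | Suc j \<Rightarrow> a j)" for i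
    show ?thesis
    proof (intro exI[of _ f'] exI[of _ a'] conjI allI impI)
      show "f' 0 = x" by (simp add: f'_def)
      fix i
      show "elem (f' i)" "dp (f' i) = Suc k - i" if "i < Suc k"
        using that Suc.prems fa(2) by (auto simp: f'_def split: nat.splits)
      show "a' i \<in> S" "bl (f' i) (a' i) > 0" "f' (Suc i) = refl (a' i) (f' i)" if "Suc i < Suc k"
        using that s fa(1,3) by (auto simp: f'_def a'_def split: nat.splits)
    qed
  qed
qed

lemma bm_nonpos: assumes "s \<in> S" "t \<in> S" "s \<noteq> t" shows "bm s t \<le> 0"
proof (cases "M s t")
  case (enat m)
  note b = bm_finite[OF assms enat]
  have "cos (pi / real m) \<ge> 0" using b(1)
    by (intro cos_ge_zero) (auto simp: field_simps intro: order_trans[of _ 0])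
  then show ?thesis using b(2) by simp
qed (simp add: bm_def)

text \<open>If two roots of a
  descending chain had the same relevant inner products with the simple roots, their own
  inner product would be 1, so the deeper one would dominate the other.\<close>

lemma elem_dp_bounded: "\<exists>D. \<forall>x. elem x \<longrightarrow> dp x \<le> D"
proof -
  \<comment> \<open>The value 2 is a marker for inner products outside (-1, 1); by
    \<open>bf_finite_values\<close> all other entries lie in \<open>Evals\<close>.\<close>
  let ?X = "PiE S (\<lambda>_. insert 2 Evals)"
  have fX: "finite ?X" using finite_S finite_Evals by (intro finite_PiE) auto
  have "dp x \<le> Suc (card ?X)" if el: "elem x" for x
  proof (rule ccontr)
    assume n: "\<not> ?thesis"
    define k where "k = dp x"
    have k: "k > Suc (card ?X)" using n by (simp add: k_def)
    obtain f a where f0: "f 0 = x" and fi: "\<And>i. i < k \<Longrightarrow> elem (f i) \<and> dp (f i) = k - i"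
      and fa: "\<And>i. Suc i < k \<Longrightarrow> a i \<in> S \<and> bl (f i) (a i) > 0 \<and> f (Suc i) = refl (a i) (f i)"
      using elem_chain[OF el k_def[symmetric]] by blast
    define sy where "sy i = (\<lambda>s\<in>S. if \<bar>bl (f i) s\<bar> < 1 then bl (f i) s else 2)" for i
    have syX: "sy i \<in> ?X" if "i < k" for i
    proof -
      have "bl (f i) s \<in> Evals" if "s \<in> S" "\<bar>bl (f i) s\<bar> < 1" for s
        using bf_finite_values[of "f i" "al s"] fi[OF \<open>i < k\<close>] that by (auto simp: bf_al elem_def posr_def)
      then show ?thesis unfolding sy_def by auto
    qed
    \<comment> \<open>The last root of the chain, of depth 1, is left out because
      \<open>elem_bl_less\<close> needs depth at least 2.\<close>
    have "sy ` {..<k - 1} \<subseteq> ?X" by (intro image_subsetI syX) simp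
    then have "card (sy ` {..<k - 1}) \<le> card ?X" using fX by (rule card_mono[rotated])
    then have "\<not> inj_on sy {..<k - 1}" using k by (auto dest: card_image)
    then obtain i j where ij: "i < j" "j < k - 1" "sy i = sy j"
      unfolding inj_on_def by (metis (no_types, lifting) lessThan_iff linorder_neqE_nat)
    \<comment> \<open>The pairing with a letter used since time \<open>i\<close> exceeds -1 right
      after its use, being the negative of a value below 1, and reflections in other letters can
      only raise it. So the marker hides no such entry.\<close>
    have lower: "\<forall>l. i \<le> l \<and> l < m \<longrightarrow> bl (f m) (a l) > -1" if "m < k - 1" for m
      using that
    proof (induction m)
      case (Suc m)
      have m: "Suc m < k" using Suc.prems by simp
      have S: "Suc l < k" if "l < Suc m" for l using that Suc.prems by simp
      show ?case
      proof (intro allI impI)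
        fix l assume l: "i \<le> l \<and> l < Suc m"
        have lt: "bl (f m) (a m) < 1"
          using elem_bl_less[of "f m" "a m"] fi[of m] fa[OF m] m Suc.prems by simp
        have eq: "bl (f (Suc m)) (a l) = bl (f m) (a l) - 2 * bl (f m) (a m) * bm (a m) (a l)"
          using fa[OF m] fa[OF S[of l]] l bl_lin[of 1 "f m" "- 2 * bl (f m) (a m)" "al (a m)" "a l"]
          by (simp add: refl_alt bl_al)
        show "bl (f (Suc m)) (a l) > -1"
        proof (cases "a l = a m")
          case True
          then show ?thesis using eq lt fa[OF m] by simp
        next
          case False
          then have "l < m" using l by (cases "l = m") auto
          then have "bl (f m) (a l) > -1" using Suc l by simp
          moreover have "bl (f m) (a m) * bm (a m) (a l) \<le> 0"
            using bm_nonpos[of "a m" "a l"] fa[OF m] fa[OF S[of l]] l False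
            by (intro mult_nonneg_nonpos) auto
          ultimately show ?thesis using eq by (simp add: mult.assoc)
        qed
      qed
    qed simp
    have same: "bl (f i) (a l) = bl (f j) (a l)" if l: "i \<le> l" "l < j" for l
    proof -
      have aS: "a l \<in> S" using fa[of l] l ij by simp
      have "bl (f j) (a l) < 1" using elem_bl_less[OF _ _ aS, of "f j"] fi[of j] ij by simp
      moreover have "bl (f j) (a l) > -1" using lower[of j] ij l by simp
      ultimately have j: "\<bar>bl (f j) (a l)\<bar> < 1" by linarith
      have "sy i (a l) = sy j (a l)" using ij by simp
      then show ?thesis using aS j unfolding sy_def by (auto split: if_splits)
    qed
    have expand: "bf (f i) z = bf (f m) z + (\<Sum>l\<in>{i..<m}. 2 * bl (f l) (a l) * bl z (a l)) \<and> ht (f m) \<le> ht (f i)"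
      if "i \<le> m" "m < k" for m z
      using that
    proof (induction m rule: dec_induct)
      case (step m)
      have m: "Suc m < k" using step by simp
      have "bf (f (Suc m)) z = bf (f m) z - 2 * bl (f m) (a m) * bl z (a m)"
        using fa[OF m] bf_lin1[of 1 "f m" "- 2 * bl (f m) (a m)" "al (a m)" z] by (simp add: refl_alt bf_al')
      moreover have "ht (f (Suc m)) \<le> ht (f m)"
        using fa[OF m] ht_lin[of 1 "f m" "- 2 * bl (f m) (a m)" "al (a m)"] ht_pos(1)[of "al (a m)"]
        by (simp add: refl_alt)
      ultimately show ?case using step by simp
    qed simp
    have E: "bf (f i) z = bf (f j) z + (\<Sum>l\<in>{i..<j}. 2 * bl (f l) (a l) * bl z (a l))" for z
      using expand[of j z] ij by simp
    have "(\<Sum>l\<in>{i..<j}. 2 * bl (f l) (a l) * bl (f i) (a l)) = (\<Sum>l\<in>{i..<j}. 2 * bl (f l) (a l) * bl (f j) (a l))"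
      using same by (intro sum.cong) auto
    \<comment> \<open>With norms 1 the equation reads 1 - b = b - 1 for b = B(f i, f j).\<close>
    then have "bf (f i) (f i) - bf (f j) (f i) = bf (f i) (f j) - bf (f j) (f j)"
      using E[of "f i"] E[of "f j"] by linarith
    moreover have P: "f i \<in> posr" "f j \<in> posr" using fi[of i] fi[of j] ij by (auto simp: elem_def)
    ultimately have "bf (f i) (f j) \<ge> 1"
      using roots_norm[of "f i"] roots_norm[of "f j"] bf_sym[of "f i" "f j"] posrD by auto
    then have "dom (f i) (f j)" using dom_of_height P expand[of j] ij by auto
    then have "f j = f i" using fi[of i] ij P by (auto simp: elem_def)
    moreover have "dp (f i) = k - i" "dp (f j) = k - j" using fi[of i] fi[of j] ij by auto
    ultimately show False using ij by simp
  qed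
  then show ?thesis by blast
qed

text \<open>An inversion \<open>y\<close> of \<open>iv v\<close> arises at one letter
  \<open>s\<close> of \<open>v\<close>, as \<open>act v' (al s)\<close> with \<open>v'\<close> the
  part before it. Since x v' s is reduced, \<open>x\<close> takes this root to a positive
  one.\<close>

lemma reduced_product_inversion:
  assumes "x \<in> W" "v \<in> W" "len (x \<odot> v) = len x + len v" "y \<in> posr" "negv (act (iv v) y)"
  shows "posv (act x y)"
  using assms
proof (induction "len v" arbitrary: v)
  case 0
  then have "v = e" using len_0_iff by simp
  then show ?case using 0 posrD not_posv_negv by fastforce
next
  case (Suc n)
  have ve: "v \<noteq> e" using Suc.hyps by auto
  obtain s where s: "s \<in> S" "Suc (len (v \<odot> g s)) = len v" by (rule ex_right_descent[OF Suc.prems(2) ve])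
  define v' where "v' = v \<odot> g s"
  have v': "v' \<in> W" "v = v' \<odot> g s" "len v' = n" using s Suc by (auto simp: v'_def)
  have "len (x \<odot> v) \<le> Suc (len (x \<odot> v'))"
    using len_mul_le[of "x \<odot> v'" "g s"] v' s Suc.prems by (simp add: mul_assoc)
  then have l: "len (x \<odot> v') = len x + len v'"
    using len_mul_le[of x v'] v' Suc by simp
  have iv: "act (iv v) y = refl s (act (iv v') y)" using v' s by (simp add: iv_mul_distrib act_mul)
  have r: "act (iv v') y \<in> roots" using v' Suc.prems act_roots posrD by simp
  from r show ?case
  proof (cases rule: roots_cases)
    case 1
    then have "act (iv v') y = al s" using refl_neg_iff[of "act (iv v') y" s] r iv Suc.prems s by (simp add: posr_def)
    then have "y = act v' (al s)" using v' by (metis act_act_iv)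
    then have "act x y = act (x \<odot> v') (al s)" using v' Suc.prems by (simp add: act_mul)
    moreover have "len (x \<odot> v' \<odot> g s) = Suc (len (x \<odot> v'))"
      using Suc l v' s by (simp add: mul_assoc)
    ultimately show ?thesis using act_al_pos_iff(1)[of "x \<odot> v'" s] v' s Suc.prems by simp
  next
    case 2
    then show ?thesis using Suc.hyps(1)[of v'] v' l Suc.prems by simp
  qed
qed

section \<open>The ShortLex combing\<close>

definition ldesc :: "'s list set \<Rightarrow> 's set" where
  "ldesc w = {s \<in> S. Suc (len (g s \<odot> w)) = len w}"

definition idx :: "'s \<Rightarrow> nat" where
  "idx = (SOME f. inj_on f S)"

lemma inj_idx: "inj_on idx S"
proof -
  obtain f :: "'s \<Rightarrow> nat" where "inj_on f S" using finite_imp_inj_to_nat_seg[OF finite_S] by blast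
  then show ?thesis unfolding idx_def by (rule someI[of "\<lambda>f. inj_on f S"])
qed

text \<open>The first letter of the ShortLex normal form: the least left descent in the fixed but
  arbitrary order \<open>idx\<close>.\<close>

definition fl :: "'s list set \<Rightarrow> 's" where
  "fl w = (SOME s. s \<in> ldesc w \<and> (\<forall>t\<in>ldesc w. idx s \<le> idx t))"

lemma ldesc_nonempty: assumes "w \<in> W" "w \<noteq> e" shows "ldesc w \<noteq> {}"
proof -
  have iw: "iv w \<in> W" using assms by simp
  have ne: "iv w \<noteq> e"
  proof
    assume "iv w = e"
    then have "iv (iv w) = iv e" by (rule arg_cong)
    then show False using assms by simp
  qed
  obtain s where s: "s \<in> S" "Suc (len (iv w \<odot> g s)) = len (iv w)" by (rule ex_right_descent[OF iw ne])
  have "len (iv w \<odot> g s) = len (g s \<odot> w)" using len_iv[of "g s \<odot> w"] assms s by (simp add: iv_mul_distrib)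
  then show ?thesis using s assms by (auto simp: ldesc_def)
qed

lemma fl: assumes "w \<in> W" "w \<noteq> e"
  shows "fl w \<in> ldesc w" "\<And>t. t \<in> ldesc w \<Longrightarrow> idx (fl w) \<le> idx t"
proof -
  obtain s where "s \<in> ldesc w" using ldesc_nonempty[OF assms] by blast
  from ex_has_least_nat[of "\<lambda>s. s \<in> ldesc w", OF this, of idx]
  have "\<exists>s. s \<in> ldesc w \<and> (\<forall>t\<in>ldesc w. idx s \<le> idx t)" by (elim exE) auto
  then have "fl w \<in> ldesc w \<and> (\<forall>t\<in>ldesc w. idx (fl w) \<le> idx t)"
    unfolding fl_def by (rule someI_ex)
  then show "fl w \<in> ldesc w" "\<And>t. t \<in> ldesc w \<Longrightarrow> idx (fl w) \<le> idx t" by auto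
qed

text \<open>The prefix of length \<open>n\<close> of the ShortLex normal form.\<close>

primrec comb :: "nat \<Rightarrow> 's list set \<Rightarrow> 's list set" where
  "comb 0 w = e"
| "comb (Suc n) w = (if w = e then e else g (fl w) \<odot> comb n (g (fl w) \<odot> w))"

lemma fl_step: assumes "w \<in> W" "w \<noteq> e"
  shows "fl w \<in> S" "g (fl w) \<odot> w \<in> W" "Suc (len (g (fl w) \<odot> w)) = len w"
  using fl(1)[OF assms] assms by (auto simp: ldesc_def)

lemma comb_in_W [simp]: "w \<in> W \<Longrightarrow> comb n w \<in> W"
  by (induction n arbitrary: w) (auto simp: fl_step)

lemma comb_e [simp]: "comb n e = e"
  by (cases n) auto

text \<open>The factorisation of \<open>w\<close> at a prefix is reduced; for \<open>n\<close>
  beyond the length the prefix stays at \<open>w\<close>.\<close>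

lemma comb_len: "w \<in> W \<Longrightarrow> len (comb n w) = min n (len w) \<and> len w = len (comb n w) + len (iv (comb n w) \<odot> w)"
proof (induction n arbitrary: w)
  case 0 then show ?case by simp
next
  case (Suc n)
  show ?case
  proof (cases "w = e")
    case False
    define a where "a = fl w"
    define v where "v = g a \<odot> w"
    have a: "a \<in> S" "v \<in> W" "Suc (len v) = len w" using fl_step[OF Suc.prems False] by (auto simp: a_def v_def)
    have IH: "len (comb n v) = min n (len v)" "len v = len (comb n v) + len (iv (comb n v) \<odot> v)"
      by (rule conjunct1[OF Suc.IH[OF a(2)]], rule conjunct2[OF Suc.IH[OF a(2)]])
    have r: "comb (Suc n) w = g a \<odot> comb n v" using False by (simp add: a_def v_def)
    have q: "iv (g a \<odot> comb n v) \<odot> w = iv (comb n v) \<odot> v"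
      unfolding v_def[symmetric] using a Suc.prems by (simp add: iv_mul_distrib mul_assoc flip: v_def)
    have 1: "len (g a \<odot> comb n v) \<le> Suc (len (comb n v))" using len_mul_le[of "g a" "comb n v"] a by simp
    have "g a \<odot> v = w" using a Suc.prems by (simp add: v_def)
    then have "(g a \<odot> comb n v) \<odot> (iv (comb n v) \<odot> v) = w" using a by (simp add: mul_assoc)
    then have "len w \<le> len (g a \<odot> comb n v) + len (iv (comb n v) \<odot> v)"
      using len_mul_le[of "g a \<odot> comb n v" "iv (comb n v) \<odot> v"] a by simp
    then have 2: "len (g a \<odot> comb n v) = Suc (len (comb n v))" using 1 IH a by linarith
    have "min (Suc n) (len w) = Suc (min n (len v))" unfolding a(3)[symmetric] by simp
    then show ?thesis unfolding r q using IH a(3) 2 by linarith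
  qed simp
qed

lemma comb_full: assumes "w \<in> W" "len w \<le> n" shows "comb n w = w"
proof -
  have "len (iv (comb n w) \<odot> w) = 0" using comb_len[OF assms(1), of n] assms(2) by linarith
  then have "iv (comb n w) \<odot> w = e" using len_0_iff assms by simp
  then have "comb n w \<odot> (iv (comb n w) \<odot> w) = comb n w \<odot> e" by simp
  then show ?thesis using assms(1) by simp
qed

lemma comb_Suc: "w \<noteq> e \<Longrightarrow> comb (Suc n) w = g (fl w) \<odot> comb n (g (fl w) \<odot> w)"
  by simp

declare comb.simps(2) [simp del]

lemma comb_Suc_dist: "w \<in> W \<Longrightarrow> len (iv (comb n w) \<odot> comb (Suc n) w) \<le> 1"
proof (induction n arbitrary: w)
  case 0
  show ?case
  proof (cases "w = e")
    case False
    then show ?thesis using fl_step(1)[OF 0 False] by (simp add: comb_Suc)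
  qed simp
next
  case (Suc n)
  show ?case
  proof (cases "w = e")
    case False
    let ?v = "g (fl w) \<odot> w"
    have s: "fl w \<in> S" "?v \<in> W" using fl_step[OF Suc.prems False] by auto
    have "iv (comb (Suc n) w) \<odot> comb (Suc (Suc n)) w = iv (g (fl w) \<odot> comb n ?v) \<odot> (g (fl w) \<odot> comb (Suc n) ?v)"
      using comb_Suc[OF False] by simp
    also have "\<dots> = iv (comb n ?v) \<odot> comb (Suc n) ?v"
      using s by (simp add: iv_mul_distrib mul_assoc)
    finally show ?thesis using Suc.IH[OF s(2)] by simp
  qed simp
qed

section \<open>The fellow traveller property\<close>

lemma root_sign: "x \<in> roots \<Longrightarrow> posv x \<or> negv x"
  by (elim roots_cases) simp_all

text \<open>The root y = x^-1 (al b) cannot dominate another root z: both s v^-1 and b x make y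
  negative, so z would be an inversion of v^-1 and of x, against
  \<open>reduced_product_inversion\<close>. Hence y is elementary, its depth is at most
  \<open>D\<close>, and x^-1 b x is the reflection in it.\<close>

lemma inserted_reflection_bounded:
  assumes D: "\<And>x. elem x \<Longrightarrow> dp x \<le> D"
    and x: "x \<in> W" "v \<in> W" "len (x \<odot> v) = len x + len v"
    and b: "b \<in> S" "s \<in> S" "act (iv (x \<odot> v)) (al b) = al s"
  shows "len (iv x \<odot> g b \<odot> x) \<le> 2 * D"
proof -
  define y where "y = act (iv x) (al b)"
  have vy: "act (iv v) y = al s" using b x by (simp add: y_def iv_mul_distrib act_mul)
  have xy: "act x y = al b" using x by (simp add: y_def)
  have yr: "y \<in> roots" using x b act_roots by (simp add: y_def)
  have "posv y"
  proof (rule ccontr)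
    assume "\<not> posv y"
    then have "(\<lambda>t. - y t) \<in> posr" using posr_uminus[OF yr] root_sign[OF yr] by simp
    moreover have "negv (act (iv v) (\<lambda>t. - y t))" using vy by (simp add: act_uminus negv_neg)
    ultimately have "posv (act x (\<lambda>t. - y t))" by (rule reduced_product_inversion[OF x])
    then have "negv (al b)" unfolding act_uminus xy posv_neg .
    then show False using not_posv_negv[OF posv_al] by blast
  qed
  then have yp: "y \<in> posr" using yr by (simp add: posr_def)
  have "elem y" unfolding elem_def
  proof (intro conjI ballI impI yp)
    fix z assume z: "z \<in> posr" and d: "dom y z"
    show "z = y"
    proof (rule ccontr)
      assume ne: "z \<noteq> y"
      have "negv (act (g s \<odot> iv v) y)" using vy x b by (simp add: act_mul refl_al_self negv_neg)
      moreover have "g s \<odot> iv v \<in> W" using x b by simp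
      ultimately have "negv (act (g s \<odot> iv v) z)" using d unfolding dom_def by blast
      then have 11: "negv (refl s (act (iv v) z))" using x b by (simp add: act_mul)
      have vz: "act (iv v) z \<in> roots" using act_roots[OF iv_closed[OF x(2)] posrD(1)[OF z]] .
      from vz have n1: "negv (act (iv v) z)"
      proof (cases rule: roots_cases)
        case 1
        then have "act (iv v) z \<in> posr" using vz by (simp add: posr_def)
        then have "act (iv v) z = al s"
          by (rule refl_neg_iff[OF _ b(2) 11])
        then have "act v (act (iv v) z) = act v (act (iv v) y)" using vy by simp
        then show ?thesis using x ne by simp
      qed simp
      have "negv (act (g b \<odot> x) y)" using xy x b by (simp add: act_mul refl_al_self negv_neg)
      moreover have "g b \<odot> x \<in> W" using x b by simp
      ultimately have "negv (act (g b \<odot> x) z)" using d unfolding dom_def by blast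
      then have 2: "negv (refl b (act x z))" using x b by (simp add: act_mul)
      have p: "posv (act x z)" using reduced_product_inversion[OF x z n1] .
      then have "act x z \<in> posr" using act_roots[OF x(1) posrD(1)[OF z]] by (simp add: posr_def)
      then have "act x z = al b" by (rule refl_neg_iff[OF _ b(1) 2])
      then have "act (iv x) (act x z) = act (iv x) (act x y)" using xy by simp
      then show False using x ne by simp
    qed
  qed
  then have "dp y \<le> D" by (rule D)
  then obtain u r where u: "u \<in> W" "r \<in> S" "y = act u (al r)" "len u < D"
    using root_of_dp[OF yp] by fastforce
  have "iv x \<odot> g b \<odot> iv (iv x) = u \<odot> g r \<odot> iv u"
    by (rule reflection_eqI) (use x b u y_def in auto)
  then have "len (iv x \<odot> g b \<odot> x) = len (u \<odot> g r \<odot> iv u)" using x by simp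
  also have "\<dots> \<le> len u + 1 + len u"
    using len_mul_le[of "u \<odot> g r" "iv u"] len_mul_le[of u "g r"] u by simp
  finally show ?thesis using u by linarith
qed

text \<open>Equal first letters are stripped. Otherwise the first letter \<open>b\<close> for w s is
  no left descent of \<open>w\<close>, because both letters are chosen least, and so b w = w s. The
  normal form of w s is then \<open>b\<close> followed by that of \<open>w\<close>, and
  corresponding prefixes differ by one step and a conjugate of \<open>b\<close>.\<close>

lemma comb_fellow_up:
  assumes D: "\<And>x. elem x \<Longrightarrow> dp x \<le> D"
    and w: "w \<in> W" "s \<in> S" "len (w \<odot> g s) = Suc (len w)"
  shows "len (iv (comb n w) \<odot> comb n (w \<odot> g s)) \<le> 2 * D + 1"
  using w
proof (induction n arbitrary: w)
  case 0 then show ?case by simp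
next
  case (Suc n)
  let ?ws = "w \<odot> g s"
  have ws: "?ws \<in> W" "?ws \<noteq> e" using Suc.prems by auto
  show ?case
  proof (cases "w = e")
    case True
    have "len (comb (Suc n) (g s)) \<le> 1"
      using comb_len[of "g s" "Suc n"] len_g[OF Suc.prems(2)] g_in_W[OF Suc.prems(2)] by linarith
    then show ?thesis using True Suc.prems by simp
  next
    case False
    define a where "a = fl w"
    define b where "b = fl ?ws"
    have a: "a \<in> S" "Suc (len (g a \<odot> w)) = len w" using fl_step[OF Suc.prems(1) False] by (auto simp: a_def)
    have b: "b \<in> S" "Suc (len (g b \<odot> ?ws)) = len ?ws" using fl_step[OF ws] by (auto simp: b_def)
    have cw: "comb (Suc n) w = g a \<odot> comb n (g a \<odot> w)" using comb_Suc[OF False] by (simp add: a_def)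
    have cws: "comb (Suc n) ?ws = g b \<odot> comb n (g b \<odot> ?ws)" using comb_Suc[OF ws(2)] by (simp add: b_def)
    have sub: "ldesc w \<subseteq> ldesc ?ws"
    proof
      fix t assume t: "t \<in> ldesc w"
      then have t': "t \<in> S" "Suc (len (g t \<odot> w)) = len w" by (auto simp: ldesc_def)
      have "len (g t \<odot> ?ws) \<le> len (g t \<odot> w) + 1"
        using len_mul_le[of "g t \<odot> w" "g s"] Suc.prems t' by (simp add: mul_assoc)
      then have "Suc (len (g t \<odot> ?ws)) = len ?ws" using len_g_mul[OF ws(1) t'(1)] t' Suc.prems by linarith
      then show "t \<in> ldesc ?ws" using t' by (simp add: ldesc_def)
    qed
    show ?thesis
    proof (cases "a = b")
      case True
      have w': "g a \<odot> w \<in> W" using a Suc.prems by simp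
      have "len (g a \<odot> w \<odot> g s) = Suc (len (g a \<odot> w))"
        using True a b Suc.prems by (simp add: mul_assoc)
      from Suc.IH[OF w' Suc.prems(2) this]
      have "len (iv (comb n (g a \<odot> w)) \<odot> comb n (g a \<odot> ?ws)) \<le> 2 * D + 1"
        using a Suc.prems by (simp add: mul_assoc)
      then show ?thesis unfolding cw cws using True a Suc.prems
        by (simp add: iv_mul_distrib mul_assoc)
    next
      case False
      note ab = False
      have "b \<notin> ldesc w"
      proof
        assume "b \<in> ldesc w"
        then have "idx a \<le> idx b" using fl(2)[OF Suc.prems(1) \<open>w \<noteq> e\<close>] by (simp add: a_def)
        moreover have "fl w \<in> ldesc ?ws" using fl(1)[OF Suc.prems(1) \<open>w \<noteq> e\<close>] sub by blast
        then have "idx b \<le> idx a" unfolding a_def b_def by (rule fl(2)[OF ws])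
        ultimately have "idx a = idx b" by simp
        then show False using inj_onD[OF inj_idx _ a(1) b(1)] ab by blast
      qed
      then have "len (g b \<odot> w) = Suc (len w)" using len_g_mul[OF Suc.prems(1) b(1)] b(1) unfolding ldesc_def by blast
      then have "len (iv w \<odot> g b) = Suc (len (iv w))"
        using len_iv[of "g b \<odot> w"] Suc.prems b by (simp add: iv_mul_distrib)
      then have p: "posv (act (iv w) (al b))" using act_al_pos_iff(1)[of "iv w" b] Suc.prems b by simp
      have "Suc (len (iv ?ws \<odot> g b)) = len (iv ?ws)"
        using len_iv[of "g b \<odot> ?ws"] ws b by (simp add: iv_mul_distrib)
      then have "negv (act (iv ?ws) (al b))" using act_al_pos_iff(2)[of "iv ?ws" b] ws b by simp
      then have "negv (refl s (act (iv w) (al b)))" using Suc.prems by (simp add: iv_mul_distrib act_mul)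
      moreover have "act (iv w) (al b) \<in> posr"
        using p act_roots[OF iv_closed[OF Suc.prems(1)] roots_al[OF b(1)]] by (simp add: posr_def)
      ultimately have eq: "act (iv w) (al b) = al s" using refl_neg_iff[OF _ Suc.prems(2)] by blast
      have "act (iv w) (al b) = act e (al s)" using eq by simp
      then have "iv w \<odot> g b \<odot> iv (iv w) = e \<odot> g s \<odot> iv e"
        by (rule reflection_eqI[OF iv_closed[OF Suc.prems(1)] b(1) e_in_W Suc.prems(2)])
      then have "iv w \<odot> (g b \<odot> w) = g s" using Suc.prems(1,2) b(1) by (simp add: mul_assoc)
      then have "w \<odot> (iv w \<odot> (g b \<odot> w)) = ?ws" by (rule arg_cong)
      then have gw: "g b \<odot> w = ?ws" using Suc.prems(1) b(1) by simp
      have "g b \<odot> (g b \<odot> w) = w" using Suc.prems(1) b(1) by simp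
      then have "g b \<odot> ?ws = w" unfolding gw .
      then have cws': "comb (Suc n) ?ws = g b \<odot> comb n w" using cws by simp
      let ?x = "comb n w"
      let ?v = "iv ?x \<odot> w"
      have xW: "?x \<in> W" "?v \<in> W" and xv: "?x \<odot> ?v = w" using Suc.prems(1) by simp_all
      have "len (?x \<odot> ?v) = len ?x + len ?v"
        unfolding xv using comb_len[OF Suc.prems(1), of n] by blast
      moreover have "act (iv (?x \<odot> ?v)) (al b) = al s" unfolding xv by (rule eq)
      ultimately have "len (iv ?x \<odot> g b \<odot> ?x) \<le> 2 * D"
        using inserted_reflection_bounded[OF D xW _ b(1) Suc.prems(2)] by blast
      moreover have "len (iv (comb (Suc n) w) \<odot> ?x) \<le> 1"
        using comb_Suc_dist[OF Suc.prems(1), of n] len_iv[of "iv ?x \<odot> comb (Suc n) w"] Suc.prems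
        by (simp add: iv_mul_distrib)
      moreover have eq': "iv (comb (Suc n) w) \<odot> comb (Suc n) ?ws = (iv (comb (Suc n) w) \<odot> ?x) \<odot> (iv ?x \<odot> g b \<odot> ?x)"
        unfolding cws' using Suc.prems(1) b(1) by (simp add: mul_assoc)
      moreover have "len ((iv (comb (Suc n) w) \<odot> ?x) \<odot> (iv ?x \<odot> g b \<odot> ?x))
          \<le> len (iv (comb (Suc n) w) \<odot> ?x) + len (iv ?x \<odot> g b \<odot> ?x)"
        by (rule len_mul_le) (use Suc.prems(1) b(1) in simp_all)
      ultimately show ?thesis unfolding eq' by linarith
    qed
  qed
qed

text \<open>A reduced word for \<open>h\<close> is followed letter by letter; a letter that shortens
  is the reverse of one that lengthens.\<close>

theorem comb_fellow_traveller:
  "\<exists>R. \<forall>w\<in>W. \<forall>h\<in>W. \<forall>n. len (iv (comb n w) \<odot> comb n (w \<odot> h)) \<le> R * len h"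
proof -
  obtain D0 where D0: "\<And>x. elem x \<Longrightarrow> dp x \<le> D0" using elem_dp_bounded by blast
  define R where "R = 2 * (Suc D0) + 1"
  have D: "dp x \<le> Suc D0" if "elem x" for x using D0[OF that] by simp
  have up: "len (iv (comb n w) \<odot> comb n (w \<odot> g s)) \<le> R"
    if w: "w \<in> W" "s \<in> S" "len (w \<odot> g s) = Suc (len w)" for w s n
    unfolding R_def
  proof (rule comb_fellow_up[where D = "Suc D0"])
    show "dp x \<le> Suc D0" if "elem x" for x using that by (rule D)
  qed (rule w)+
  have step: "len (iv (comb n w) \<odot> comb n (w \<odot> g s)) \<le> R" if w: "w \<in> W" "s \<in> S" for w s n
  proof (cases "len (w \<odot> g s) = Suc (len w)")
    case True
    show ?thesis by (rule up[OF w True])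
  next
    case False
    have ws: "w \<odot> g s \<in> W" "w \<odot> g s \<odot> g s = w" using w by simp_all
    have l: "len (w \<odot> g s \<odot> g s) = Suc (len (w \<odot> g s))" unfolding ws(2) using len_mul_g[OF w] False by auto
    have "len (iv (comb n (w \<odot> g s)) \<odot> comb n (w \<odot> g s \<odot> g s)) \<le> R"
      by (rule up[OF ws(1) w(2) l])
    then have "len (iv (comb n (w \<odot> g s)) \<odot> comb n w) \<le> R" unfolding ws(2) .
    moreover have "len (iv (iv (comb n (w \<odot> g s)) \<odot> comb n w)) = len (iv (comb n (w \<odot> g s)) \<odot> comb n w)"
      by (rule len_iv) (use w ws in simp)
    moreover have "iv (iv (comb n (w \<odot> g s)) \<odot> comb n w) = iv (comb n w) \<odot> comb n (w \<odot> g s)"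
      using w ws by (simp add: iv_mul_distrib)
    ultimately show ?thesis by simp
  qed
  have words: "len (iv (comb n w) \<odot> comb n (w \<odot> cls u)) \<le> R * length u" if "w \<in> W" "set u \<subseteq> S" for w u n
    using that
  proof (induction u arbitrary: w)
    case Nil
    have "w \<odot> cls [] = w" using Nil by (simp flip: cox_one_def)
    then show ?case using Nil by simp
  next
    case (Cons s u)
    have s: "s \<in> S" "set u \<subseteq> S" "w \<odot> g s \<in> W" using Cons.prems by auto
    let ?a = "comb n w" let ?b = "comb n (w \<odot> g s)" let ?c = "comb n (w \<odot> g s \<odot> cls u)"
    have W: "?a \<in> W" "?b \<in> W" "?c \<in> W" using Cons.prems(1) s by (simp_all add: cls_in_W)
    have eq: "iv ?a \<odot> ?c = (iv ?a \<odot> ?b) \<odot> (iv ?b \<odot> ?c)" using W by (simp add: mul_assoc)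
    have "len (iv ?a \<odot> ?c) \<le> len (iv ?a \<odot> ?b) + len (iv ?b \<odot> ?c)"
      unfolding eq by (rule len_mul_le) (use W in simp_all)
    also have "\<dots> \<le> R + R * length u"
      by (rule add_mono[OF step[OF Cons.prems(1) s(1)] Cons.IH[OF s(3,2)]])
    finally have le: "len (iv ?a \<odot> ?c) \<le> R + R * length u" .
    have w2: "w \<odot> cls (s # u) = w \<odot> g s \<odot> cls u"
      unfolding cls_Cons[OF s(1,2)] using Cons.prems(1) s by (simp add: mul_assoc cls_in_W)
    show ?case unfolding w2 using le by simp
  qed
  have "len (iv (comb n w) \<odot> comb n (w \<odot> h)) \<le> R * len h" if "w \<in> W" "h \<in> W" for w h n
  proof -
    obtain u where u: "set u \<subseteq> S" "cls u = h" "length u = len h" by (rule reduced_word[OF \<open>h \<in> W\<close>])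
    show ?thesis using words[OF \<open>w \<in> W\<close> u(1), of n] unfolding u .
  qed
  then show ?thesis by blast
qed

end

section \<open>Chains on an order complex\<close>

lemma keys_add_subset: "Poly_Mapping.keys a \<subseteq> X \<Longrightarrow> Poly_Mapping.keys b \<subseteq> X \<Longrightarrow> Poly_Mapping.keys (a + b) \<subseteq> X"
  using Poly_Mapping.keys_add[of a b] by blast

lemma keys_diff_subset: fixes a b :: "'a \<Rightarrow>\<^sub>0 int"
  shows "Poly_Mapping.keys a \<subseteq> X \<Longrightarrow> Poly_Mapping.keys b \<subseteq> X \<Longrightarrow> Poly_Mapping.keys (a - b) \<subseteq> X"
  using keys_diff[of a b] by blast

lemma keys_sum_subset: "(\<And>i. i \<in> I \<Longrightarrow> Poly_Mapping.keys (f i) \<subseteq> X) \<Longrightarrow> Poly_Mapping.keys (sum f I) \<subseteq> X"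
  using keys_sum[of f I] by blast

lemma keys_frag_extend_subset:
  "(\<And>x. x \<in> Poly_Mapping.keys z \<Longrightarrow> Poly_Mapping.keys (f x) \<subseteq> X) \<Longrightarrow> Poly_Mapping.keys (frag_extend f z) \<subseteq> X"
  using keys_frag_extend[of f z] by blast

lemma frag_extend_cong_id: "(\<And>x. x \<in> Poly_Mapping.keys z \<Longrightarrow> f x = frag_of x) \<Longrightarrow> frag_extend f z = z"
  using frag_extend_eq[of z f frag_of] frag_expansion[of z] by simp

lemma frag_extend_frag_extend: "frag_extend f (frag_extend h z) = frag_extend (\<lambda>x. frag_extend f (h x)) z"
proof -
  have "frag_extend f (frag_extend h z) = (\<Sum>i\<in>Poly_Mapping.keys z. frag_cmul (poly_mapping.lookup z i) (frag_extend f (h i)))"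
    unfolding frag_extend_def[of h] by (subst frag_extend_sum) (auto simp: frag_extend_cmul o_def)
  then show ?thesis by (simp add: frag_extend_def[of "\<lambda>x. frag_extend f (h x)"])
qed

lemma frag_extend_add_fun: "frag_extend (\<lambda>x. f x + h x) z = frag_extend f z + frag_extend h z"
  unfolding frag_extend_def by (simp add: sum.distrib frag_cmul_distrib2)

lemma frag_extend_diff_fun: "frag_extend (\<lambda>x. f x - h x) z = frag_extend f z - frag_extend h z"
  using frag_extend_add_fun[of "\<lambda>x. f x - h x" h z] by simp

lemma frag_extend_sum_fun: "finite I \<Longrightarrow> frag_extend (\<lambda>x. \<Sum>i\<in>I. f i x) z = (\<Sum>i\<in>I. frag_extend (f i) z)"
proof (induction I rule: finite_induct)
  case empty then show ?case by (simp add: frag_extend_def)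
next
  case (insert i I) then show ?case by (simp add: frag_extend_add_fun)
qed

text \<open>Augmented simplicial chains of an order complex, as formal sums of lists; the empty
  list is the simplex of dimension -1.\<close>

definition pre :: "'b \<Rightarrow> ('b list \<Rightarrow>\<^sub>0 int) \<Rightarrow> 'b list \<Rightarrow>\<^sub>0 int" where
  "pre T = frag_extend (\<lambda>c. frag_of (T # c))"

text \<open>The boundary of the cone over \<open>c\<close> with apex \<open>T\<close>. A single
  vertex has the empty list as boundary, which is the augmentation; \<open>ev_bdl\<close> recovers
  the alternating sum over faces.\<close>

fun bdl :: "'b list \<Rightarrow> ('b list \<Rightarrow>\<^sub>0 int)" where
  "bdl [] = 0"
| "bdl (T # c) = frag_of c - pre T (bdl c)"

abbreviation "BDL \<equiv> frag_extend bdl"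

lemma BDL_pre: "BDL (pre T x) = x - pre T (BDL x)"
proof -
  have "BDL (pre T x) = frag_extend (\<lambda>c. frag_of c - pre T (bdl c)) x"
    unfolding pre_def frag_extend_frag_extend by simp (simp add: pre_def)
  also have "\<dots> = x - pre T (BDL x)"
    unfolding frag_extend_diff_fun by (simp add: pre_def frag_extend_frag_extend flip: frag_expansion)
  finally show ?thesis .
qed

lemma BDL_bdl: "BDL (bdl c) = 0"
  by (induction c) (simp_all add: frag_extend_diff BDL_pre, simp add: pre_def)

lemma BDL_BDL: "BDL (BDL x) = 0"
  by (simp add: frag_extend_frag_extend BDL_bdl frag_extend_eq_0)

lemma keys_bdl: "c' \<in> Poly_Mapping.keys (bdl c) \<Longrightarrow>
   Suc (length c') = length c \<and> set c' \<subseteq> set c \<and> (sorted_wrt P c \<longrightarrow> sorted_wrt P c')"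
proof (induction c arbitrary: c')
  case (Cons T c)
  have "Poly_Mapping.keys (bdl (T # c)) \<subseteq> {c} \<union> (#) T ` Poly_Mapping.keys (bdl c)"
    using keys_diff[of "frag_of c" "pre T (bdl c)"] keys_frag_extend[of "\<lambda>c. frag_of (T # c)" "bdl c"]
    by (auto simp: pre_def)
  with Cons.prems consider "c' = c" | d where "c' = T # d" "d \<in> Poly_Mapping.keys (bdl c)" by blast
  then show ?case
  proof cases
    case 2
    then show ?thesis using Cons.IH[OF 2(2)] by auto
  qed auto
qed simp

section \<open>Special subgroups and their cosets\<close>

context coxeter
begin

abbreviation WT :: "'s set \<Rightarrow> 's list set set" where "WT \<equiv> special_subgroup S M"
abbreviation cos :: "'s list set \<Rightarrow> 's set \<Rightarrow> 's list set set" where "cos \<equiv> cox_coset S M"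

lemma WT_iff: "x \<in> WT T \<longleftrightarrow> (\<exists>v. set v \<subseteq> T \<and> x = cls v)"
  unfolding special_subgroup_def by auto

lemma WT_subset_W: "T \<subseteq> S \<Longrightarrow> x \<in> WT T \<Longrightarrow> x \<in> W"
  unfolding WT_iff using cls_in_W by auto

lemma WT_mono: "T \<subseteq> T' \<Longrightarrow> WT T \<subseteq> WT T'"
  unfolding special_subgroup_def by auto

lemma WT_e [simp]: "e \<in> WT T"
  unfolding WT_iff cox_one_def by (rule exI[of _ "[]"]) simp

lemma WT_g: "s \<in> T \<Longrightarrow> g s \<in> WT T"
  unfolding WT_iff by (rule exI[of _ "[s]"]) simp

lemma WT_mul: assumes "T \<subseteq> S" "x \<in> WT T" "y \<in> WT T" shows "x \<odot> y \<in> WT T"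
proof -
  obtain u v where "set u \<subseteq> T" "x = cls u" "set v \<subseteq> T" "y = cls v" using assms unfolding WT_iff by auto
  then show ?thesis unfolding WT_iff using assms by (intro exI[of _ "u @ v"]) (auto simp: mul_cls)
qed

lemma WT_iv: assumes "T \<subseteq> S" "x \<in> WT T" shows "iv x \<in> WT T"
proof -
  obtain u where "set u \<subseteq> T" "x = cls u" using assms unfolding WT_iff by auto
  then show ?thesis unfolding WT_iff using assms by (intro exI[of _ "rev u"]) (auto simp: iv_cls)
qed

lemma WT_S: "WT S = W"
  unfolding special_subgroup_def cox_group_def ..

lemma cos_eq: assumes "w \<in> W" "T \<subseteq> S" shows "cos w T = (\<lambda>x. w \<odot> x) ` WT T"
proof
  show "cos w T \<subseteq> (\<lambda>x. w \<odot> x) ` WT T"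
  proof
    fix y assume "y \<in> cos w T"
    then obtain u v where u: "u \<in> w" "set v \<subseteq> T" "y = cls (u @ v)" unfolding cox_coset_def by auto
    then have "y = w \<odot> cls v" using in_W_subset[OF assms(1) u(1)] mul_cls[of u v] assms by auto
    then show "y \<in> (\<lambda>x. w \<odot> x) ` WT T" using u WT_iff by blast
  qed
  show "(\<lambda>x. w \<odot> x) ` WT T \<subseteq> cos w T"
  proof
    fix y assume "y \<in> (\<lambda>x. w \<odot> x) ` WT T"
    then obtain v where v: "set v \<subseteq> T" "y = w \<odot> cls v" by (auto simp: WT_iff)
    obtain u where u: "set u \<subseteq> S" "cls u = w" "length u = len w" by (rule reduced_word[OF assms(1)])
    have "u \<in> w" using cls_self[OF u(1)] u by simp
    moreover have "y = cls (u @ v)" using u v assms mul_cls[of u v] by auto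
    ultimately show "y \<in> cos w T" unfolding cox_coset_def using v by blast
  qed
qed

lemma cos_iff: assumes "w \<in> W" "T \<subseteq> S" shows "y \<in> cos w T \<longleftrightarrow> y \<in> W \<and> iv w \<odot> y \<in> WT T"
proof
  assume "y \<in> cos w T"
  then show "y \<in> W \<and> iv w \<odot> y \<in> WT T" using assms WT_subset_W by (auto simp: cos_eq)
next
  assume y: "y \<in> W \<and> iv w \<odot> y \<in> WT T"
  then have "w \<odot> (iv w \<odot> y) \<in> (\<lambda>x. w \<odot> x) ` WT T" by blast
  then show "y \<in> cos w T" using assms y by (simp add: cos_eq)
qed

lemma cos_self: "w \<in> W \<Longrightarrow> T \<subseteq> S \<Longrightarrow> w \<in> cos w T"
  by (simp add: cos_iff)

lemma cos_subset_W: "w \<in> W \<Longrightarrow> T \<subseteq> S \<Longrightarrow> cos w T \<subseteq> W"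
  by (auto simp: cos_iff)

lemma cos_absorb: assumes "w \<in> W" "T \<subseteq> S" "y \<in> cos w T" shows "cos y T = cos w T"
proof -
  have y: "y \<in> W" "iv w \<odot> y \<in> WT T" using assms cos_iff by auto
  then have iy: "iv y \<odot> w \<in> WT T" using WT_iv[OF assms(2), of "iv w \<odot> y"] assms by (simp add: iv_mul_distrib)
  have "iv y \<odot> z \<in> WT T \<longleftrightarrow> iv w \<odot> z \<in> WT T" if z: "z \<in> W" for z
  proof
    assume "iv y \<odot> z \<in> WT T"
    then have "(iv w \<odot> y) \<odot> (iv y \<odot> z) \<in> WT T" using WT_mul assms y by blast
    then show "iv w \<odot> z \<in> WT T" using y z assms by (simp add: mul_assoc)
  next
    assume "iv w \<odot> z \<in> WT T"
    then have "(iv y \<odot> w) \<odot> (iv w \<odot> z) \<in> WT T" using WT_mul assms iy by blast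
    then show "iv y \<odot> z \<in> WT T" using y z assms by (simp add: mul_assoc)
  qed
  then show ?thesis using cos_iff[OF y(1) assms(2)] cos_iff[OF assms(1,2)] by blast
qed

lemma cos_union: assumes "w \<in> W" "T \<subseteq> T'" "T' \<subseteq> S" shows "(\<Union>y\<in>cos w T. cos y T') = cos w T'"
proof
  have T: "T \<subseteq> S" using assms by blast
  have "cos y T' = cos w T'" if "y \<in> cos w T" for y
    using that assms cos_iff[OF assms(1) T] cos_iff[OF assms(1,3)] WT_mono[OF assms(2)]
    by (intro cos_absorb) auto
  then show "(\<Union>y\<in>cos w T. cos y T') \<subseteq> cos w T'" by auto
  show "cos w T' \<subseteq> (\<Union>y\<in>cos w T. cos y T')" using cos_self[OF assms(1) T] by blast
qed

section \<open>Descents and shortest coset representatives\<close>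

definition rdesc :: "'s list set \<Rightarrow> 's set" where
  "rdesc w = {s \<in> S. Suc (len (w \<odot> g s)) = len w}"

lemma rdesc_iff: "w \<in> W \<Longrightarrow> s \<in> S \<Longrightarrow> s \<in> rdesc w \<longleftrightarrow> negv (act w (al s))"
  and not_rdesc_iff: "w \<in> W \<Longrightarrow> s \<in> S \<Longrightarrow> s \<notin> rdesc w \<longleftrightarrow> posv (act w (al s))"
  using act_al_pos_iff[of w s] len_mul_g[of w s] by (auto simp: rdesc_def)

lemma rdesc_subset: "rdesc w \<subseteq> S"
  by (auto simp: rdesc_def)

lemma act_expand: assumes "z \<in> roots" shows "act w z t = (\<Sum>s\<in>S. z s * act w (al s) t)"
  by (rule linear_expand[of "\<lambda>z. act w z t"]) (use assms roots_support in \<open>auto simp: act_lin\<close>)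

lemma wact_supp: "set u \<subseteq> T \<Longrightarrow> t \<notin> T \<Longrightarrow> wact u x t = x t"
  by (induction u) (auto simp: refl_def al_def)

lemma act_sign_parabolic:
  assumes "w \<in> W" "T \<subseteq> S" "z \<in> roots" "\<And>t. t \<notin> T \<Longrightarrow> z t = 0" "posv z"
  shows "(\<And>s. s \<in> T \<Longrightarrow> posv (act w (al s))) \<Longrightarrow> posv (act w z)"
    and "(\<And>s. s \<in> T \<Longrightarrow> negv (act w (al s))) \<Longrightarrow> negv (act w z)"
proof -
  have r: "act w z \<in> roots" using act_roots assms by simp
  show "posv (act w z)" if p: "\<And>s. s \<in> T \<Longrightarrow> posv (act w (al s))"
  proof -
    have "act w z t \<ge> 0" for t unfolding act_expand[OF assms(3)]
    proof (intro sum_nonneg)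
      fix s show "0 \<le> z s * act w (al s) t"
        using p[of s] assms(4)[of s] assms(5) by (cases "s \<in> T") (auto simp: posv_def)
    qed
    then have "\<not> negv (act w z)" unfolding negv_def by (auto simp: not_less)
    then show ?thesis using r roots_cases by blast
  qed
  show "negv (act w z)" if p: "\<And>s. s \<in> T \<Longrightarrow> negv (act w (al s))"
  proof -
    have "act w z t \<le> 0" for t unfolding act_expand[OF assms(3)]
    proof (intro sum_nonpos)
      fix s show "z s * act w (al s) t \<le> 0"
        using p[of s] assms(4)[of s] assms(5) by (cases "s \<in> T") (auto simp: posv_def negv_def mult_nonneg_nonpos)
    qed
    then have "\<not> posv (act w z)" unfolding posv_def by (auto simp: not_less)
    then show ?thesis using r roots_cases by blast
  qed
qed

lemma parabolic_root: assumes "T \<subseteq> S" "set u \<subseteq> T" "s \<in> T"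
  shows "act (cls u) (al s) \<in> roots" "t \<notin> T \<Longrightarrow> act (cls u) (al s) t = 0"
proof -
  have u: "set u \<subseteq> S" using assms by auto
  show "act (cls u) (al s) \<in> roots" using assms u by (intro rootsI) (auto simp: cls_in_W)
  show "t \<notin> T \<Longrightarrow> act (cls u) (al s) t = 0"
    using wact_supp[OF assms(2)] assms by (auto simp: act_cls[OF u] al_def)
qed

text \<open>The element \<open>w\<close> keeps the simple roots of \<open>T\<close> positive, hence
  all positive roots supported on \<open>T\<close>. So a letter of \<open>T\<close> lengthens w v
  exactly when it lengthens v.\<close>

lemma len_min_coset:
  assumes w: "w \<in> W" "T \<subseteq> S" "T \<inter> rdesc w = {}" and v: "v \<in> WT T"
  shows "len (w \<odot> v) = len w + len v"
proof -
  have pos: "posv (act w (al s))" if "s \<in> T" for s using w that not_rdesc_iff[OF w(1), of s] by blast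
  have "set u \<subseteq> T \<Longrightarrow> len (w \<odot> cls u) = len w + len (cls u)" for u
  proof (induction u rule: rev_induct)
    case Nil then show ?case using w by (simp flip: cox_one_def)
  next
    case (snoc s u)
    then have u: "set u \<subseteq> T" "s \<in> T" "set u \<subseteq> S" "s \<in> S" using w by auto
    have uW: "cls u \<in> W" using u cls_in_W by simp
    have c: "cls (u @ [s]) = cls u \<odot> g s" using u by (simp add: cls_snoc)
    have IH: "len (w \<odot> cls u) = len w + len (cls u)" using snoc u by simp
    let ?z = "act (cls u) (al s)"
    have az: "act (w \<odot> cls u) (al s) = act w ?z" using w uW by (simp add: act_mul)
    note z = parabolic_root[OF w(2) u(1,2)]
    from z(1) show ?case
    proof (cases rule: roots_cases)
      case 1
      then have "posv (act w ?z)" using act_sign_parabolic(1)[OF w(1,2) z] pos by blast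
      then have "len (w \<odot> cls u \<odot> g s) = Suc (len (w \<odot> cls u))"
        using act_al_pos_iff(1)[of "w \<odot> cls u" s] az w uW u by simp
      then show ?thesis using IH act_al_pos_iff(1)[OF uW u(4)] 1 w uW u by (simp add: c mul_assoc)
    next
      case 2
      then have n: "posv (\<lambda>t. - ?z t)" by (simp add: posv_neg)
      have "posv (act w (\<lambda>t. - ?z t))"
        by (rule act_sign_parabolic(1)[OF w(1,2) roots_uminus[OF z(1)] _ n]) (use z pos in auto)
      then have "negv (act w ?z)" by (simp add: act_uminus posv_neg)
      then have "Suc (len (w \<odot> cls u \<odot> g s)) = len (w \<odot> cls u)"
        using act_al_pos_iff(2)[of "w \<odot> cls u" s] az w uW u by simp
      then show ?thesis using IH act_al_pos_iff(2)[OF uW u(4)] 2 w uW u by (simp add: c mul_assoc)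
    qed
  qed
  then show ?thesis using v WT_iff by auto
qed

text \<open>The sign-reversed form of \<open>len_min_coset\<close>: \<open>w\<close> is longest in
  its coset of the subgroup generated by its right descents.\<close>

lemma len_max_coset:
  assumes w: "w \<in> W" and v: "v \<in> WT (rdesc w)"
  shows "len (w \<odot> v) + len v = len w"
proof -
  let ?T = "rdesc w"
  note T = rdesc_subset[of w]
  have neg: "negv (act w (al s))" if "s \<in> ?T" for s using w that rdesc_iff[OF w(1), of s] T by blast
  have "set u \<subseteq> ?T \<Longrightarrow> len (w \<odot> cls u) + len (cls u) = len w" for u
  proof (induction u rule: rev_induct)
    case Nil then show ?case using w by (simp flip: cox_one_def)
  next
    case (snoc s u)
    then have u: "set u \<subseteq> ?T" "s \<in> ?T" "set u \<subseteq> S" "s \<in> S" using T by auto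
    have uW: "cls u \<in> W" using u cls_in_W by simp
    have c: "cls (u @ [s]) = cls u \<odot> g s" using u by (simp add: cls_snoc)
    have IH: "len (w \<odot> cls u) + len (cls u) = len w" using snoc u by simp
    let ?z = "act (cls u) (al s)"
    have az: "act (w \<odot> cls u) (al s) = act w ?z" using w uW by (simp add: act_mul)
    note z = parabolic_root[OF T u(1,2)]
    from z(1) show ?case
    proof (cases rule: roots_cases)
      case 1
      then have "negv (act w ?z)" using act_sign_parabolic(2)[OF w T z] neg by blast
      then have "Suc (len (w \<odot> cls u \<odot> g s)) = len (w \<odot> cls u)"
        using act_al_pos_iff(2)[of "w \<odot> cls u" s] az w uW u by simp
      then show ?thesis using IH act_al_pos_iff(1)[OF uW u(4)] 1 w uW u by (simp add: c mul_assoc)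
    next
      case 2
      then have n: "posv (\<lambda>t. - ?z t)" by (simp add: posv_neg)
      have "negv (act w (\<lambda>t. - ?z t))"
        by (rule act_sign_parabolic(2)[OF w T roots_uminus[OF z(1)] _ n]) (use z neg in auto)
      then have "posv (act w ?z)" by (simp add: act_uminus negv_neg)
      then have "len (w \<odot> cls u \<odot> g s) = Suc (len (w \<odot> cls u))"
        using act_al_pos_iff(1)[of "w \<odot> cls u" s] az w uW u by simp
      then show ?thesis using IH act_al_pos_iff(2)[OF uW u(4)] 2 w uW u by (simp add: c mul_assoc)
    qed
  qed
  then show ?thesis using v WT_iff by auto
qed

lemma finite_len_le: "finite {w \<in> W. len w \<le> n}"
proof -
  have "{w \<in> W. len w \<le> n} \<subseteq> cls ` {u. set u \<subseteq> S \<and> length u \<le> n}"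
  proof
    fix w assume "w \<in> {w \<in> W. len w \<le> n}"
    then have w: "w \<in> W" "len w \<le> n" by auto
    obtain u where "set u \<subseteq> S" "cls u = w" "length u = len w" by (rule reduced_word[OF w(1)])
    then show "w \<in> cls ` {u. set u \<subseteq> S \<and> length u \<le> n}" using w by (intro image_eqI[of _ _ u]) auto
  qed
  then show ?thesis using finite_lists_length_le[OF finite_S] finite_subset by blast
qed

text \<open>Lengths in this subgroup are bounded by that of \<open>w\<close>. In
  \<open>Davis_acyclic\<close> this makes the part of a chamber shared with shorter chambers
  acyclic.\<close>

lemma spherical_rdesc: assumes "w \<in> W" shows "spherical S M (rdesc w)"
proof -
  have "WT (rdesc w) \<subseteq> {v \<in> W. len v \<le> len w}"
  proof
    fix v assume v: "v \<in> WT (rdesc w)"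
    have "v \<in> W" by (rule WT_subset_W[OF rdesc_subset v])
    then show "v \<in> {v \<in> W. len v \<le> len w}" using len_max_coset[OF assms v] by simp
  qed
  then have "finite (WT (rdesc w))" by (rule finite_subset[OF _ finite_len_le])
  then show ?thesis unfolding spherical_def using rdesc_subset by simp
qed

lemma spherical_mono: "T \<subseteq> T' \<Longrightarrow> spherical S M T' \<Longrightarrow> spherical S M T"
  unfolding spherical_def using finite_subset[OF WT_mono[of T T']] by auto

lemma spherical_subset: "spherical S M T \<Longrightarrow> T \<subseteq> S"
  by (simp add: spherical_def)

lemma spherical_empty: "spherical S M {}"
proof -
  have "WT {} = {e}" unfolding special_subgroup_def cox_one_def by simp
  then show ?thesis by (simp add: spherical_def)
qed

lemma min_coset_unique:
  assumes "w \<in> W" "T \<subseteq> S" "T \<inter> rdesc w = {}" "y \<in> cos w T"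
  shows "len w \<le> len y" "len y \<le> len w \<Longrightarrow> y = w"
proof -
  obtain v where v: "v \<in> WT T" "y = w \<odot> v" using assms(4) unfolding cos_eq[OF assms(1,2)] by blast
  have l: "len y = len w + len v" unfolding v(2) by (rule len_min_coset[OF assms(1-3) v(1)])
  then show "len w \<le> len y" by simp
  assume "len y \<le> len w"
  then have "len v = 0" using l by linarith
  then have "v = e" using len_0_iff[OF WT_subset_W[OF assms(2) v(1)]] by simp
  then show "y = w" using v(2) assms(1) by simp
qed

lemma min_coset_exists:
  assumes "w \<in> W" "T \<subseteq> S" obtains y where "y \<in> cos w T" "T \<inter> rdesc y = {}"
proof -
  obtain y where y: "y \<in> cos w T" "\<forall>z. z \<in> cos w T \<longrightarrow> len y \<le> len z"
    using ex_has_least_nat[of "\<lambda>y. y \<in> cos w T" w len] cos_self[OF assms] by blast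
  have yW: "y \<in> W" using y cos_subset_W assms by blast
  have "s \<notin> rdesc y" if s: "s \<in> T" for s
  proof
    assume d: "s \<in> rdesc y"
    have "iv w \<odot> (y \<odot> g s) \<in> WT T"
      using WT_mul[OF assms(2) _ WT_g[OF s], of "iv w \<odot> y"] y cos_iff[OF assms] s assms yW
      by (auto simp: mul_assoc subset_iff)
    then have "y \<odot> g s \<in> cos w T" using cos_iff[OF assms] yW s assms by auto
    then show False using y(2) d by (fastforce simp: rdesc_def)
  qed
  then show ?thesis using that y by blast
qed

section \<open>Acyclicity of chambers and links\<close>

text \<open>The empty chain is the simplex of dimension -1 in augmented chains; giving it the stabiliser \<open>W\<close>
  (\<open>hc [] = S\<close>) makes its translates coincide.\<close>

definition hc :: "'s set list \<Rightarrow> 's set" where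
  "hc c = (if c = [] then S else hd c)"

text \<open>Chains, and below simplices \<open>SX k\<close>, are indexed by the number of vertices, one more than the
  dimension.\<close>

definition Ch :: "nat \<Rightarrow> 's set list set" where
  "Ch k = {c. length c = k \<and> (\<forall>T\<in>set c. spherical S M T) \<and> sorted_wrt (\<subset>) c}"

definition smp :: "'s list set \<Rightarrow> 's set list \<Rightarrow> 's dsimplex" where
  "smp w c = (cos w (hc c), c)"

definition SX :: "nat \<Rightarrow> 's dsimplex set" where
  "SX k = {smp w c | w c. w \<in> W \<and> c \<in> Ch k}"

lemma finite_Ch: "finite (Ch k)"
proof -
  have "Ch k \<subseteq> {c. set c \<subseteq> Pow S \<and> length c = k}" unfolding Ch_def using spherical_subset by auto
  then show ?thesis using finite_lists_length_eq[of "Pow S" k] finite_S finite_subset by auto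
qed

lemma hc_subset: "c \<in> Ch k \<Longrightarrow> hc c \<subseteq> S"
  unfolding Ch_def hc_def using spherical_subset by (cases c) auto

lemma sorted_hd_subset: "sorted_wrt (\<subset>) c \<Longrightarrow> T \<in> set c \<Longrightarrow> hd c \<subseteq> T"
  by (cases c) auto

lemma keys_bdl_Ch: assumes "c \<in> Ch k" "c' \<in> Poly_Mapping.keys (bdl c)"
  shows "k = Suc (length c')" "c' \<in> Ch (k - 1)" "hc c \<subseteq> hc c'"
proof -
  note b = keys_bdl[OF assms(2), of "(\<subset>)"]
  show "k = Suc (length c')" using b assms by (auto simp: Ch_def)
  then show "c' \<in> Ch (k - 1)" using b assms by (auto simp: Ch_def)
  show "hc c \<subseteq> hc c'"
  proof (cases "c' = []")
    case True then show ?thesis using hc_subset[OF assms(1)] by (simp add: hc_def)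
  next
    case False
    then have "hd c' \<in> set c" using b by auto
    moreover have "c \<noteq> []" using b by auto
    ultimately show ?thesis using sorted_hd_subset[of c] assms False by (auto simp: hc_def Ch_def)
  qed
qed

lemma BDL_keys: "Poly_Mapping.keys z \<subseteq> Ch k \<Longrightarrow> Poly_Mapping.keys (BDL z) \<subseteq> Ch (k - 1)"
  using keys_bdl_Ch(2) by (intro keys_frag_extend_subset) blast

definition CA :: "'s set \<Rightarrow> nat \<Rightarrow> 's set list set" where
  "CA A k = {c \<in> Ch k. \<forall>T\<in>set c. A \<subseteq> T}"

text \<open>The union of the mirrors of \<open>U\<close> in the chamber, intersected with the
  mirrors of \<open>A\<close>; the parameter \<open>A\<close> is there for the Mayer-Vietoris
  induction.\<close>

definition QA :: "'s set \<Rightarrow> 's set \<Rightarrow> nat \<Rightarrow> 's set list set" where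
  "QA A U k = {c \<in> Ch k. \<forall>T\<in>set c. A \<subseteq> T \<and> T \<inter> U \<noteq> {}}"

lemma BDL_keys_CA: "Poly_Mapping.keys z \<subseteq> CA A k \<Longrightarrow> Poly_Mapping.keys (BDL z) \<subseteq> CA A (k - 1)"
proof (rule keys_frag_extend_subset, rule subsetI)
  fix c c' assume "Poly_Mapping.keys z \<subseteq> CA A k" "c \<in> Poly_Mapping.keys z" "c' \<in> Poly_Mapping.keys (bdl c)"
  then show "c' \<in> CA A (k - 1)" using keys_bdl_Ch[of c k c'] keys_bdl[of c' c "(\<subset>)"] by (auto simp: CA_def)
qed

lemma BDL_keys_QA: "Poly_Mapping.keys z \<subseteq> QA A U k \<Longrightarrow> Poly_Mapping.keys (BDL z) \<subseteq> QA A U (k - 1)"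
proof (rule keys_frag_extend_subset, rule subsetI)
  fix c c' assume "Poly_Mapping.keys z \<subseteq> QA A U k" "c \<in> Poly_Mapping.keys z" "c' \<in> Poly_Mapping.keys (bdl c)"
  then show "c' \<in> QA A U (k - 1)" using keys_bdl_Ch[of c k c'] keys_bdl[of c' c "(\<subset>)"] by (auto simp: QA_def)
qed

definition cone :: "'s set \<Rightarrow> 's set list \<Rightarrow> ('s set list \<Rightarrow>\<^sub>0 int)" where
  "cone A c = (if c \<noteq> [] \<and> hd c = A then 0 else frag_of (A # c))"

text \<open>\<open>A\<close> is the least element of the poset, so its order complex is a cone;
  coning off contracts the augmented complex, including the empty chain.\<close>

lemma cone_homotopy: assumes "c \<in> CA A k" "spherical S M A"
  shows "BDL (cone A c) + frag_extend (cone A) (bdl c) = frag_of c"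
proof (cases c)
  case Nil
  then show ?thesis by (simp add: cone_def pre_def)
next
  case (Cons T d)
  have c: "sorted_wrt (\<subset>) (T # d)" "\<forall>X\<in>set (T # d). A \<subseteq> X" using assms Cons by (auto simp: CA_def Ch_def)
  show ?thesis
  proof (cases "T = A")
    case True
    have "d = [] \<or> hd d \<noteq> A" using c True by (cases d) auto
    then have 1: "cone A d = frag_of c" using Cons True by (auto simp: cone_def)
    have "frag_extend (cone A) (pre A (bdl d)) = 0"
      unfolding pre_def frag_extend_frag_extend by (rule frag_extend_eq_0) (simp add: cone_def)
    moreover have "cone A c = 0" using True Cons by (simp add: cone_def)
    moreover have "bdl c = frag_of d - pre A (bdl d)" using True Cons by simp
    ultimately show ?thesis using 1 by (simp add: frag_extend_diff)
  next
    case False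
    have "A \<notin> set c" using c Cons False by auto
    then have "hd c' \<noteq> A" if "c' \<in> Poly_Mapping.keys (bdl c)" "c' \<noteq> []" for c'
      using keys_bdl[OF that(1)] that(2) hd_in_set by blast
    then have "frag_extend (cone A) (bdl c) = pre A (bdl c)"
      unfolding pre_def by (intro frag_extend_eq) (auto simp: cone_def)
    moreover have "cone A c = frag_of (A # c)" using False Cons by (simp add: cone_def)
    ultimately show ?thesis by simp
  qed
qed

lemma cone_keys: assumes "c \<in> CA A k" "spherical S M A" shows "Poly_Mapping.keys (cone A c) \<subseteq> CA A (Suc k)"
proof (cases "c \<noteq> [] \<and> hd c = A")
  case False
  have "A \<subset> T" if "T \<in> set c" for T
  proof -
    have "A \<subseteq> hd c" "hd c \<subseteq> T" "hd c \<noteq> A"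
      using assms that False sorted_hd_subset[of c T] by (cases c; auto simp: CA_def Ch_def)+
    then show ?thesis by blast
  qed
  then show ?thesis using assms False by (auto simp: cone_def CA_def Ch_def)
qed (simp add: cone_def)

lemma acyclic_CA:
  assumes z: "Poly_Mapping.keys z \<subseteq> CA A k" "BDL z = 0" and A: "spherical S M A"
  shows "\<exists>y. Poly_Mapping.keys y \<subseteq> CA A (Suc k) \<and> BDL y = z"
proof (intro exI conjI)
  show "Poly_Mapping.keys (frag_extend (cone A) z) \<subseteq> CA A (Suc k)"
    using z cone_keys[OF _ A] by (intro keys_frag_extend_subset) blast
  have "BDL (frag_extend (cone A) z) + frag_extend (cone A) (BDL z)
      = frag_extend (\<lambda>c. BDL (cone A c) + frag_extend (cone A) (bdl c)) z"
    unfolding frag_extend_frag_extend frag_extend_add_fun ..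
  also have "\<dots> = z" using z cone_homotopy[OF _ A] by (intro frag_extend_cong_id) blast
  finally show "BDL (frag_extend (cone A) z) = z" using z by simp
qed

definition restr :: "('b \<Rightarrow> bool) \<Rightarrow> ('b \<Rightarrow>\<^sub>0 int) \<Rightarrow> 'b \<Rightarrow>\<^sub>0 int" where
  "restr P z = frag_extend (\<lambda>x. if P x then frag_of x else 0) z"

lemma restr_split: "z = restr P z + restr (\<lambda>x. \<not> P x) z"
proof -
  have "restr P z + restr (\<lambda>x. \<not> P x) z = frag_extend frag_of z"
    unfolding restr_def frag_extend_add_fun[symmetric] by (intro frag_extend_eq) auto
  then show ?thesis by (simp flip: frag_expansion)
qed

lemma keys_restr: "Poly_Mapping.keys (restr P z) \<subseteq> {x \<in> Poly_Mapping.keys z. P x}"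
  unfolding restr_def by (intro keys_frag_extend_subset) auto

text \<open>Mayer-Vietoris: adding \<open>s\<close> to \<open>U\<close> glues the cone of the sets
  that contain \<open>s\<close> to the mirrors of \<open>U\<close>, along the mirrors of
  \<open>U\<close> taken with \<open>s\<close> added to \<open>A\<close>. Both pieces and their
  intersection are acyclic.\<close>

lemma acyclic_QA:
  assumes "finite U" "U \<noteq> {}" "spherical S M (A \<union> U)"
    "Poly_Mapping.keys z \<subseteq> QA A U k" "BDL z = 0"
  shows "\<exists>y. Poly_Mapping.keys y \<subseteq> QA A U (Suc k) \<and> BDL y = z"
  using assms
proof (induction U arbitrary: A z k rule: finite_ne_induct)
  case (singleton s)
  have "QA A {s} k = CA (insert s A) k" for k by (auto simp: QA_def CA_def)
  then show ?case using acyclic_CA[of z "insert s A" k] singleton by simp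
next
  case (insert s U)
  have sph: "spherical S M (insert s A)" "spherical S M (A \<union> U)" "spherical S M (insert s A \<union> U)"
    using insert.prems(1) spherical_mono[of _ "A \<union> insert s U"] by auto
  define z1 where "z1 = restr (\<lambda>c. \<forall>T\<in>set c. s \<in> T) z"
  define z2 where "z2 = restr (\<lambda>c. \<not> (\<forall>T\<in>set c. s \<in> T)) z"
  have zz: "z = z1 + z2" unfolding z1_def z2_def by (rule restr_split)
  have k1: "Poly_Mapping.keys z1 \<subseteq> CA (insert s A) k"
  proof
    fix c assume "c \<in> Poly_Mapping.keys z1"
    then have "c \<in> Poly_Mapping.keys z" "\<forall>T\<in>set c. s \<in> T"
      using keys_restr[of "\<lambda>c. \<forall>T\<in>set c. s \<in> T" z] unfolding z1_def by blast+
    moreover from this have "c \<in> QA A (insert s U) k" using insert.prems by blast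
    ultimately show "c \<in> CA (insert s A) k" unfolding CA_def QA_def by simp
  qed
  have k2: "Poly_Mapping.keys z2 \<subseteq> QA A U k"
  proof
    fix c assume "c \<in> Poly_Mapping.keys z2"
    then have c: "c \<in> QA A (insert s U) k" "\<exists>T\<in>set c. s \<notin> T"
      using keys_restr[of "\<lambda>c. \<not> (\<forall>T\<in>set c. s \<in> T)" z] insert.prems by (auto simp: z2_def)
    \<comment> \<open>If some member of the chain omits \<open>s\<close>, so does the least one,
      which must therefore meet \<open>U\<close>.\<close>
    then have hs: "s \<notin> hd c" "c \<noteq> []" using sorted_hd_subset[of c] by (auto simp: QA_def Ch_def)
    then have "hd c \<inter> U \<noteq> {}" using c by (auto simp: QA_def)
    then have "T \<inter> U \<noteq> {}" if "T \<in> set c" for T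
      using sorted_hd_subset[of c T] c that by (auto simp: QA_def Ch_def)
    then show "c \<in> QA A U k" using c by (auto simp: QA_def)
  qed
  have bb: "BDL z1 = - BDL z2" using insert.prems zz by (simp add: frag_extend_add add_eq_0_iff2)
  \<comment> \<open>The boundary common to the two pieces lies in the intersection and is filled
    there; the filling completes each piece to a cycle.\<close>
  have "\<exists>y. Poly_Mapping.keys y \<subseteq> QA (insert s A) U k \<and> BDL y = BDL z1"
  proof (cases k)
    case 0
    have "BDL z1 = 0" using k1 0 by (intro frag_extend_eq_0) (auto simp: CA_def Ch_def)
    then show ?thesis by (intro exI[of _ 0]) simp
  next
    case (Suc k')
    have "Poly_Mapping.keys (BDL z1) \<subseteq> CA (insert s A) k'" using BDL_keys_CA[OF k1] Suc by simp
    moreover have "Poly_Mapping.keys (BDL z1) \<subseteq> QA A U k'" using BDL_keys_QA[OF k2] Suc bb by simp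
    ultimately have "Poly_Mapping.keys (BDL z1) \<subseteq> QA (insert s A) U k'" by (auto simp: QA_def CA_def)
    then show ?thesis using insert.IH[OF sph(3) _ BDL_BDL] Suc by simp
  qed
  then obtain y where y: "Poly_Mapping.keys y \<subseteq> QA (insert s A) U k" "BDL y = BDL z1" by blast
  have "\<exists>y1. Poly_Mapping.keys y1 \<subseteq> CA (insert s A) (Suc k) \<and> BDL y1 = z1 - y"
    using y k1 sph by (intro acyclic_CA keys_diff_subset) (auto simp: frag_extend_diff QA_def CA_def)
  then obtain y1 where y1: "Poly_Mapping.keys y1 \<subseteq> CA (insert s A) (Suc k)" "BDL y1 = z1 - y" by blast
  have "\<exists>y2. Poly_Mapping.keys y2 \<subseteq> QA A U (Suc k) \<and> BDL y2 = z2 + y"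
    using y k2 bb by (intro insert.IH[OF sph(2)] keys_add_subset) (auto simp: frag_extend_add QA_def)
  then obtain y2 where y2: "Poly_Mapping.keys y2 \<subseteq> QA A U (Suc k)" "BDL y2 = z2 + y" by blast
  have "Poly_Mapping.keys (y1 + y2) \<subseteq> QA A (insert s U) (Suc k)"
    using y1 y2 by (intro keys_add_subset) (auto simp: QA_def CA_def)
  moreover have "BDL (y1 + y2) = z" using y1 y2 zz by (simp add: frag_extend_add)
  ultimately show ?case by blast
qed

text \<open>The whole chamber and the mirrors of \<open>U\<close> are both acyclic, so a chain with
  boundary in the mirrors can be pushed into them.\<close>

lemma relative_acyclic:
  assumes U: "U \<noteq> {}" "spherical S M U" and x: "Poly_Mapping.keys x \<subseteq> Ch k"
    and b: "Poly_Mapping.keys (BDL x) \<subseteq> QA {} U (k - 1)"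
  shows "\<exists>y. Poly_Mapping.keys y \<subseteq> Ch (Suc k) \<and> Poly_Mapping.keys (x - BDL y) \<subseteq> QA {} U k"
proof (cases k)
  case 0
  then have "Poly_Mapping.keys x \<subseteq> QA {} U k" using x by (auto simp: QA_def Ch_def)
  then show ?thesis by (intro exI[of _ 0]) simp
next
  case (Suc k')
  have fU: "finite U" using U spherical_subset finite_S finite_subset by blast
  obtain y' where y': "Poly_Mapping.keys y' \<subseteq> QA {} U k" "BDL y' = BDL x"
    using acyclic_QA[OF fU U(1), of "{}" "BDL x" k'] U b Suc BDL_BDL by auto
  have CA: "CA {} k = Ch k" for k by (auto simp: CA_def)
  have "\<exists>y. Poly_Mapping.keys y \<subseteq> CA {} (Suc k) \<and> BDL y = x - y'"
    using y' x spherical_empty by (intro acyclic_CA keys_diff_subset) (auto simp: frag_extend_diff QA_def CA_def)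
  then obtain y where y: "Poly_Mapping.keys y \<subseteq> Ch (Suc k)" "BDL y = x - y'" unfolding CA by blast
  have "x - BDL y = y'" using y by simp
  then show ?thesis using y y' by metis
qed

section \<open>Acyclicity of the Davis complex\<close>

abbreviation keys where "keys \<equiv> Poly_Mapping.keys"

definition inc :: "'s list set \<Rightarrow> ('s set list \<Rightarrow>\<^sub>0 int) \<Rightarrow> ('s dsimplex \<Rightarrow>\<^sub>0 int)" where
  "inc w = frag_extend (\<lambda>c. frag_of (smp w c))"

text \<open>The coset of a face is written as a union of cosets, so that no representative is
  chosen; with \<open>hc [] = S\<close> all vertices have the same empty simplex as
  boundary.\<close>

definition bd :: "'s dsimplex \<Rightarrow> ('s dsimplex \<Rightarrow>\<^sub>0 int)" where
  "bd \<sigma> = frag_extend (\<lambda>c. frag_of (\<Union>w\<in>fst \<sigma>. cos w (hc c), c)) (bdl (snd \<sigma>))"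

abbreviation "BD \<equiv> frag_extend bd"

lemma smp_in_SX: "w \<in> W \<Longrightarrow> c \<in> Ch k \<Longrightarrow> smp w c \<in> SX k"
  unfolding SX_def by blast

lemma inc_keys: "w \<in> W \<Longrightarrow> keys x \<subseteq> Ch k \<Longrightarrow> keys (inc w x) \<subseteq> SX k"
  unfolding inc_def by (intro keys_frag_extend_subset) (auto intro: smp_in_SX)

lemma snd_smp [simp]: "snd (smp w c) = c"
  by (simp add: smp_def)

lemma bd_smp: assumes "w \<in> W" "c \<in> Ch k" shows "bd (smp w c) = inc w (bdl c)"
  unfolding bd_def inc_def snd_smp
proof (rule frag_extend_eq)
  fix c' assume c': "c' \<in> keys (bdl c)"
  note k = keys_bdl_Ch[OF assms(2) c']
  have "(\<Union>y\<in>cos w (hc c). cos y (hc c')) = cos w (hc c')"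
    by (rule cos_union[OF assms(1) k(3) hc_subset[OF k(2)]])
  then show "frag_of (\<Union>w\<in>fst (smp w c). cos w (hc c'), c') = frag_of (smp w c')"
    by (simp add: smp_def)
qed

lemma BD_inc: assumes "w \<in> W" "keys x \<subseteq> Ch k" shows "BD (inc w x) = inc w (BDL x)"
  unfolding inc_def frag_extend_frag_extend
proof (rule frag_extend_eq)
  fix c assume "c \<in> keys x"
  then have "c \<in> Ch k" using assms(2) by blast
  then show "BD (frag_of (smp w c)) = frag_extend (\<lambda>c. frag_of (smp w c)) (bdl c)"
    using bd_smp[OF assms(1)] by (simp add: inc_def)
qed

lemma keys_bd: assumes "\<sigma> \<in> SX k" shows "keys (bd \<sigma>) \<subseteq> SX (k - 1)"
proof -
  obtain w c where w: "w \<in> W" "c \<in> Ch k" "\<sigma> = smp w c" using assms unfolding SX_def by auto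
  have "keys (bdl c) \<subseteq> Ch (k - 1)" using keys_bdl_Ch(2)[OF w(2)] by blast
  then show ?thesis unfolding w(3) bd_smp[OF w(1,2)] by (rule inc_keys[OF w(1)])
qed

lemma BD_bd: assumes "\<sigma> \<in> SX k" shows "BD (bd \<sigma>) = 0"
proof -
  obtain w c where w: "w \<in> W" "c \<in> Ch k" "\<sigma> = smp w c" using assms unfolding SX_def by auto
  have "keys (bdl c) \<subseteq> Ch (k - 1)" using keys_bdl_Ch(2)[OF w(2)] by blast
  then have "BD (inc w (bdl c)) = inc w (BDL (bdl c))" by (rule BD_inc[OF w(1)])
  then show ?thesis unfolding w(3) bd_smp[OF w(1,2)] BDL_bdl by (simp add: inc_def)
qed

lemma BD_BD: "keys z \<subseteq> SX k \<Longrightarrow> BD (BD z) = 0"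
  unfolding frag_extend_frag_extend by (rule frag_extend_eq_0, rule BD_bd) blast

text \<open>The union of the chambers of length at most \<open>n\<close>, as
  \<open>smp_in_LV\<close> shows; the shortest representative makes the level of a simplex well
  defined.\<close>

definition LV :: "nat \<Rightarrow> nat \<Rightarrow> 's dsimplex set" where
  "LV n k = {smp w c | w c. w \<in> W \<and> c \<in> Ch k \<and> hc c \<inter> rdesc w = {} \<and> len w \<le> n}"

lemma smp_eqI: assumes "w \<in> W" "c \<in> Ch k" "y \<in> cos w (hc c)" shows "smp y c = smp w c"
  unfolding smp_def using cos_absorb[OF assms(1) hc_subset[OF assms(2)] assms(3)] by simp

lemma smp_min_rep: assumes "w \<in> W" "c \<in> Ch k"
  obtains y where "y \<in> W" "y \<in> cos w (hc c)" "hc c \<inter> rdesc y = {}" "smp w c = smp y c"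
proof -
  note T = hc_subset[OF assms(2)]
  obtain y where y: "y \<in> cos w (hc c)" "hc c \<inter> rdesc y = {}" by (rule min_coset_exists[OF assms(1) T])
  have "y \<in> W" using y(1) cos_subset_W[OF assms(1) T] by blast
  moreover have "smp w c = smp y c" using smp_eqI[OF assms y(1)] by simp
  ultimately show ?thesis using that[of y] y by simp
qed

lemma smp_min_unique:
  assumes "w \<in> W" "c \<in> Ch k" "hc c \<inter> rdesc w = {}" "w' \<in> W" "smp w' c' = smp w c"
  shows "c' = c" "len w \<le> len w'" "len w' \<le> len w \<Longrightarrow> w' = w"
proof -
  show c: "c' = c" using assms(5) by (simp add: smp_def)
  note T = hc_subset[OF assms(2)]
  have "w' \<in> cos w (hc c)" using cos_self[OF assms(4) T] assms(5) by (simp add: smp_def c)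
  note u = min_coset_unique[OF assms(1) T assms(3) this]
  show "len w \<le> len w'" by (rule u(1))
  show "len w' \<le> len w \<Longrightarrow> w' = w" by (rule u(2))
qed

lemma SX_LV: assumes "\<sigma> \<in> SX k" shows "\<exists>n. \<sigma> \<in> LV n k"
proof -
  obtain w c where w: "w \<in> W" "c \<in> Ch k" "\<sigma> = smp w c" using assms unfolding SX_def by auto
  obtain y where "y \<in> W" "y \<in> cos w (hc c)" "hc c \<inter> rdesc y = {}" "smp w c = smp y c"
    by (rule smp_min_rep[OF w(1,2)])
  then have "\<sigma> \<in> LV (len y) k" unfolding LV_def using w by blast
  then show ?thesis by blast
qed

lemma LV_mono: assumes "m \<le> n" shows "LV m k \<subseteq> LV n k"
proof
  fix \<sigma> assume "\<sigma> \<in> LV m k"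
  then obtain w c where w: "w \<in> W" "c \<in> Ch k" "hc c \<inter> rdesc w = {}" "\<sigma> = smp w c" "len w \<le> m"
    unfolding LV_def by blast
  have "len w \<le> n" using w(5) assms by simp
  then show "\<sigma> \<in> LV n k" unfolding LV_def using w by blast
qed

lemma smp_in_LV: assumes "w \<in> W" "c \<in> Ch k" "len w \<le> n" shows "smp w c \<in> LV n k"
proof -
  obtain y where y: "y \<in> W" "y \<in> cos w (hc c)" "hc c \<inter> rdesc y = {}" "smp w c = smp y c"
    by (rule smp_min_rep[OF assms(1,2)])
  have "len y \<le> len w" using smp_min_unique(2)[OF y(1) assms(2) y(3) assms(1) y(4)] .
  then have "len y \<le> n" using assms(3) by simp
  then show ?thesis unfolding LV_def y(4) using y(1,3) assms(2) by blast
qed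

lemma smp_in_LV_less: assumes "w \<in> W" "c \<in> Ch k" "len w \<le> Suc n" "hc c \<inter> rdesc w \<noteq> {}"
  shows "smp w c \<in> LV n k"
proof -
  obtain y where y: "y \<in> W" "y \<in> cos w (hc c)" "hc c \<inter> rdesc y = {}" "smp w c = smp y c"
    by (rule smp_min_rep[OF assms(1,2)])
  have "\<not> len w \<le> len y"
  proof
    assume "len w \<le> len y"
    then have "w = y" by (rule smp_min_unique(3)[OF y(1) assms(2) y(3) assms(1) y(4)])
    then show False using y(3) assms(4) by simp
  qed
  then have "len y \<le> n" using assms(3) by simp
  then show ?thesis unfolding LV_def y(4) using y(1,3) assms(2) by blast
qed

lemma keys_BD_LV: assumes "keys z \<subseteq> LV n k" shows "keys (BD z) \<subseteq> LV n (k - 1)"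
proof (rule keys_frag_extend_subset)
  fix \<sigma> assume "\<sigma> \<in> keys z"
  then obtain w c where w: "w \<in> W" "c \<in> Ch k" "\<sigma> = smp w c" "len w \<le> n" using assms unfolding LV_def by blast
  have "keys (bdl c) \<subseteq> Ch (k - 1)" using keys_bdl_Ch(2)[OF w(2)] by blast
  then show "keys (bd \<sigma>) \<subseteq> LV n (k - 1)" unfolding w(3) bd_smp[OF w(1,2)] inc_def
    using smp_in_LV[OF w(1) _ w(4)] by (intro keys_frag_extend_subset) auto
qed

text \<open>The component of a chain on those simplices of the chamber \<open>w\<close> that lie in
  no shorter chamber.\<close>

definition prj :: "'s list set \<Rightarrow> 's dsimplex \<Rightarrow> ('s set list \<Rightarrow>\<^sub>0 int)" where
  "prj w \<sigma> = (if \<sigma> = smp w (snd \<sigma>) \<and> hc (snd \<sigma>) \<inter> rdesc w = {} then frag_of (snd \<sigma>) else 0)"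

lemma prj_smp_self: "prj w (smp w c) = (if hc c \<inter> rdesc w = {} then frag_of c else 0)"
  by (simp add: prj_def)

lemma prj_smp_other: assumes "w \<in> W" "w' \<in> W" "c \<in> Ch k" "len w' \<le> len w" "w' \<noteq> w"
  shows "prj w (smp w' c) = 0"
proof -
  have "\<not> (smp w' c = smp w c \<and> hc c \<inter> rdesc w = {})"
    using smp_min_unique(3)[OF assms(1,3) _ assms(2) _ assms(4)] assms(5) by blast
  then show ?thesis by (auto simp: prj_def)
qed

lemma top_decompose:
  assumes "keys z \<subseteq> LV (Suc n) k"
  shows "keys (z - (\<Sum>w\<in>{w\<in>W. len w = Suc n}. inc w (frag_extend (prj w) z))) \<subseteq> LV n k"
    (is "keys (z - (\<Sum>w\<in>?F. _)) \<subseteq> _")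
proof -
  have F: "finite ?F" by (rule finite_subset[OF _ finite_len_le[of "Suc n"]]) auto
  define q where "q \<sigma> = frag_of \<sigma> - (\<Sum>w\<in>?F. inc w (prj w \<sigma>))" for \<sigma>
  have "frag_extend q z = frag_extend frag_of z - (\<Sum>w\<in>?F. frag_extend (\<lambda>\<sigma>. inc w (prj w \<sigma>)) z)"
    unfolding q_def frag_extend_diff_fun frag_extend_sum_fun[OF F] ..
  also have "\<dots> = z - (\<Sum>w\<in>?F. inc w (frag_extend (prj w) z))"
    unfolding inc_def frag_extend_frag_extend by (simp flip: frag_expansion)
  finally have eq: "z - (\<Sum>w\<in>?F. inc w (frag_extend (prj w) z)) = frag_extend q z" ..
  show ?thesis unfolding eq
  proof (rule keys_frag_extend_subset)
    fix \<sigma> assume "\<sigma> \<in> keys z"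
    then obtain w c where w: "w \<in> W" "c \<in> Ch k" "hc c \<inter> rdesc w = {}" "\<sigma> = smp w c" "len w \<le> Suc n"
      using assms unfolding LV_def by blast
    have other: "inc w' (prj w' \<sigma>) = 0" if "w' \<in> ?F" "w' \<noteq> w" for w'
    proof -
      have "prj w' (smp w c) = 0" by (rule prj_smp_other[OF _ w(1,2)]) (use that w in auto)
      then show ?thesis by (simp add: w(4) inc_def)
    qed
    show "keys (q \<sigma>) \<subseteq> LV n k"
    proof (cases "len w = Suc n")
      case True
      then have "(\<Sum>w\<in>?F. inc w (prj w \<sigma>)) = inc w (prj w \<sigma>)"
        using F w(1) other by (subst sum.remove[of _ w]) (auto intro!: sum.neutral)
      also have "\<dots> = frag_of \<sigma>" unfolding w(4) prj_smp_self using w(3) by (simp add: inc_def)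
      finally show ?thesis by (simp add: q_def)
    next
      case False
      then have "(\<Sum>w\<in>?F. inc w (prj w \<sigma>)) = 0" using other by (intro sum.neutral) auto
      moreover have "len w \<le> n" using w(5) False by simp
      then have "\<sigma> \<in> LV n k" unfolding LV_def using w(1-4) by blast
      ultimately show ?thesis by (simp add: q_def)
    qed
  qed
qed

text \<open>Chambers are added in order of length. A chamber of length n + 1 meets the shorter ones
  in the mirrors of its descents, and two chambers of that length meet only in shorter ones. The
  part of a cycle in each top chamber is thus a relative cycle, which
  \<open>relative_acyclic\<close> pushes into level \<open>n\<close>.\<close>

theorem Davis_acyclic:
  assumes "keys z \<subseteq> LV n k" "BD z = 0"
  shows "\<exists>y. keys y \<subseteq> SX (Suc k) \<and> BD y = z"
  using assms
proof (induction n arbitrary: z)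
  case 0
  define x where "x = frag_extend (\<lambda>\<sigma>. frag_of (snd \<sigma>)) z"
  have lv: "\<exists>c. c \<in> Ch k \<and> \<sigma> = smp e c" if "\<sigma> \<in> keys z" for \<sigma>
    using that 0(1) len_0_iff unfolding LV_def by blast
  have kx: "keys x \<subseteq> CA {} k" unfolding x_def
  proof (rule keys_frag_extend_subset)
    fix \<sigma> assume "\<sigma> \<in> keys z"
    from lv[OF this] obtain c where "c \<in> Ch k" "\<sigma> = smp e c" by blast
    then show "keys (frag_of (snd \<sigma>)) \<subseteq> CA {} k" by (simp add: CA_def)
  qed
  then have kx': "keys x \<subseteq> Ch k" by (auto simp: CA_def)
  have zx: "inc e x = z" unfolding x_def inc_def frag_extend_frag_extend
  proof (rule frag_extend_cong_id)
    fix \<sigma> assume "\<sigma> \<in> keys z"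
    from lv[OF this] obtain c where "c \<in> Ch k" "\<sigma> = smp e c" by blast
    then show "frag_extend (\<lambda>c. frag_of (smp e c)) (frag_of (snd \<sigma>)) = frag_of \<sigma>" by simp
  qed
  have inj: "frag_extend (\<lambda>\<sigma>. frag_of (snd \<sigma>)) (inc e y) = y" for y
    unfolding inc_def frag_extend_frag_extend by (intro frag_extend_cong_id) simp
  have "inc e (BDL x) = 0" using BD_inc[OF e_in_W kx'] zx 0(2) by simp
  then have "BDL x = 0" using inj[of "BDL x"] by simp
  then obtain y where y: "keys y \<subseteq> CA {} (Suc k)" "BDL y = x"
    using acyclic_CA[OF kx _ spherical_empty] by blast
  then have ky: "keys y \<subseteq> Ch (Suc k)" by (auto simp: CA_def)
  have "BD (inc e y) = z" using BD_inc[OF e_in_W ky] y zx by simp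
  then show ?case using inc_keys[OF e_in_W ky] by blast
next
  case (Suc n)
  let ?F = "{w \<in> W. len w = Suc n}"
  have F: "finite ?F" by (rule finite_subset[OF _ finite_len_le[of "Suc n"]]) auto
  define x where "x w = frag_extend (prj w) z" for w
  define z0 where "z0 = z - (\<Sum>w\<in>?F. inc w (x w))"
  have kz0: "keys z0 \<subseteq> LV n k" unfolding z0_def x_def by (rule top_decompose[OF Suc.prems(1)])
  have kx: "keys (x w) \<subseteq> Ch k" for w unfolding x_def
  proof (rule keys_frag_extend_subset)
    fix \<sigma> assume "\<sigma> \<in> keys z"
    then have "snd \<sigma> \<in> Ch k" using Suc.prems(1) unfolding LV_def by force
    then show "keys (prj w \<sigma>) \<subseteq> Ch k" by (auto simp: prj_def)
  qed
  have "BD z = BD z0 + (\<Sum>w\<in>?F. inc w (BDL (x w)))"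
  proof -
    have "BD (\<Sum>w\<in>?F. inc w (x w)) = (\<Sum>w\<in>?F. inc w (BDL (x w)))"
      unfolding frag_extend_sum[OF F] using BD_inc[OF _ kx] by (intro sum.cong) auto
    moreover have "z = z0 + (\<Sum>w\<in>?F. inc w (x w))" by (simp add: z0_def)
    ultimately show ?thesis by (metis frag_extend_add)
  qed
  then have cyc: "BD z0 + (\<Sum>w\<in>?F. inc w (BDL (x w))) = 0" using Suc.prems by simp
  have y_ex: "\<exists>y. keys y \<subseteq> Ch (Suc k) \<and> keys (x w - BDL y) \<subseteq> QA {} (rdesc w) k" if w: "w \<in> ?F" for w
  proof -
    have wW: "w \<in> W" "w \<noteq> e" using w by auto
    have kB: "keys (BDL (x w')) \<subseteq> Ch (k - 1)" for w' using BDL_keys[OF kx] .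
    \<comment> \<open>Projecting the equation \<open>cyc\<close> to the chamber \<open>w\<close>
      leaves only the part of the boundary of \<open>x w\<close> outside the mirrors, which must
      then vanish.\<close>
    have 0: "frag_extend (prj w) (BD z0) = 0"
    proof (rule frag_extend_eq_0)
      fix \<sigma> assume "\<sigma> \<in> keys (BD z0)"
      then have "\<sigma> \<in> LV n (k - 1)" using keys_BD_LV[OF kz0] by blast
      then obtain v c where v: "v \<in> W" "c \<in> Ch (k - 1)" "\<sigma> = smp v c" "len v \<le> n" unfolding LV_def by blast
      show "prj w \<sigma> = 0" unfolding v(3) by (rule prj_smp_other[OF wW(1) v(1,2)]) (use v w in auto)
    qed
    have 1: "frag_extend (prj w) (inc w' (BDL (x w'))) = 0" if "w' \<in> ?F" "w' \<noteq> w" for w'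
      unfolding inc_def
    proof (subst frag_extend_frag_extend, rule frag_extend_eq_0)
      fix c assume "c \<in> keys (BDL (x w'))"
      then have cC: "c \<in> Ch (k - 1)" using kB by blast
      have "prj w (smp w' c) = 0" by (rule prj_smp_other[OF wW(1) _ cC]) (use that w in auto)
      then show "frag_extend (prj w) (frag_of (smp w' c)) = 0" by simp
    qed
    have 2: "frag_extend (prj w) (inc w (BDL (x w))) = restr (\<lambda>c. hc c \<inter> rdesc w = {}) (BDL (x w))"
      unfolding inc_def restr_def by (subst frag_extend_frag_extend) (simp add: prj_smp_self)
    have "frag_extend (prj w) (BD z0 + (\<Sum>w\<in>?F. inc w (BDL (x w)))) =
        frag_extend (prj w) (\<Sum>w\<in>?F. inc w (BDL (x w)))"
      by (simp add: frag_extend_add 0)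
    also have "\<dots> = (\<Sum>w'\<in>?F. frag_extend (prj w) (inc w' (BDL (x w'))))"
      unfolding frag_extend_sum[OF F] by (simp add: o_def)
    also have "\<dots> = frag_extend (prj w) (inc w (BDL (x w)))"
      using F w 1 by (subst sum.remove[of _ w]) (auto intro!: sum.neutral)
    finally have "restr (\<lambda>c. hc c \<inter> rdesc w = {}) (BDL (x w)) = 0"
      unfolding cyc 2 by simp
    then have "BDL (x w) = restr (\<lambda>c. \<not> hc c \<inter> rdesc w = {}) (BDL (x w))"
      using restr_split[of "BDL (x w)" "\<lambda>c. hc c \<inter> rdesc w = {}"] by simp
    then have "keys (BDL (x w)) \<subseteq> {c \<in> keys (BDL (x w)). hc c \<inter> rdesc w \<noteq> {}}"
      using keys_restr[of "\<lambda>c. \<not> hc c \<inter> rdesc w = {}" "BDL (x w)"] by simp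
    then have "keys (BDL (x w)) \<subseteq> QA {} (rdesc w) (k - 1)"
    proof (rule order_trans, intro subsetI)
      fix c assume "c \<in> {c \<in> keys (BDL (x w)). hc c \<inter> rdesc w \<noteq> {}}"
      then have c: "c \<in> Ch (k - 1)" "hc c \<inter> rdesc w \<noteq> {}" using kB by auto
      have "T \<inter> rdesc w \<noteq> {}" if "T \<in> set c" for T
      proof -
        have "c \<noteq> []" using that by auto
        then have "hc c \<subseteq> T" using sorted_hd_subset[OF _ that] c(1) by (simp add: hc_def Ch_def)
        then show ?thesis using c(2) by blast
      qed
      then show "c \<in> QA {} (rdesc w) (k - 1)" using c(1) by (simp add: QA_def)
    qed
    note kq = this
    have ne: "rdesc w \<noteq> {}"
    proof -
      obtain s where "s \<in> S" "Suc (len (w \<odot> g s)) = len w" by (rule ex_right_descent[OF wW])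
      then show ?thesis by (auto simp: rdesc_def)
    qed
    show ?thesis by (rule relative_acyclic[OF ne spherical_rdesc[OF wW(1)] kx kq])
  qed
  define y where "y w = (SOME y. keys y \<subseteq> Ch (Suc k) \<and> keys (x w - BDL y) \<subseteq> QA {} (rdesc w) k)" for w
  have y: "keys (y w) \<subseteq> Ch (Suc k)" "keys (x w - BDL (y w)) \<subseteq> QA {} (rdesc w) k" if "w \<in> ?F" for w
    using someI_ex[OF y_ex[OF that]] unfolding y_def by blast+
  define Y where "Y = (\<Sum>w\<in>?F. inc w (y w))"
  have kY: "keys Y \<subseteq> SX (Suc k)" unfolding Y_def
  proof (rule keys_sum_subset)
    fix w assume "w \<in> ?F"
    then show "keys (inc w (y w)) \<subseteq> SX (Suc k)" using inc_keys[OF _ y(1)] by blast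
  qed
  have BY: "BD Y = (\<Sum>w\<in>?F. inc w (BDL (y w)))"
    unfolding Y_def frag_extend_sum[OF F] using BD_inc[OF _ y(1)] by (intro sum.cong) auto
  have "z - BD Y = z0 + (\<Sum>w\<in>?F. inc w (x w - BDL (y w)))"
    unfolding BY z0_def by (simp add: inc_def frag_extend_diff sum_subtractf)
  moreover have "keys (z0 + (\<Sum>w\<in>?F. inc w (x w - BDL (y w)))) \<subseteq> LV n k"
  proof (intro keys_add_subset keys_sum_subset kz0)
    fix w assume w: "w \<in> ?F"
    show "keys (inc w (x w - BDL (y w))) \<subseteq> LV n k" unfolding inc_def
    proof (rule keys_frag_extend_subset)
      fix c assume "c \<in> keys (x w - BDL (y w))"
      then have c: "c \<in> Ch k" "\<forall>T\<in>set c. T \<inter> rdesc w \<noteq> {}" using y(2)[OF w] by (auto simp: QA_def)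
      have wW: "w \<in> W" "w \<noteq> e" using w by auto
      obtain s where "s \<in> S" "Suc (len (w \<odot> g s)) = len w" by (rule ex_right_descent[OF wW])
      then have "S \<inter> rdesc w \<noteq> {}" by (auto simp: rdesc_def)
      then have "hc c \<inter> rdesc w \<noteq> {}" using c(2) by (cases c) (auto simp: hc_def)
      then have "smp w c \<in> LV n k" using smp_in_LV_less[OF wW(1) c(1)] w by simp
      then show "keys (frag_of (smp w c)) \<subseteq> LV n k" by simp
    qed
  qed
  ultimately have kz': "keys (z - BD Y) \<subseteq> LV n k" by simp
  have "BD (z - BD Y) = 0" using Suc.prems(2) BD_BD[OF kY] by (simp add: frag_extend_diff)
  from Suc.IH[OF kz' this] obtain y' where y': "keys y' \<subseteq> SX (Suc k)" "BD y' = z - BD Y" by blast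
  have "BD (y' + Y) = z" using y' by (simp add: frag_extend_add)
  then show ?case using keys_add_subset[OF y'(1) kY] by blast
qed

lemma Davis_fill:
  assumes "keys z \<subseteq> SX k" "BD z = 0"
  shows "\<exists>y. keys y \<subseteq> SX (Suc k) \<and> BD y = z"
proof -
  have "\<exists>n. keys z \<subseteq> LV n k"
  proof -
    define f where "f \<sigma> = (SOME n. \<sigma> \<in> LV n k)" for \<sigma>
    have f: "\<sigma> \<in> LV (f \<sigma>) k" if "\<sigma> \<in> SX k" for \<sigma>
      unfolding f_def by (rule someI_ex[OF SX_LV[OF that]])
    have "\<sigma> \<in> LV (Max (f ` keys z)) k" if "\<sigma> \<in> keys z" for \<sigma>
    proof -
      have "f \<sigma> \<le> Max (f ` keys z)" using that by (intro Max_ge) auto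
      then show ?thesis using f[of \<sigma>] LV_mono that assms(1) by blast
    qed
    then show ?thesis by blast
  qed
  then show ?thesis using Davis_acyclic assms(2) by blast
qed

section \<open>Homotopies along the combing\<close>

definition tr :: "'s list set \<Rightarrow> 's dsimplex \<Rightarrow> 's dsimplex" where
  "tr x \<sigma> = ((\<lambda>y. x \<odot> y) ` fst \<sigma>, snd \<sigma>)"

definition Tr :: "'s list set \<Rightarrow> ('s dsimplex \<Rightarrow>\<^sub>0 int) \<Rightarrow> ('s dsimplex \<Rightarrow>\<^sub>0 int)" where
  "Tr x = frag_extend (\<lambda>\<sigma>. frag_of (tr x \<sigma>))"

lemma tr_smp: assumes "x \<in> W" "w \<in> W" "c \<in> Ch k" shows "tr x (smp w c) = smp (x \<odot> w) c"
proof -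
  note T = hc_subset[OF assms(3)]
  have "x \<odot> (w \<odot> v) = x \<odot> w \<odot> v" if "v \<in> WT (hc c)" for v
    using mul_assoc[OF assms(1,2) WT_subset_W[OF T that]] by simp
  then have "(\<lambda>y. x \<odot> y) ` (\<lambda>v. w \<odot> v) ` WT (hc c) = (\<lambda>v. x \<odot> w \<odot> v) ` WT (hc c)"
    unfolding image_image by (rule image_cong[OF HOL.refl])
  then show ?thesis unfolding tr_def smp_def using cos_eq[OF assms(2) T] cos_eq[OF mul_closed[OF assms(1,2)] T]
    by simp
qed

lemma SX_cases: assumes "\<sigma> \<in> SX k" obtains w c where "w \<in> W" "c \<in> Ch k" "\<sigma> = smp w c"
  using assms unfolding SX_def by blast

lemma tr_SX: assumes "x \<in> W" "\<sigma> \<in> SX k" shows "tr x \<sigma> \<in> SX k"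
proof -
  obtain w c where w: "w \<in> W" "c \<in> Ch k" "\<sigma> = smp w c" by (rule SX_cases[OF assms(2)])
  show ?thesis unfolding w(3) tr_smp[OF assms(1) w(1,2)] by (rule smp_in_SX[OF mul_closed[OF assms(1) w(1)] w(2)])
qed

lemma tr_mul: assumes "x \<in> W" "y \<in> W" "\<sigma> \<in> SX k" shows "tr x (tr y \<sigma>) = tr (x \<odot> y) \<sigma>"
proof -
  obtain w c where w: "w \<in> W" "c \<in> Ch k" "\<sigma> = smp w c" by (rule SX_cases[OF assms(3)])
  show ?thesis unfolding w(3) tr_smp[OF assms(2) w(1,2)] tr_smp[OF assms(1) mul_closed[OF assms(2) w(1)] w(2)]
      tr_smp[OF mul_closed[OF assms(1,2)] w(1,2)] mul_assoc[OF assms(1,2) w(1)] ..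
qed

lemma tr_e: assumes "\<sigma> \<in> SX k" shows "tr e \<sigma> = \<sigma>"
proof -
  obtain w c where w: "w \<in> W" "c \<in> Ch k" "\<sigma> = smp w c" by (rule SX_cases[OF assms])
  show ?thesis unfolding w(3) tr_smp[OF e_in_W w(1,2)] using w(1) by simp
qed

lemma Tr_keys: "x \<in> W \<Longrightarrow> keys z \<subseteq> SX k \<Longrightarrow> keys (Tr x z) \<subseteq> SX k"
  unfolding Tr_def by (rule keys_frag_extend_subset) (use tr_SX in auto)

lemma Tr_mul: assumes "x \<in> W" "y \<in> W" "keys z \<subseteq> SX k" shows "Tr x (Tr y z) = Tr (x \<odot> y) z"
  unfolding Tr_def frag_extend_frag_extend
proof (rule frag_extend_eq)
  fix \<sigma> assume "\<sigma> \<in> keys z"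
  then have "\<sigma> \<in> SX k" using assms(3) by blast
  then show "frag_extend (\<lambda>\<sigma>. frag_of (tr x \<sigma>)) (frag_of (tr y \<sigma>)) = frag_of (tr (x \<odot> y) \<sigma>)"
    using tr_mul[OF assms(1,2)] by simp
qed

lemma Tr_e: assumes "keys z \<subseteq> SX k" shows "Tr e z = z"
  unfolding Tr_def
proof (rule frag_extend_cong_id)
  fix \<sigma> assume "\<sigma> \<in> keys z"
  then have "\<sigma> \<in> SX k" using assms by blast
  then show "frag_of (tr e \<sigma>) = frag_of \<sigma>" using tr_e by simp
qed

lemma Tr_inc: assumes "x \<in> W" "w \<in> W" "keys y \<subseteq> Ch k" shows "Tr x (inc w y) = inc (x \<odot> w) y"
  unfolding Tr_def inc_def frag_extend_frag_extend
proof (rule frag_extend_eq)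
  fix c assume "c \<in> keys y"
  then have "c \<in> Ch k" using assms(3) by blast
  then show "frag_extend (\<lambda>\<sigma>. frag_of (tr x \<sigma>)) (frag_of (smp w c)) = frag_of (smp (x \<odot> w) c)"
    using tr_smp[OF assms(1,2)] by simp
qed

lemma keys_bdl_subset: "c \<in> Ch k \<Longrightarrow> keys (bdl c) \<subseteq> Ch (k - 1)"
  using keys_bdl_Ch(2) by blast

lemma BD_Tr: assumes "x \<in> W" "keys z \<subseteq> SX k" shows "BD (Tr x z) = Tr x (BD z)"
  unfolding Tr_def frag_extend_frag_extend
proof (rule frag_extend_eq)
  fix \<sigma> assume "\<sigma> \<in> keys z"
  then have "\<sigma> \<in> SX k" using assms(2) by blast
  then obtain w c where w: "w \<in> W" "c \<in> Ch k" "\<sigma> = smp w c" by (rule SX_cases)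
  have "bd (tr x \<sigma>) = inc (x \<odot> w) (bdl c)"
    unfolding w(3) tr_smp[OF assms(1) w(1,2)] by (rule bd_smp[OF mul_closed[OF assms(1) w(1)] w(2)])
  also have "\<dots> = Tr x (inc w (bdl c))"
    by (rule Tr_inc[OF assms(1) w(1) keys_bdl_subset[OF w(2)], symmetric])
  also have "inc w (bdl c) = bd \<sigma>" unfolding w(3) by (rule bd_smp[OF w(1,2), symmetric])
  finally show "BD (frag_of (tr x \<sigma>)) = frag_extend (\<lambda>\<sigma>. frag_of (tr x \<sigma>)) (bd \<sigma>)"
    by (simp add: Tr_def)
qed

text \<open>A fixed choice that depends on the chain alone, so finitely many chains have finitely
  many fillings. That zero is filled by zero is used in \<open>phi_0\<close>.\<close>

definition Fill :: "nat \<Rightarrow> ('s dsimplex \<Rightarrow>\<^sub>0 int) \<Rightarrow> ('s dsimplex \<Rightarrow>\<^sub>0 int)" where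
  "Fill k z = (if z = 0 then 0 else (SOME y. keys y \<subseteq> SX (Suc k) \<and> BD y = z))"

lemma Fill: assumes "keys z \<subseteq> SX k" "BD z = 0"
  shows "keys (Fill k z) \<subseteq> SX (Suc k)" "BD (Fill k z) = z"
proof -
  have "keys (Fill k z) \<subseteq> SX (Suc k) \<and> BD (Fill k z) = z"
  proof (cases "z = 0")
    case False
    then show ?thesis unfolding Fill_def using someI_ex[OF Davis_fill[OF assms]] by simp
  qed (simp add: Fill_def)
  then show "keys (Fill k z) \<subseteq> SX (Suc k)" "BD (Fill k z) = z" by blast+
qed

text \<open>The shortest element whose chamber contains the simplex; \<open>smp_min_unique\<close>
  makes the choice unique.\<close>

definition base :: "'s dsimplex \<Rightarrow> 's list set" where
  "base \<sigma> = (SOME y. y \<in> W \<and> \<sigma> = smp y (snd \<sigma>) \<and> hc (snd \<sigma>) \<inter> rdesc y = {})"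

definition lev :: "'s dsimplex \<Rightarrow> nat" where
  "lev \<sigma> = len (base \<sigma>)"

lemma base: assumes "\<sigma> \<in> SX k"
  shows "base \<sigma> \<in> W" "\<sigma> = smp (base \<sigma>) (snd \<sigma>)" "hc (snd \<sigma>) \<inter> rdesc (base \<sigma>) = {}" "snd \<sigma> \<in> Ch k"
proof -
  obtain w c where w: "w \<in> W" "c \<in> Ch k" "\<sigma> = smp w c" by (rule SX_cases[OF assms])
  obtain y where y: "y \<in> W" "y \<in> cos w (hc c)" "hc c \<inter> rdesc y = {}" "smp w c = smp y c"
    by (rule smp_min_rep[OF w(1,2)])
  have "y \<in> W \<and> \<sigma> = smp y (snd \<sigma>) \<and> hc (snd \<sigma>) \<inter> rdesc y = {}" using y w by simp
  from someI[of "\<lambda>y. y \<in> W \<and> \<sigma> = smp y (snd \<sigma>) \<and> hc (snd \<sigma>) \<inter> rdesc y = {}", OF this]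
  show "base \<sigma> \<in> W" "\<sigma> = smp (base \<sigma>) (snd \<sigma>)" "hc (snd \<sigma>) \<inter> rdesc (base \<sigma>) = {}"
    unfolding base_def by blast+
  show "snd \<sigma> \<in> Ch k" using w by simp
qed

lemma face_base: assumes "\<sigma> \<in> SX (Suc k)" "\<tau> \<in> keys (bd \<sigma>)"
  shows "\<tau> \<in> SX k" "lev \<tau> \<le> lev \<sigma>" "iv (base \<sigma>) \<odot> base \<tau> \<in> WT (hc (snd \<tau>))"
proof -
  note b = base[OF assms(1)]
  show t: "\<tau> \<in> SX k" using keys_bd[OF assms(1)] assms(2) by auto
  note bt = base[OF t]
  have "bd \<sigma> = inc (base \<sigma>) (bdl (snd \<sigma>))"
    using bd_smp[OF b(1,4)] b(2) by simp
  then have "\<tau> \<in> keys (inc (base \<sigma>) (bdl (snd \<sigma>)))" using assms(2) by simp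
  then obtain c' where c': "\<tau> = smp (base \<sigma>) c'"
    unfolding inc_def using keys_frag_extend[of "\<lambda>c. frag_of (smp (base \<sigma>) c)"] by fastforce
  then have sc: "snd \<tau> = c'" by simp
  have eq: "smp (base \<sigma>) (snd \<tau>) = smp (base \<tau>) (snd \<tau>)" using c' sc bt(2) by simp
  show "lev \<tau> \<le> lev \<sigma>" unfolding lev_def by (rule smp_min_unique(2)[OF bt(1,4,3) b(1) eq])
  note T = hc_subset[OF bt(4)]
  have "base \<tau> \<in> cos (base \<sigma>) (hc (snd \<tau>))"
    using cos_self[OF bt(1) T] eq by (simp add: smp_def)
  then show "iv (base \<sigma>) \<odot> base \<tau> \<in> WT (hc (snd \<tau>))" using cos_iff[OF b(1) T] by blast
qed

definition cb :: "nat \<Rightarrow> 's dsimplex \<Rightarrow> 's list set" where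
  "cb n \<sigma> = comb n (base \<sigma>)"

lemma cb_in_W: "\<sigma> \<in> SX k \<Longrightarrow> cb n \<sigma> \<in> W"
  unfolding cb_def using base(1) by simp

text \<open>\<open>phi k n\<close> pushes a simplex at \<open>w\<close> to the prefix of length \<open>n\<close> of the normal form of \<open>w\<close>, and
  \<open>psi k n\<close> is a homotopy from \<open>phi k n\<close> to \<open>phi k (Suc n)\<close>.  Choosing the fillings after
  translation back to the identity leaves only finitely many choices.\<close>

primrec phi :: "nat \<Rightarrow> nat \<Rightarrow> 's dsimplex \<Rightarrow> ('s dsimplex \<Rightarrow>\<^sub>0 int)" where
  "phi 0 n \<sigma> = frag_of \<sigma>"
| "phi (Suc k) n \<sigma> = (if lev \<sigma> < n then frag_of \<sigma> else
     Tr (cb n \<sigma>) (Fill k (Tr (iv (cb n \<sigma>)) (frag_extend (phi k n) (bd \<sigma>)))))"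

declare phi.simps(2) [simp del]

lemma phi_id: "lev \<sigma> < n \<Longrightarrow> phi k n \<sigma> = frag_of \<sigma>"
  by (cases k) (simp_all add: phi.simps(2))

lemma bd_SX0: assumes "\<sigma> \<in> SX 0" shows "bd \<sigma> = 0"
proof -
  have "snd \<sigma> = []" using base(4)[OF assms] by (simp add: Ch_def)
  then show ?thesis by (simp add: bd_def)
qed

lemma phi_face_sum_id: assumes "\<sigma> \<in> SX (Suc k)" "lev \<sigma> < n" shows "frag_extend (phi k n) (bd \<sigma>) = bd \<sigma>"
proof (rule frag_extend_cong_id)
  fix \<tau> assume "\<tau> \<in> keys (bd \<sigma>)"
  from face_base(2)[OF assms(1) this] have "lev \<tau> < n" using assms(2) by simp
  then show "phi k n \<tau> = frag_of \<tau>" by (rule phi_id)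
qed

lemma Tr_Tr_iv: assumes "u \<in> W" "keys z \<subseteq> SX k" shows "Tr u (Tr (iv u) z) = z" "Tr (iv u) (Tr u z) = z"
  using Tr_mul[OF assms(1) iv_closed[OF assms(1)] assms(2)] Tr_mul[OF iv_closed[OF assms(1)] assms] Tr_e[OF assms(2)] assms(1)
  by simp_all

text \<open>The map is an augmented chain map: being one in lower dimension makes the image of the
  boundary a cycle, which is what \<open>Fill\<close> requires.\<close>

lemma phi_keys_BD:
  "\<sigma> \<in> SX k \<Longrightarrow> keys (phi k n \<sigma>) \<subseteq> SX k \<and> BD (phi k n \<sigma>) = (case k of 0 \<Rightarrow> 0 | Suc k' \<Rightarrow> frag_extend (phi k' n) (bd \<sigma>))"
proof (induction k arbitrary: \<sigma>)
  case 0
  then show ?case using bd_SX0 by simp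
next
  case (Suc k)
  let ?z = "frag_extend (phi k n) (bd \<sigma>)"
  note fb = face_base(1)[OF Suc.prems]
  show ?case
  proof (cases "lev \<sigma> < n")
    case True
    then show ?thesis using Suc.prems phi_face_sum_id[OF Suc.prems True] by (simp add: phi_id)
  next
    case False
    have kz: "keys ?z \<subseteq> SX k"
      by (rule keys_frag_extend_subset) (use Suc.IH fb in blast)
    have "BD ?z = 0"
    proof (cases k)
      case 0
      show ?thesis unfolding frag_extend_frag_extend
      proof (rule frag_extend_eq_0)
        fix \<tau> assume "\<tau> \<in> keys (bd \<sigma>)"
        then show "BD (phi k n \<tau>) = 0" using Suc.IH[OF fb] 0 by simp
      qed
    next
      case (Suc k')
      have "BD ?z = frag_extend (\<lambda>\<tau>. frag_extend (phi k' n) (bd \<tau>)) (bd \<sigma>)"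
        unfolding frag_extend_frag_extend
      proof (rule frag_extend_eq)
        fix \<tau> assume "\<tau> \<in> keys (bd \<sigma>)"
        then show "BD (phi k n \<tau>) = frag_extend (phi k' n) (bd \<tau>)" using Suc.IH[OF fb] Suc by simp
      qed
      also have "\<dots> = frag_extend (phi k' n) (BD (bd \<sigma>))" by (simp add: frag_extend_frag_extend)
      finally show ?thesis using BD_bd[OF Suc.prems] by simp
    qed
    note u = cb_in_W[OF Suc.prems, of n]
    let ?y = "Tr (iv (cb n \<sigma>)) ?z"
    have ky: "keys ?y \<subseteq> SX k" by (rule Tr_keys[OF iv_closed[OF u] kz])
    have "BD ?y = Tr (iv (cb n \<sigma>)) (BD ?z)" by (rule BD_Tr[OF iv_closed[OF u] kz])
    also have "\<dots> = 0" using \<open>BD ?z = 0\<close> by (simp add: Tr_def)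
    finally have By: "BD ?y = 0" .
    note F = Fill[OF ky By]
    have p: "phi (Suc k) n \<sigma> = Tr (cb n \<sigma>) (Fill k ?y)" using False by (simp add: phi.simps(2))
    have "BD (phi (Suc k) n \<sigma>) = Tr (cb n \<sigma>) ?y" unfolding p BD_Tr[OF u F(1)] F(2) ..
    also have "\<dots> = ?z" by (rule Tr_Tr_iv(1)[OF u kz])
    finally show ?thesis using Tr_keys[OF u F(1)] by (simp add: p)
  qed
qed

lemma phi_keys: "\<sigma> \<in> SX k \<Longrightarrow> keys (phi k n \<sigma>) \<subseteq> SX k"
  using phi_keys_BD by blast

lemma BD_phi: "\<sigma> \<in> SX (Suc k) \<Longrightarrow> BD (phi (Suc k) n \<sigma>) = frag_extend (phi k n) (bd \<sigma>)"
  using phi_keys_BD[of \<sigma> "Suc k" n] by simp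

primrec psi :: "nat \<Rightarrow> nat \<Rightarrow> 's dsimplex \<Rightarrow> ('s dsimplex \<Rightarrow>\<^sub>0 int)" where
  "psi 0 n \<sigma> = 0"
| "psi (Suc k) n \<sigma> = (if lev \<sigma> < n then 0 else
     Tr (cb n \<sigma>) (Fill (Suc k) (Tr (iv (cb n \<sigma>))
       (phi (Suc k) (Suc n) \<sigma> - phi (Suc k) n \<sigma> - frag_extend (psi k n) (bd \<sigma>)))))"

declare psi.simps(2) [simp del]

lemma psi_0: "lev \<sigma> < n \<Longrightarrow> psi k n \<sigma> = 0"
  by (cases k) (simp_all add: psi.simps(2))

text \<open>The chain homotopy identity between times n and n + 1. As usual for acyclic targets, the
  chain to be filled is a cycle by the identity one dimension lower.\<close>

lemma psi_keys_BD:
  "\<sigma> \<in> SX k \<Longrightarrow> keys (psi k n \<sigma>) \<subseteq> SX (Suc k) \<and>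
    BD (psi k n \<sigma>) = phi k (Suc n) \<sigma> - phi k n \<sigma> - (case k of 0 \<Rightarrow> 0 | Suc k' \<Rightarrow> frag_extend (psi k' n) (bd \<sigma>))"
proof (induction k arbitrary: \<sigma>)
  case 0
  then show ?case by simp
next
  case (Suc k)
  let ?z = "phi (Suc k) (Suc n) \<sigma> - phi (Suc k) n \<sigma> - frag_extend (psi k n) (bd \<sigma>)"
  note fb = face_base(1)[OF Suc.prems]
  show ?case
  proof (cases "lev \<sigma> < n")
    case True
    have "frag_extend (psi k n) (bd \<sigma>) = 0"
    proof (rule frag_extend_eq_0)
      fix \<tau> assume "\<tau> \<in> keys (bd \<sigma>)"
      from face_base(2)[OF Suc.prems this] show "psi k n \<tau> = 0" using True by (intro psi_0) simp
    qed
    then show ?thesis using True by (simp add: phi_id psi_0)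
  next
    case False
    have kp: "keys (frag_extend (psi k n) (bd \<sigma>)) \<subseteq> SX (Suc k)"
      by (rule keys_frag_extend_subset) (use Suc.IH fb in blast)
    have kz: "keys ?z \<subseteq> SX (Suc k)"
      by (intro keys_diff_subset phi_keys[OF Suc.prems] kp)
    have "BD (frag_extend (psi k n) (bd \<sigma>)) = frag_extend (phi k (Suc n)) (bd \<sigma>) - frag_extend (phi k n) (bd \<sigma>)"
    proof -
      have "BD (frag_extend (psi k n) (bd \<sigma>)) = frag_extend (\<lambda>\<tau>. phi k (Suc n) \<tau> - phi k n \<tau>
          - (case k of 0 \<Rightarrow> 0 | Suc k' \<Rightarrow> frag_extend (psi k' n) (bd \<tau>))) (bd \<sigma>)"
        unfolding frag_extend_frag_extend by (rule frag_extend_eq) (use Suc.IH fb in blast)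
      also have "\<dots> = frag_extend (phi k (Suc n)) (bd \<sigma>) - frag_extend (phi k n) (bd \<sigma>)
          - frag_extend (\<lambda>\<tau>. case k of 0 \<Rightarrow> 0 | Suc k' \<Rightarrow> frag_extend (psi k' n) (bd \<tau>)) (bd \<sigma>)"
        unfolding frag_extend_diff_fun ..
      also have "frag_extend (\<lambda>\<tau>. case k of 0 \<Rightarrow> 0 | Suc k' \<Rightarrow> frag_extend (psi k' n) (bd \<tau>)) (bd \<sigma>) = 0"
      proof (cases k)
        case 0 then show ?thesis by (simp add: frag_extend_eq_0)
      next
        case (Suc k')
        have "frag_extend (\<lambda>\<tau>. frag_extend (psi k' n) (bd \<tau>)) (bd \<sigma>) = frag_extend (psi k' n) (BD (bd \<sigma>))"
          by (simp add: frag_extend_frag_extend)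
        then show ?thesis using BD_bd[OF Suc.prems] Suc by simp
      qed
      finally show ?thesis by simp
    qed
    then have Bz: "BD ?z = 0" by (simp add: frag_extend_diff BD_phi[OF Suc.prems])
    note u = cb_in_W[OF Suc.prems, of n]
    let ?y = "Tr (iv (cb n \<sigma>)) ?z"
    have ky: "keys ?y \<subseteq> SX (Suc k)" by (rule Tr_keys[OF iv_closed[OF u] kz])
    have "BD ?y = Tr (iv (cb n \<sigma>)) (BD ?z)" by (rule BD_Tr[OF iv_closed[OF u] kz])
    also have "\<dots> = 0" unfolding Bz by (simp add: Tr_def)
    finally have By: "BD ?y = 0" .
    note F = Fill[OF ky By]
    have p: "psi (Suc k) n \<sigma> = Tr (cb n \<sigma>) (Fill (Suc k) ?y)" using False by (simp add: psi.simps(2))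
    have "BD (psi (Suc k) n \<sigma>) = Tr (cb n \<sigma>) ?y" unfolding p BD_Tr[OF u F(1)] F(2) ..
    also have "\<dots> = ?z" by (rule Tr_Tr_iv(1)[OF u kz])
    finally show ?thesis using Tr_keys[OF u F(1)] by (simp add: p)
  qed
qed

text \<open>At time 0 every prefix is the identity, so all vertices have the same image and the two
  ends of an edge cancel; from there on zero is filled by zero.\<close>

lemma phi_0: assumes "\<sigma> \<in> SX (Suc (Suc k))" shows "phi (Suc (Suc k)) 0 \<sigma> = 0"
  using assms
proof (induction k arbitrary: \<sigma>)
  case 0
  obtain w c where w: "w \<in> W" "c \<in> Ch (Suc (Suc 0))" "\<sigma> = smp w c" by (rule SX_cases[OF 0])
  obtain T1 T2 where c: "c = [T1, T2]" using w(2) by (auto simp: Ch_def length_Suc_conv)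
  have v: "phi (Suc 0) 0 (smp w [T]) = Tr e (Fill 0 (Tr (iv e) (frag_of (smp e []))))" if "[T] \<in> Ch (Suc 0)" for T
  proof -
    have "smp w [] = smp e []"
      by (rule smp_eqI[OF e_in_W, of "[]" 0]) (use w(1) in \<open>auto simp: Ch_def hc_def cos_iff WT_S\<close>)
    moreover have "bd (smp w [T]) = frag_of (smp w [])"
      using bd_smp[OF w(1) that] by (simp add: inc_def pre_def)
    moreover have "cb 0 (smp w [T]) = e" by (simp add: cb_def)
    ultimately show ?thesis by (simp add: phi.simps(2))
  qed
  have T: "[T1] \<in> Ch (Suc 0)" "[T2] \<in> Ch (Suc 0)" using w(2) unfolding c by (auto simp: Ch_def)
  have "bd \<sigma> = frag_of (smp w [T2]) - frag_of (smp w [T1])"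
    unfolding w(3) bd_smp[OF w(1,2)] by (simp add: c inc_def pre_def frag_extend_diff)
  then have "frag_extend (phi (Suc 0) 0) (bd \<sigma>) = 0" by (simp add: frag_extend_diff v[OF T(1)] v[OF T(2)])
  then show ?case by (simp add: phi.simps(2)[of "Suc 0"] Fill_def Tr_def)
next
  case (Suc k)
  have "frag_extend (phi (Suc (Suc k)) 0) (bd \<sigma>) = 0"
    by (rule frag_extend_eq_0) (use Suc.IH face_base(1)[OF Suc.prems] in blast)
  then show ?case by (simp add: phi.simps(2)[of "Suc (Suc k)"] Fill_def Tr_def)
qed

section \<open>Finitely many homotopies up to translation\<close>

lemma spherical_bound: "\<exists>D. \<forall>T x. spherical S M T \<longrightarrow> x \<in> WT T \<longrightarrow> len x \<le> D"
proof -
  let ?X = "\<Union>T\<in>{T. spherical S M T}. WT T"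
  have "finite {T. spherical S M T}"
    by (rule finite_subset[of _ "Pow S"]) (use finite_S spherical_subset in auto)
  then have f: "finite ?X" by (rule finite_UN_I) (simp add: spherical_def)
  have "\<forall>T x. spherical S M T \<longrightarrow> x \<in> WT T \<longrightarrow> len x \<le> Max (len ` ?X)"
    using f by (auto intro!: Max_ge)
  then show ?thesis ..
qed

lemma hc_spherical: "c \<in> Ch (Suc k) \<Longrightarrow> spherical S M (hc c)"
  by (cases c) (auto simp: Ch_def hc_def)

lemma smp_base: assumes "w \<in> W" "c \<in> Ch k" shows "iv w \<odot> base (smp w c) \<in> WT (hc c)"
proof -
  note b = base[OF smp_in_SX[OF assms], unfolded snd_smp]
  note T = hc_subset[OF assms(2)]
  have "base (smp w c) \<in> cos w (hc c)"
    using cos_self[OF b(1) T] b(2) by (simp add: smp_def)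
  then show ?thesis using cos_iff[OF assms(1) T] by blast
qed

definition nrm :: "nat \<Rightarrow> (nat \<Rightarrow> 's dsimplex \<Rightarrow> 's dsimplex \<Rightarrow>\<^sub>0 int) \<Rightarrow> 's dsimplex \<Rightarrow> 's dsimplex \<Rightarrow>\<^sub>0 int" where
  "nrm n P \<sigma> = Tr (iv (cb n \<sigma>)) (P n \<sigma>)"

lemma Tr_change: assumes "u \<in> W" "v \<in> W" "keys z \<subseteq> SX m" shows "Tr (iv u) z = Tr (iv u \<odot> v) (Tr (iv v) z)"
proof -
  have "iv u \<odot> v \<odot> iv v = iv u"
    using mul_assoc[OF iv_closed[OF assms(1)] assms(2) iv_closed[OF assms(2)]] mul_iv[OF assms(2)]
      mul_e[OF iv_closed[OF assms(1)]] by simp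
  then show ?thesis
    using Tr_mul[OF mul_closed[OF iv_closed[OF assms(1)] assms(2)] iv_closed[OF assms(2)] assms(3)] by simp
qed

lemma finite_translates: assumes "finite F" shows "finite (\<Union>h\<in>{h \<in> W. len h \<le> r}. Tr h ` F)"
  by (rule finite_UN_I[OF finite_len_le]) (use assms in simp)

text \<open>A face of the simplex at \<open>w\<close> sits at w h with \<open>h\<close> in a finite
  special subgroup, so its prefix lies in a fixed ball around that of \<open>w\<close>, and its
  normalised value is only changed by one of finitely many translations. The face needs a vertex
  (\<open>k = Suc k'\<close>), as the empty simplex has stabiliser \<open>W\<close>.\<close>

lemma face_sum_finite:
  assumes F: "finite F" and k: "k = Suc k'"
    and P: "\<And>n \<sigma>. \<sigma> \<in> SX k \<Longrightarrow> keys (P n \<sigma>) \<subseteq> SX m" "\<And>n \<sigma>. \<sigma> \<in> SX k \<Longrightarrow> nrm n P \<sigma> \<in> F"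
  shows "\<exists>G. finite G \<and> (\<forall>n. \<forall>\<sigma>\<in>SX (Suc k). Tr (iv (cb n \<sigma>)) (frag_extend (P n) (bd \<sigma>)) \<in> G)"
proof -
  obtain R where R: "\<And>w h n. w \<in> W \<Longrightarrow> h \<in> W \<Longrightarrow> len (iv (comb n w) \<odot> comb n (w \<odot> h)) \<le> R * len h"
    using comb_fellow_traveller by blast
  obtain D where D: "\<And>T x. spherical S M T \<Longrightarrow> x \<in> WT T \<Longrightarrow> len x \<le> D"
    using spherical_bound by blast
  let ?K = "\<Union>h\<in>{h \<in> W. len h \<le> R * D}. Tr h ` F"
  let ?G = "\<Union>c\<in>Ch (Suc k). (\<lambda>p. frag_extend p (bdl c)) ` (PiE (Ch k) (\<lambda>_. ?K))"
  have "finite (PiE (Ch k) (\<lambda>_. ?K))" by (rule finite_PiE[OF finite_Ch finite_translates[OF F]])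
  then have fin: "finite ?G" by (rule finite_UN_I[OF finite_Ch finite_imageI])
  have "Tr (iv (cb n \<sigma>)) (frag_extend (P n) (bd \<sigma>)) \<in> ?G" if s: "\<sigma> \<in> SX (Suc k)" for n \<sigma>
  proof -
    note b = base[OF s]
    let ?w = "base \<sigma>" and ?c = "snd \<sigma>"
    have u: "cb n \<sigma> \<in> W" by (rule cb_in_W[OF s])
    let ?p = "\<lambda>c. Tr (iv (cb n \<sigma>)) (P n (smp ?w c))"
    have p: "?p c \<in> ?K" if c: "c \<in> Ch k" for c
    proof -
      let ?t = "smp ?w c"
      have t: "?t \<in> SX k" by (rule smp_in_SX[OF b(1) c])
      have v: "cb n ?t \<in> W" by (rule cb_in_W[OF t])
      let ?h = "iv ?w \<odot> base ?t"
      have h: "?h \<in> WT (hc c)" by (rule smp_base[OF b(1) c])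
      have hW: "?h \<in> W" by (rule WT_subset_W[OF hc_subset[OF c] h])
      have "?w \<odot> ?h = base ?t" by (rule mul_iv_cancel[OF b(1) base(1)[OF t]])
      then have "len (iv (cb n \<sigma>) \<odot> cb n ?t) \<le> R * len ?h"
        using R[OF b(1) hW, of n] by (simp add: cb_def)
      also have "\<dots> \<le> R * D" using D[OF hc_spherical h] c k by simp
      finally have l: "len (iv (cb n \<sigma>) \<odot> cb n ?t) \<le> R * D" .
      have "?p c = Tr (iv (cb n \<sigma>) \<odot> cb n ?t) (nrm n P ?t)"
        unfolding nrm_def by (rule Tr_change[OF u v P(1)[OF t]])
      then show ?thesis using P(2)[OF t] l mul_closed[OF iv_closed[OF u] v] by blast
    qed
    have "bd \<sigma> = inc ?w (bdl ?c)" using bd_smp[OF b(1,4)] b(2) by simp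
    then have "Tr (iv (cb n \<sigma>)) (frag_extend (P n) (bd \<sigma>)) = frag_extend ?p (bdl ?c)"
      by (simp add: inc_def frag_extend_frag_extend Tr_def)
    \<comment> \<open>Restricted to the finite set of chains, the function belongs to a finite
      product.\<close>
    also have "\<dots> = frag_extend (restrict ?p (Ch k)) (bdl ?c)"
      by (rule frag_extend_eq) (use keys_bdl_subset[OF b(4)] in auto)
    finally have eq: "Tr (iv (cb n \<sigma>)) (frag_extend (P n) (bd \<sigma>)) = frag_extend (restrict ?p (Ch k)) (bdl ?c)" .
    have r: "restrict ?p (Ch k) \<in> PiE (Ch k) (\<lambda>_. ?K)" unfolding restrict_PiE_iff using p by blast
    show ?thesis unfolding eq by (rule UN_I[OF b(4)]) (rule imageI[OF r])
  qed
  then show ?thesis using fin by blast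
qed

lemma smp_Nil: assumes "w \<in> W" shows "smp w [] = smp e []"
  by (rule smp_eqI[OF e_in_W, of "[]" 0]) (use assms in \<open>auto simp: Ch_def hc_def cos_iff WT_S\<close>)

lemma SX0_eq: assumes "\<sigma> \<in> SX 0" shows "\<sigma> = smp e []"
proof -
  obtain w c where w: "w \<in> W" "c \<in> Ch 0" "\<sigma> = smp w c" by (rule SX_cases[OF assms])
  then have "\<sigma> = smp w []" by (simp add: Ch_def)
  also have "\<dots> = smp e []" by (rule smp_Nil[OF w(1)])
  finally show ?thesis .
qed

lemma bd_SX1: assumes "\<sigma> \<in> SX (Suc 0)" shows "bd \<sigma> = frag_of (smp e [])"
proof -
  obtain w c where w: "w \<in> W" "c \<in> Ch (Suc 0)" "\<sigma> = smp w c" by (rule SX_cases[OF assms])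
  obtain T where c: "c = [T]" using w(2) by (auto simp: Ch_def length_Suc_conv)
  have "bd \<sigma> = frag_of (smp w [])" unfolding w(3) bd_smp[OF w(1,2)] by (simp add: c inc_def pre_def)
  also have "\<dots> = frag_of (smp e [])" by (rule arg_cong[OF smp_Nil[OF w(1)]])
  finally show ?thesis .
qed

lemma smp_Nil_SX: "smp e [] \<in> SX 0"
  by (rule smp_in_SX[OF e_in_W]) (simp add: Ch_def)

lemma Tr_smp_Nil: assumes "x \<in> W" shows "Tr x (frag_of (smp e [])) = frag_of (smp e [])"
proof -
  have "tr x (smp e []) = smp e []" by (rule SX0_eq[OF tr_SX[OF assms smp_Nil_SX]])
  then show ?thesis by (simp add: Tr_def)
qed

text \<open>Through \<open>Fill\<close> finitely many normalised boundaries give finitely many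
  values; where \<open>phi\<close> is already the identity, the normalised value is a simplex at the
  identity element.\<close>

lemma phi_finite: "\<exists>F. finite F \<and> (\<forall>n. \<forall>\<sigma>\<in>SX k. nrm n (phi k) \<sigma> \<in> F)"
proof (induction k)
  case 0
  have "nrm n (phi 0) \<sigma> \<in> {frag_of (smp e [])}" if "\<sigma> \<in> SX 0" for n \<sigma>
  proof -
    have "phi 0 n \<sigma> = frag_of (smp e [])" using SX0_eq[OF that] by simp
    then show ?thesis unfolding nrm_def using Tr_smp_Nil[OF iv_closed[OF cb_in_W[OF that]]] by (simp only: singleton_iff)
  qed
  then show ?case by blast
next
  case (Suc k)
  then obtain F where F: "finite F" "\<And>n \<sigma>. \<sigma> \<in> SX k \<Longrightarrow> nrm n (phi k) \<sigma> \<in> F" by blast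
  have "\<exists>G. finite G \<and> (\<forall>n. \<forall>\<sigma>\<in>SX (Suc k). Tr (iv (cb n \<sigma>)) (frag_extend (phi k n) (bd \<sigma>)) \<in> G)"
  proof (cases k)
    case 0
    have "Tr (iv (cb n \<sigma>)) (frag_extend (phi k n) (bd \<sigma>)) \<in> {frag_of (smp e [])}" if "\<sigma> \<in> SX (Suc k)" for n \<sigma>
    proof -
      have "frag_extend (phi k n) (bd \<sigma>) = frag_of (smp e [])"
        using bd_SX1 that 0 by simp
      then show ?thesis using Tr_smp_Nil[OF iv_closed[OF cb_in_W[OF that]]] by (simp only: singleton_iff)
    qed
    then show ?thesis by blast
  next
    case (Suc k')
    show ?thesis by (rule face_sum_finite[OF F(1) Suc phi_keys F(2)])
  qed
  then obtain G where G: "finite G"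
    "\<And>n \<sigma>. \<sigma> \<in> SX (Suc k) \<Longrightarrow> Tr (iv (cb n \<sigma>)) (frag_extend (phi k n) (bd \<sigma>)) \<in> G" by blast
  let ?H = "Fill k ` G \<union> (\<lambda>c. frag_of (smp e c)) ` Ch (Suc k)"
  have "nrm n (phi (Suc k)) \<sigma> \<in> ?H" if s: "\<sigma> \<in> SX (Suc k)" for n \<sigma>
  proof (cases "lev \<sigma> < n")
    case True
    note b = base[OF s]
    have "cb n \<sigma> = base \<sigma>" unfolding cb_def by (rule comb_full[OF b(1)]) (use True in \<open>simp add: lev_def\<close>)
    moreover have "tr (iv (base \<sigma>)) \<sigma> = smp e (snd \<sigma>)"
      using tr_smp[OF iv_closed[OF b(1)] b(1,4)] b(1,2) by simp
    ultimately have "nrm n (phi (Suc k)) \<sigma> = frag_of (smp e (snd \<sigma>))"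
      using True by (simp add: nrm_def phi_id Tr_def)
    then show ?thesis using b(4) by blast
  next
    case False
    let ?u = "cb n \<sigma>" and ?y = "Tr (iv (cb n \<sigma>)) (frag_extend (phi k n) (bd \<sigma>))"
    have u: "?u \<in> W" by (rule cb_in_W[OF s])
    have p: "phi (Suc k) n \<sigma> = Tr ?u (Fill k ?y)" using False by (simp add: phi.simps(2))
    have kz: "keys (frag_extend (phi k n) (bd \<sigma>)) \<subseteq> SX k"
      by (rule keys_frag_extend_subset) (use phi_keys face_base(1)[OF s] in blast)
    have ky: "keys ?y \<subseteq> SX k" by (rule Tr_keys[OF iv_closed[OF u] kz])
    have "BD ?y = Tr (iv ?u) (BD (BD (phi (Suc k) n \<sigma>)))"
      unfolding BD_phi[OF s] by (rule BD_Tr[OF iv_closed[OF u] kz])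
    also have "\<dots> = 0" unfolding BD_BD[OF phi_keys[OF s]] by (simp add: Tr_def)
    finally have "nrm n (phi (Suc k)) \<sigma> = Fill k ?y"
      unfolding nrm_def p by (intro Tr_Tr_iv(2)[OF u Fill(1)[OF ky]])
    then show ?thesis using G(2)[OF s] by blast
  qed
  moreover have "finite ?H" using G(1) finite_Ch by simp
  ultimately show ?case by blast
qed

lemma psi_keys: "\<sigma> \<in> SX k \<Longrightarrow> keys (psi k n \<sigma>) \<subseteq> SX (Suc k)"
  using psi_keys_BD by blast

lemma nrm_psi_Suc: assumes s: "\<sigma> \<in> SX (Suc k)"
  shows "nrm n (psi (Suc k)) \<sigma> = (if lev \<sigma> < n then 0 else Fill (Suc k) (Tr (iv (cb n \<sigma>))
       (phi (Suc k) (Suc n) \<sigma> - phi (Suc k) n \<sigma> - frag_extend (psi k n) (bd \<sigma>))))"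
proof (cases "lev \<sigma> < n")
  case True
  then show ?thesis by (simp add: nrm_def psi_0 Tr_def)
next
  case False
  let ?u = "cb n \<sigma>" and ?z = "phi (Suc k) (Suc n) \<sigma> - phi (Suc k) n \<sigma> - frag_extend (psi k n) (bd \<sigma>)"
  have u: "?u \<in> W" by (rule cb_in_W[OF s])
  have p: "psi (Suc k) n \<sigma> = Tr ?u (Fill (Suc k) (Tr (iv ?u) ?z))" using False by (simp add: psi.simps(2))
  have kp: "keys (frag_extend (psi k n) (bd \<sigma>)) \<subseteq> SX (Suc k)"
    by (rule keys_frag_extend_subset) (use psi_keys face_base(1)[OF s] in blast)
  have kz: "keys ?z \<subseteq> SX (Suc k)"
    by (intro keys_diff_subset phi_keys[OF s] kp)
  have ky: "keys (Tr (iv ?u) ?z) \<subseteq> SX (Suc k)" by (rule Tr_keys[OF iv_closed[OF u] kz])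
  have "?z = BD (psi (Suc k) n \<sigma>)" using psi_keys_BD[OF s, of n] by simp
  then have "BD ?z = 0" using BD_BD[OF psi_keys[OF s]] by simp
  then have "BD (Tr (iv ?u) ?z) = 0" using BD_Tr[OF iv_closed[OF u] kz] by (simp add: Tr_def)
  then show ?thesis
    unfolding nrm_def p using Tr_Tr_iv(2)[OF u Fill(1)[OF ky]] False by simp
qed

lemma Tr_diff: "Tr x (a - b) = Tr x a - Tr x b"
  by (simp add: Tr_def frag_extend_diff)

text \<open>As for \<open>phi\<close>; the term at time n + 1 is normalised at the next prefix,
  which is at distance at most 1.\<close>

lemma psi_finite: "\<exists>F. finite F \<and> (\<forall>n. \<forall>\<sigma>\<in>SX k. nrm n (psi k) \<sigma> \<in> F)"
proof (induction k)
  case 0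
  have "nrm n (psi 0) \<sigma> \<in> {0}" for n \<sigma> by (simp add: nrm_def Tr_def)
  then show ?case by blast
next
  case (Suc k)
  then obtain F where F: "finite F" "\<And>n \<sigma>. \<sigma> \<in> SX k \<Longrightarrow> nrm n (psi k) \<sigma> \<in> F" by blast
  have "\<exists>G. finite G \<and> (\<forall>n. \<forall>\<sigma>\<in>SX (Suc k). Tr (iv (cb n \<sigma>)) (frag_extend (psi k n) (bd \<sigma>)) \<in> G)"
  proof (cases k)
    case 0
    have "Tr (iv (cb n \<sigma>)) (frag_extend (psi k n) (bd \<sigma>)) \<in> {0}" for n \<sigma>
      using 0 by (simp add: Tr_def frag_extend_eq_0)
    then show ?thesis by blast
  next
    case (Suc k')
    show ?thesis by (rule face_sum_finite[OF F(1) Suc psi_keys F(2)])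
  qed
  then obtain G where G: "finite G"
    "\<And>n \<sigma>. \<sigma> \<in> SX (Suc k) \<Longrightarrow> Tr (iv (cb n \<sigma>)) (frag_extend (psi k n) (bd \<sigma>)) \<in> G" by blast
  obtain A where A: "finite A" "\<And>n \<sigma>. \<sigma> \<in> SX (Suc k) \<Longrightarrow> nrm n (phi (Suc k)) \<sigma> \<in> A"
    using phi_finite[of "Suc k"] by blast
  let ?B = "\<Union>h\<in>{h \<in> W. len h \<le> 1}. Tr h ` A"
  let ?H = "insert 0 ((\<lambda>(a, b, c). Fill (Suc k) (a - b - c)) ` (?B \<times> A \<times> G))"
  have "nrm n (psi (Suc k)) \<sigma> \<in> ?H" if s: "\<sigma> \<in> SX (Suc k)" for n \<sigma>
  proof -
    let ?u = "cb n \<sigma>" and ?v = "cb (Suc n) \<sigma>"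
    have u: "?u \<in> W" and v: "?v \<in> W" by (rule cb_in_W[OF s])+
    let ?a = "Tr (iv ?u) (phi (Suc k) (Suc n) \<sigma>)"
    have "?a = Tr (iv ?u \<odot> ?v) (nrm (Suc n) (phi (Suc k)) \<sigma>)"
      unfolding nrm_def by (rule Tr_change[OF u v phi_keys[OF s]])
    moreover have "len (iv ?u \<odot> ?v) \<le> 1" unfolding cb_def by (rule comb_Suc_dist[OF base(1)[OF s]])
    ultimately have "?a \<in> ?B" using A(2)[OF s] mul_closed[OF iv_closed[OF u] v] by blast
    moreover have "Tr (iv ?u) (phi (Suc k) n \<sigma>) \<in> A" using A(2)[OF s, of n] by (simp add: nrm_def)
    ultimately have "(?a, Tr (iv ?u) (phi (Suc k) n \<sigma>), Tr (iv ?u) (frag_extend (psi k n) (bd \<sigma>))) \<in> ?B \<times> A \<times> G"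
      using G(2)[OF s] by blast
    from imageI[OF this, of "\<lambda>(a, b, c). Fill (Suc k) (a - b - c)"] show ?thesis
      unfolding nrm_psi_Suc[OF s] Tr_diff by simp
  qed
  moreover have "finite ?H"
    by (intro finite.insertI finite_imageI finite_cartesian_product finite_translates A(1) G(1))
  ultimately show ?case by blast
qed

end

section \<open>Evaluation of cochains on chains\<close>

definition ev :: "('b \<Rightarrow> complex) \<Rightarrow> ('b \<Rightarrow>\<^sub>0 int) \<Rightarrow> complex" where
  "ev f z = (\<Sum>x\<in>Poly_Mapping.keys z. of_int (Poly_Mapping.lookup z x) * f x)"

lemma ev_superset: assumes "finite A" "Poly_Mapping.keys z \<subseteq> A"
  shows "ev f z = (\<Sum>x\<in>A. of_int (Poly_Mapping.lookup z x) * f x)"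
  unfolding ev_def by (rule sum.mono_neutral_left[OF assms]) (simp add: in_keys_iff)

lemma ev_0 [simp]: "ev f 0 = 0"
  by (simp add: ev_def)

lemma ev_frag_of [simp]: "ev f (frag_of x) = f x"
  by (simp add: ev_def)

lemma ev_add: "ev f (a + b) = ev f a + ev f b"
proof -
  let ?A = "Poly_Mapping.keys a \<union> Poly_Mapping.keys b"
  have "ev f (a + b) = (\<Sum>x\<in>?A. of_int (Poly_Mapping.lookup (a + b) x) * f x)"
    by (rule ev_superset) (simp_all add: keys_add_subset)
  moreover have "ev f a = (\<Sum>x\<in>?A. of_int (Poly_Mapping.lookup a x) * f x)"
    by (rule ev_superset) simp_all
  moreover have "ev f b = (\<Sum>x\<in>?A. of_int (Poly_Mapping.lookup b x) * f x)"
    by (rule ev_superset) simp_all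
  ultimately show ?thesis by (simp add: lookup_add algebra_simps sum.distrib)
qed

lemma ev_cmul: "ev f (frag_cmul n a) = of_int n * ev f a"
proof -
  have "ev f (frag_cmul n a) = (\<Sum>x\<in>Poly_Mapping.keys a. of_int (Poly_Mapping.lookup (frag_cmul n a) x) * f x)"
    by (rule ev_superset) (simp_all add: keys_cmul)
  then show ?thesis by (simp add: ev_def sum_distrib_left mult.assoc)
qed

lemma ev_diff: "ev f (a - b) = ev f a - ev f b"
  using ev_add[of f "a - b" b] by simp

lemma ev_sum: "ev f (sum z A) = (\<Sum>i\<in>A. ev f (z i))"
  by (induction A rule: infinite_finite_induct) (simp_all add: ev_add)

lemma ev_frag_extend: "ev f (frag_extend p z) = ev (\<lambda>x. ev f (p x)) z"
  unfolding frag_extend_def ev_sum ev_cmul by (simp add: ev_def)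

lemma ev_cong: "(\<And>x. x \<in> Poly_Mapping.keys z \<Longrightarrow> f x = f' x) \<Longrightarrow> ev f z = ev f' z"
  unfolding ev_def by (rule sum.cong) simp_all

lemma ev_eq_0: "(\<And>x. x \<in> Poly_Mapping.keys z \<Longrightarrow> f x = 0) \<Longrightarrow> ev f z = 0"
  unfolding ev_def by (rule sum.neutral) simp

lemma ev_sum_fun: "ev (\<lambda>x. \<Sum>i\<in>A. f i x) z = (\<Sum>i\<in>A. ev (f i) z)"
  unfolding ev_def sum_distrib_left by (rule sum.swap)

lemma norm_ev_le: "norm (ev f z) \<le> (\<Sum>x\<in>Poly_Mapping.keys z. \<bar>real_of_int (Poly_Mapping.lookup z x)\<bar> * norm (f x))"
  unfolding ev_def by (rule order_trans[OF norm_sum]) (simp add: norm_mult)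

lemma ev_bdl: "ev f (bdl c) = (\<Sum>j<length c. (-1) ^ j * f (take j c @ drop (Suc j) c))"
proof (induction c arbitrary: f)
  case (Cons T c)
  have "ev f (pre T (bdl c)) = ev (\<lambda>c. f (T # c)) (bdl c)"
    unfolding pre_def ev_frag_extend by simp
  also have "\<dots> = (\<Sum>j<length c. (-1) ^ j * f (T # take j c @ drop (Suc j) c))"
    by (rule Cons.IH)
  finally show ?case
    unfolding list.size add_0_right add_Suc_right sum.lessThan_Suc_shift by (simp add: ev_diff sum_negf)
qed simp

context coxeter
begin

lemma face_smp: assumes "w \<in> W" "c \<in> Ch (Suc (Suc k))" "j < length c"
  shows "face S M j (smp w c) = smp w (take j c @ drop (Suc j) c)"
proof -
  obtain T T' c' where c: "c = T # T' # c'" using assms(2) by (auto simp: Ch_def length_Suc_conv)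
  have T: "T \<subseteq> T'" "T' \<subseteq> S" using assms(2) spherical_subset unfolding c by (auto simp: Ch_def)
  show ?thesis
    using cos_union[OF assms(1) T] assms(3)
    by (cases j) (simp_all add: face_def smp_def hc_def c)
qed

text \<open>The two boundaries agree from two vertices on. Below that \<open>bd\<close> yields the
  empty simplex, whereas \<open>face\<close> reads a second vertex.\<close>

lemma coboundary_eq: assumes "\<sigma> \<in> SX (Suc (Suc k))" shows "coboundary S M f \<sigma> = ev f (bd \<sigma>)"
proof -
  obtain w c where w: "w \<in> W" "c \<in> Ch (Suc (Suc k))" "\<sigma> = smp w c" by (rule SX_cases[OF assms])
  have "ev f (bd \<sigma>) = ev (\<lambda>c. f (smp w c)) (bdl c)"
    unfolding w(3) bd_smp[OF w(1,2)] inc_def ev_frag_extend by simp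
  then show ?thesis unfolding ev_bdl coboundary_def w(3) snd_smp
    by (simp only:) (rule sum.cong[OF HOL.refl], simp add: face_smp[OF w(1,2)])
qed

section \<open>The cochain homotopy\<close>

lemma ev_Tr: "ev f (Tr u z) = ev (\<lambda>\<sigma>. f (tr u \<sigma>)) z"
  unfolding Tr_def ev_frag_extend by simp

text \<open>\<open>A\<close> is the union of the supports and \<open>C\<close> the sum of all
  absolute coefficients of the finitely many normalised homotopies.\<close>

lemma ev_psi_bound:
  "\<exists>A C. finite A \<and> A \<subseteq> SX (Suc k) \<and> 0 \<le> C \<and>
     (\<forall>f n. \<forall>\<sigma>\<in>SX k. norm (ev f (psi k n \<sigma>)) \<le> C * (\<Sum>\<tau>\<in>A. norm (f (tr (cb n \<sigma>) \<tau>))))"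
proof -
  obtain F where F: "finite F" "\<And>n \<sigma>. \<sigma> \<in> SX k \<Longrightarrow> nrm n (psi k) \<sigma> \<in> F" using psi_finite[of k] by blast
  let ?A = "(\<Union>y\<in>F. keys y) \<inter> SX (Suc k)"
  let ?m = "\<lambda>y \<tau>. \<bar>real_of_int (Poly_Mapping.lookup y \<tau>)\<bar>"
  let ?C = "\<Sum>y\<in>F. \<Sum>\<tau>\<in>keys y. ?m y \<tau>"
  have A: "finite ?A" using F(1) by simp
  have C: "0 \<le> ?C" by (intro sum_nonneg) simp
  have "norm (ev f (psi k n \<sigma>)) \<le> ?C * (\<Sum>\<tau>\<in>?A. norm (f (tr (cb n \<sigma>) \<tau>)))" if s: "\<sigma> \<in> SX k" for f n \<sigma>
  proof -
    let ?y = "nrm n (psi k) \<sigma>" and ?s = "\<Sum>\<tau>\<in>?A. norm (f (tr (cb n \<sigma>) \<tau>))"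
    have u: "cb n \<sigma> \<in> W" by (rule cb_in_W[OF s])
    have p: "psi k n \<sigma> = Tr (cb n \<sigma>) ?y" unfolding nrm_def by (rule Tr_Tr_iv(1)[OF u psi_keys[OF s], symmetric])
    have ky: "keys ?y \<subseteq> SX (Suc k)" unfolding nrm_def by (rule Tr_keys[OF iv_closed[OF u] psi_keys[OF s]])
    have "norm (ev f (psi k n \<sigma>)) \<le> (\<Sum>\<tau>\<in>keys ?y. ?m ?y \<tau> * norm (f (tr (cb n \<sigma>) \<tau>)))"
    proof -
      have "ev f (psi k n \<sigma>) = ev (\<lambda>\<tau>. f (tr (cb n \<sigma>) \<tau>)) ?y"
        using arg_cong[OF p, of "ev f"] ev_Tr[of f "cb n \<sigma>" ?y] by (simp only:)
      then show ?thesis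
        using norm_ev_le[of "\<lambda>\<tau>. f (tr (cb n \<sigma>) \<tau>)" ?y] by (simp only:)
    qed
    also have "\<dots> \<le> (\<Sum>\<tau>\<in>keys ?y. ?m ?y \<tau> * ?s)"
    proof (rule sum_mono)
      fix \<tau> assume t: "\<tau> \<in> keys ?y"
      have "\<tau> \<in> (\<Union>y\<in>F. keys y)" by (rule UN_I[where B = keys, OF F(2)[OF s, of n] t])
      then have "\<tau> \<in> ?A" using t ky by blast
      then have "norm (f (tr (cb n \<sigma>) \<tau>)) \<le> ?s" by (rule member_le_sum[where f = "\<lambda>\<tau>. norm (f (tr (cb n \<sigma>) \<tau>))", OF _ _ A]) simp
      then show "?m ?y \<tau> * norm (f (tr (cb n \<sigma>) \<tau>)) \<le> ?m ?y \<tau> * ?s" by (rule mult_left_mono) simp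
    qed
    also have "\<dots> = (\<Sum>\<tau>\<in>keys ?y. ?m ?y \<tau>) * ?s" by (rule sum_distrib_right[symmetric])
    also have "\<dots> \<le> ?C * ?s"
    proof (rule mult_right_mono)
      show "(\<Sum>\<tau>\<in>keys ?y. ?m ?y \<tau>) \<le> ?C"
        by (rule member_le_sum[where f = "\<lambda>y. \<Sum>\<tau>\<in>keys y. ?m y \<tau>", OF F(2)[OF s] _ F(1)]) (simp add: sum_nonneg)
    qed (intro sum_nonneg, simp)
    finally show ?thesis .
  qed
  then have "finite ?A \<and> ?A \<subseteq> SX (Suc k) \<and> 0 \<le> ?C \<and>
     (\<forall>f n. \<forall>\<sigma>\<in>SX k. norm (ev f (psi k n \<sigma>)) \<le> ?C * (\<Sum>\<tau>\<in>?A. norm (f (tr (cb n \<sigma>) \<tau>))))"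
    using A C by (intro conjI allI ballI) simp_all
  then show ?thesis by (intro exI)
qed

definition htp :: "('s dsimplex \<Rightarrow> complex) \<Rightarrow> nat \<Rightarrow> 's dsimplex \<Rightarrow> complex" where
  "htp f k \<sigma> = (\<Sum>n\<le>lev \<sigma>. ev f (psi k n \<sigma>))"

lemma htp_extend: assumes "lev \<sigma> \<le> N" shows "htp f k \<sigma> = (\<Sum>n\<le>N. ev f (psi k n \<sigma>))"
  unfolding htp_def
proof (rule sum.mono_neutral_left)
  show "{..lev \<sigma>} \<subseteq> {..N}" using assms by simp
  show "\<forall>n\<in>{..N} - {..lev \<sigma>}. ev f (psi k n \<sigma>) = 0"
  proof
    fix n assume "n \<in> {..N} - {..lev \<sigma>}"
    then have "psi k n \<sigma> = 0" by (intro psi_0) simp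
    then show "ev f (psi k n \<sigma>) = 0" by simp
  qed
qed simp

text \<open>Summed over time, the homotopy identity telescopes from \<open>phi\<close> at time 0,
  which vanishes here, to the identity map. The values of \<open>f\<close> on boundaries drop out
  because \<open>f\<close> is a cocycle.\<close>

lemma htp_coboundary:
  assumes f: "\<And>\<rho>. \<rho> \<in> SX (Suc (Suc (Suc k))) \<Longrightarrow> ev f (bd \<rho>) = 0" and s: "\<sigma> \<in> SX (Suc (Suc k))"
  shows "ev (htp f (Suc k)) (bd \<sigma>) = f \<sigma>"
proof -
  let ?N = "lev \<sigma>" and ?p = "\<lambda>n. ev f (phi (Suc (Suc k)) n \<sigma>)"
  have "ev (htp f (Suc k)) (bd \<sigma>) = ev (\<lambda>\<tau>. \<Sum>n\<le>?N. ev f (psi (Suc k) n \<tau>)) (bd \<sigma>)"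
    by (rule ev_cong) (rule htp_extend[OF face_base(2)[OF s]])
  also have "\<dots> = (\<Sum>n\<le>?N. ev f (frag_extend (psi (Suc k) n) (bd \<sigma>)))"
    unfolding ev_sum_fun ev_frag_extend ..
  also have "\<dots> = (\<Sum>n\<le>?N. ?p (Suc n) - ?p n)"
  proof (rule sum.cong[OF HOL.refl])
    fix n
    have "ev f (BD (psi (Suc (Suc k)) n \<sigma>)) = 0"
      unfolding ev_frag_extend by (rule ev_eq_0) (use f psi_keys[OF s] in blast)
    moreover have "BD (psi (Suc (Suc k)) n \<sigma>)
        = phi (Suc (Suc k)) (Suc n) \<sigma> - phi (Suc (Suc k)) n \<sigma> - frag_extend (psi (Suc k) n) (bd \<sigma>)"
      using psi_keys_BD[OF s, of n] by simp
    ultimately show "ev f (frag_extend (psi (Suc k) n) (bd \<sigma>)) = ?p (Suc n) - ?p n"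
      by (simp add: ev_diff)
  qed
  \<comment> \<open>The sum ends one step after the level of the simplex; by then \<open>phi\<close>
    is the identity on it.\<close>
  also have "\<dots> = ?p (Suc ?N) - ?p 0"
    unfolding lessThan_Suc_atMost[symmetric] by (rule sum_lessThan_telescope)
  also have "\<dots> = f \<sigma>" using phi_0[OF s] by (simp add: phi_id)
  finally show ?thesis .
qed

end

section \<open>Weighted square-summability\<close>

lemma summable_on_bounded: fixes f :: "'b \<Rightarrow> real"
  assumes "\<And>x. x \<in> A \<Longrightarrow> 0 \<le> f x" "\<And>F. finite F \<Longrightarrow> F \<subseteq> A \<Longrightarrow> sum f F \<le> B"
  shows "f summable_on A"
proof (rule nonneg_bdd_above_summable_on[OF assms(1)])
  show "bdd_above (sum f ` {F. F \<subseteq> A \<and> finite F})"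
    by (rule bdd_aboveI[of _ B]) (use assms(2) in blast)
qed

lemma sum_le_infsum_product: fixes f :: "'b \<Rightarrow> real"
  assumes F: "finite F" and inj: "inj_on (\<lambda>x. (p x, q x)) F"
    and pq: "\<And>x. x \<in> F \<Longrightarrow> p x \<in> A" "\<And>x. x \<in> F \<Longrightarrow> q x \<in> B"
    and le: "\<And>x. x \<in> F \<Longrightarrow> f x \<le> G (p x) * H (q x)"
    and G: "\<And>a. a \<in> A \<Longrightarrow> 0 \<le> G a" "G summable_on A" and H: "\<And>b. b \<in> B \<Longrightarrow> 0 \<le> H b" "H summable_on B"
  shows "sum f F \<le> infsum G A * infsum H B"
proof -
  have sub: "(\<lambda>x. (p x, q x)) ` F \<subseteq> p ` F \<times> q ` F" by auto
  have "sum f F \<le> (\<Sum>x\<in>F. G (p x) * H (q x))" by (rule sum_mono[OF le])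
  also have "\<dots> = (\<Sum>y\<in>(\<lambda>x. (p x, q x)) ` F. G (fst y) * H (snd y))"
    by (simp add: sum.reindex[OF inj])
  also have "\<dots> \<le> (\<Sum>y\<in>p ` F \<times> q ` F. G (fst y) * H (snd y))"
    by (rule sum_mono2[OF _ sub]) (use F G(1) H(1) pq in \<open>auto intro!: mult_nonneg_nonneg\<close>)
  also have "\<dots> = sum G (p ` F) * sum H (q ` F)"
    unfolding sum_product sum.cartesian_product by (simp add: case_prod_beta)
  also have "\<dots> \<le> infsum G A * infsum H B"
  proof (rule mult_mono)
    show "sum G (p ` F) \<le> infsum G A" by (rule finite_sum_le_infsum[OF G(2)]) (use F G(1) pq in auto)
    show "sum H (q ` F) \<le> infsum H B" by (rule finite_sum_le_infsum[OF H(2)]) (use F H(1) pq in auto)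
    show "0 \<le> infsum G A" by (rule infsum_nonneg[OF G(1)])
    show "0 \<le> sum H (q ` F)" by (rule sum_nonneg) (use H(1) pq in auto)
  qed
  finally show ?thesis .
qed

text \<open>The factors \<open>(1 / \<kappa>) ^ (L - n)\<close> make one side a geometric series,
  bounded independently of \<open>L\<close>.\<close>

lemma weighted_Cauchy_Schwarz: fixes \<kappa> :: real assumes "1 < \<kappa>"
  shows "(\<Sum>n\<le>L. x n)\<^sup>2 \<le> 1 / (1 - 1 / \<kappa>\<^sup>2) * (\<Sum>n\<le>L. (\<kappa>\<^sup>2) ^ (L - n) * (x n)\<^sup>2)"
proof -
  let ?q = "1 / \<kappa>\<^sup>2"
  have q: "0 < ?q" "?q < 1" using assms by (simp_all add: power_strict_increasing_iff[of \<kappa> 0 2, simplified])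
  have "(\<Sum>n\<le>L. x n) = (\<Sum>n\<le>L. (1 / \<kappa>) ^ (L - n) * (\<kappa> ^ (L - n) * x n))"
    using assms by (simp add: power_one_over)
  then have "(\<Sum>n\<le>L. x n)\<^sup>2 \<le> (\<Sum>n\<le>L. ((1 / \<kappa>) ^ (L - n))\<^sup>2) * (\<Sum>n\<le>L. (\<kappa> ^ (L - n) * x n)\<^sup>2)"
    using Cauchy_Schwarz_ineq_sum[of "\<lambda>n. (1 / \<kappa>) ^ (L - n)" "\<lambda>n. \<kappa> ^ (L - n) * x n" "{..L}"] by simp
  also have "(\<Sum>n\<le>L. ((1 / \<kappa>) ^ (L - n))\<^sup>2) = (\<Sum>n<Suc L. ?q ^ (Suc L - Suc n))"
    by (simp add: lessThan_Suc_atMost power_one_over power_mult[symmetric] mult.commute)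
  also have "\<dots> = (\<Sum>n<Suc L. ?q ^ n)" by (rule sum.nat_diff_reindex)
  also have "(\<Sum>n\<le>L. (\<kappa> ^ (L - n) * x n)\<^sup>2) = (\<Sum>n\<le>L. (\<kappa>\<^sup>2) ^ (L - n) * (x n)\<^sup>2)"
    by (simp add: power_mult_distrib power_mult[symmetric] mult.commute)
  also have "(\<Sum>n<Suc L. ?q ^ n) * (\<Sum>n\<le>L. (\<kappa>\<^sup>2) ^ (L - n) * (x n)\<^sup>2)
      \<le> 1 / (1 - ?q) * (\<Sum>n\<le>L. (\<kappa>\<^sup>2) ^ (L - n) * (x n)\<^sup>2)"
  proof (rule mult_right_mono)
    have "(\<Sum>n<Suc L. ?q ^ n) \<le> suminf (\<lambda>n. ?q ^ n)"
      by (rule sum_le_suminf) (use q summable_geometric[of ?q] in auto)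
    then show "(\<Sum>n<Suc L. ?q ^ n) \<le> 1 / (1 - ?q)" using q suminf_geometric[of ?q] by simp
  qed (intro sum_nonneg, simp)
  finally show ?thesis .
qed

context coxeter
begin

lemma growth_summable: assumes "0 \<le> x" "ereal x < growth_radius S M" shows "(\<lambda>w. x ^ len w) summable_on W"
proof (rule summable_on_bounded)
  let ?c = "\<lambda>n. real (card {w \<in> W. len w = n})"
  have s: "summable (\<lambda>n. ?c n * x ^ n)"
    by (rule summable_in_conv_radius) (use assms in \<open>simp add: growth_radius_def\<close>)
  fix F assume F: "finite F" "F \<subseteq> W"
  have "(\<Sum>w\<in>F. x ^ len w) = (\<Sum>n\<in>len ` F. \<Sum>w\<in>{w \<in> F. len w = n}. x ^ len w)"
    by (rule sum.image_gen[OF F(1)])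
  also have "\<dots> \<le> (\<Sum>n\<in>len ` F. ?c n * x ^ n)"
  proof (rule sum_mono)
    fix n
    have "card {w \<in> F. len w = n} \<le> card {w \<in> W. len w = n}"
      by (rule card_mono[OF finite_subset[OF _ finite_len_le[of n]]]) (use F(2) in auto)
    then show "(\<Sum>w\<in>{w \<in> F. len w = n}. x ^ len w) \<le> ?c n * x ^ n"
      using assms(1) by (simp add: mult_right_mono)
  qed
  also have "\<dots> \<le> suminf (\<lambda>n. ?c n * x ^ n)"
    by (rule sum_le_suminf[OF s]) (use F assms(1) in auto)
  finally show "(\<Sum>w\<in>F. x ^ len w) \<le> suminf (\<lambda>n. ?c n * x ^ n)" .
qed (use assms(1) in simp)

text \<open>A pair of \<open>w\<close> and a prefix length corresponds to a reduced factorisation w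
  = u v at the prefix \<open>u\<close>, and is recovered from \<open>u\<close> and \<open>v\<close>.
  Its weight is t^len(u) r^len(v) with \<open>r = \<kappa>\<^sup>2 * t\<close>, so the sum is
  bounded by the squared norm of \<open>a\<close> times W(r).\<close>

lemma comb_sum_summable:
  assumes t: "0 < t" "ereal t < growth_radius S M"
    and a: "(\<lambda>u. t ^ len u * (a u)\<^sup>2) summable_on W"
  shows "(\<lambda>w. t ^ len w * (\<Sum>n\<le>len w. a (comb n w))\<^sup>2) summable_on W"
proof -
  obtain r where r: "ereal t < ereal r" "ereal r < growth_radius S M"
    using ereal_dense2[OF t(2)] by blast
  \<comment> \<open>Any \<open>r\<close> strictly between t and the radius will do: the growth
    series must still converge at \<open>\<kappa>\<^sup>2 * t = r\<close>.\<close>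
  define \<kappa> where "\<kappa> = sqrt (r / t)"
  have \<kappa>: "1 < \<kappa>" "\<kappa>\<^sup>2 * t = r" using r(1) t(1) by (simp_all add: \<kappa>_def)
  have rp: "0 < r" using r(1) t(1) by simp
  let ?K = "1 / (1 - 1 / \<kappa>\<^sup>2)"
  have K: "0 \<le> ?K" using \<kappa>(1) by (simp add: power_strict_increasing_iff[of \<kappa> 0 2, simplified] less_imp_le)
  let ?G = "\<lambda>u. t ^ len u * (a u)\<^sup>2" and ?H = "\<lambda>v. r ^ len v"
  show ?thesis
  proof (rule summable_on_bounded)
    fix F assume F: "finite F" "F \<subseteq> W"
    let ?F = "Sigma F (\<lambda>w. {..len w})"
    have split: "comb n w \<in> W" "iv (comb n w) \<odot> w \<in> W" "len (comb n w) = n" "len w = n + len (iv (comb n w) \<odot> w)"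
      "comb n w \<odot> (iv (comb n w) \<odot> w) = w"
      if "w \<in> F" "n \<le> len w" for w n
    proof -
      have w: "w \<in> W" using that F by blast
      note c = comb_len[OF w, of n]
      show u: "comb n w \<in> W" by (rule comb_in_W[OF w])
      show "iv (comb n w) \<odot> w \<in> W" by (rule mul_closed[OF iv_closed[OF u] w])
      show "len (comb n w) = n" using conjunct1[OF c] that(2) by linarith
      then show "len w = n + len (iv (comb n w) \<odot> w)" using conjunct2[OF c] by linarith
      show "comb n w \<odot> (iv (comb n w) \<odot> w) = w" by (rule mul_iv_cancel[OF u w])
    qed
    have *: "t ^ len w * (\<kappa>\<^sup>2) ^ (len w - n) = t ^ len (comb n w) * r ^ len (iv (comb n w) \<odot> w)"
      if "w \<in> F" "n \<le> len w" for w n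
    proof -
      let ?v = "len (iv (comb n w) \<odot> w)"
      have "len w - n = ?v" using split(4)[OF that] by linarith
      moreover have "t ^ len w = t ^ n * t ^ ?v" by (subst split(4)[OF that]) (rule power_add)
      ultimately show ?thesis using \<kappa>(2) split(3)[OF that] by (simp add: power_mult_distrib[symmetric] mult.commute)
    qed
    have "(\<Sum>w\<in>F. t ^ len w * (\<Sum>n\<le>len w. a (comb n w))\<^sup>2)
        \<le> (\<Sum>w\<in>F. t ^ len w * (?K * (\<Sum>n\<le>len w. (\<kappa>\<^sup>2) ^ (len w - n) * (a (comb n w))\<^sup>2)))"
      by (intro sum_mono mult_left_mono weighted_Cauchy_Schwarz \<kappa>(1)) (use t(1) in simp)
    also have "\<dots> = ?K * (\<Sum>w\<in>F. \<Sum>n\<le>len w. t ^ len w * (\<kappa>\<^sup>2) ^ (len w - n) * (a (comb n w))\<^sup>2)"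
      by (simp only: sum_distrib_left ac_simps)
    also have "(\<Sum>w\<in>F. \<Sum>n\<le>len w. t ^ len w * (\<kappa>\<^sup>2) ^ (len w - n) * (a (comb n w))\<^sup>2)
        = (\<Sum>y\<in>?F. t ^ len (fst y) * (\<kappa>\<^sup>2) ^ (len (fst y) - snd y) * (a (comb (snd y) (fst y)))\<^sup>2)"
      by (subst sum.Sigma) (use F(1) in \<open>simp_all add: case_prod_beta\<close>)
    also have "?K * (\<Sum>y\<in>?F. t ^ len (fst y) * (\<kappa>\<^sup>2) ^ (len (fst y) - snd y) * (a (comb (snd y) (fst y)))\<^sup>2)
        \<le> ?K * (infsum ?G W * infsum ?H W)"
    proof (rule mult_left_mono[OF _ K], rule sum_le_infsum_product[where p = "\<lambda>y. comb (snd y) (fst y)"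
          and q = "\<lambda>y. iv (comb (snd y) (fst y)) \<odot> fst y"])
      show "finite ?F" using F(1) by simp
      show "inj_on (\<lambda>y. (comb (snd y) (fst y), iv (comb (snd y) (fst y)) \<odot> fst y)) ?F"
      proof (rule inj_onI)
        fix y z assume yz: "y \<in> ?F" "z \<in> ?F"
          and eq: "(comb (snd y) (fst y), iv (comb (snd y) (fst y)) \<odot> fst y)
            = (comb (snd z) (fst z), iv (comb (snd z) (fst z)) \<odot> fst z)"
        have y: "fst y \<in> F" "snd y \<le> len (fst y)" and z: "fst z \<in> F" "snd z \<le> len (fst z)" using yz by auto
        have "fst y = comb (snd y) (fst y) \<odot> (iv (comb (snd y) (fst y)) \<odot> fst y)" by (rule split(5)[OF y, symmetric])
        also have "\<dots> = comb (snd z) (fst z) \<odot> (iv (comb (snd z) (fst z)) \<odot> fst z)"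
          by (rule arg_cong[OF eq, of "\<lambda>p. fst p \<odot> snd p", unfolded fst_conv snd_conv])
        also have "\<dots> = fst z" by (rule split(5)[OF z])
        finally have 1: "fst y = fst z" .
        have "comb (snd y) (fst y) = comb (snd z) (fst z)" by (rule arg_cong[OF eq, of fst, unfolded fst_conv])
        then have "snd y = snd z" using split(3)[OF y] split(3)[OF z] by simp
        with 1 show "y = z" by (rule prod_eqI)
      qed
      fix y assume "y \<in> ?F"
      then have y: "fst y \<in> F" "snd y \<le> len (fst y)" by auto
      show "comb (snd y) (fst y) \<in> W" "iv (comb (snd y) (fst y)) \<odot> fst y \<in> W" by (rule split[OF y])+
      show "t ^ len (fst y) * (\<kappa>\<^sup>2) ^ (len (fst y) - snd y) * (a (comb (snd y) (fst y)))\<^sup>2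
          \<le> t ^ len (comb (snd y) (fst y)) * (a (comb (snd y) (fst y)))\<^sup>2 * r ^ len (iv (comb (snd y) (fst y)) \<odot> fst y)"
        unfolding *[OF y] by (simp add: mult.commute mult.left_commute)
    next
      show "?G summable_on W" by (rule a)
      show "?H summable_on W" by (rule growth_summable) (use rp r(2) in simp_all)
    qed (use t(1) rp in simp_all)
    finally show "(\<Sum>w\<in>F. t ^ len w * (\<Sum>n\<le>len w. a (comb n w))\<^sup>2) \<le> ?K * (infsum ?G W * infsum ?H W)" .
  qed (use t(1) in simp)
qed

end

text \<open>The label \<open>q\<close> in a finite set bounds the fibres of \<open>p\<close>, so
  pulling back along \<open>p\<close> preserves summability.\<close>

lemma summable_on_finite_to_one: fixes f :: "'b \<Rightarrow> real"
  assumes inj: "inj_on (\<lambda>x. (p x, q x)) X"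
    and pq: "\<And>x. x \<in> X \<Longrightarrow> p x \<in> A" "\<And>x. x \<in> X \<Longrightarrow> q x \<in> B" "finite B"
    and le: "\<And>x. x \<in> X \<Longrightarrow> 0 \<le> f x" "\<And>x. x \<in> X \<Longrightarrow> f x \<le> K * G (p x)" and K: "0 \<le> K"
    and G: "\<And>a. a \<in> A \<Longrightarrow> 0 \<le> G a" "G summable_on A"
  shows "f summable_on X"
proof (rule summable_on_bounded[OF le(1)])
  fix F assume F: "finite F" "F \<subseteq> X"
  show "sum f F \<le> infsum G A * infsum (\<lambda>_. K) B"
  proof (rule sum_le_infsum_product[OF F(1), where p = p and q = q and H = "\<lambda>_. K"])
    show "inj_on (\<lambda>x. (p x, q x)) F" by (rule inj_on_subset[OF inj F(2)])
    show "(\<lambda>_. K) summable_on B" by (rule summable_on_finite[OF pq(3)])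
    fix x assume "x \<in> F"
    then have x: "x \<in> X" using F(2) by blast
    show "p x \<in> A" "q x \<in> B" by (rule pq(1)[OF x], rule pq(2)[OF x])
    show "f x \<le> G (p x) * K" using le(2)[OF x] by (simp add: mult.commute)
  qed (use K G in auto)
qed

lemma summable_on_finite_sum: fixes f :: "'i \<Rightarrow> 'b \<Rightarrow> real"
  assumes "finite I" "\<And>i. i \<in> I \<Longrightarrow> f i summable_on A"
  shows "(\<lambda>x. \<Sum>i\<in>I. f i x) summable_on A"
  using assms by (induction I rule: finite_induct) (auto intro: summable_on_add)

text \<open>The constant has two summands because t may lie on either side of 1: for finite
  \<open>W\<close> the growth series converges everywhere.\<close>

lemma power_shift_le: fixes t :: real assumes "0 < t" "l \<le> l' + m" "l' \<le> l + m"
  shows "t ^ l' \<le> (t ^ m + 1 / t ^ m) * t ^ l"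
proof (cases "1 \<le> t")
  case True
  have "t ^ l' \<le> t ^ (l + m)" by (rule power_increasing[OF assms(3) True])
  also have "\<dots> = t ^ m * t ^ l" by (simp add: power_add)
  also have "\<dots> \<le> (t ^ m + 1 / t ^ m) * t ^ l" using assms(1) by (intro mult_right_mono) simp_all
  finally show ?thesis .
next
  case False
  have "t ^ (l' + m) \<le> t ^ l" by (rule power_decreasing[OF assms(2)]) (use assms(1) False in simp_all)
  then have "t ^ l' \<le> 1 / t ^ m * t ^ l" using assms(1) by (simp add: power_add field_simps)
  also have "\<dots> \<le> (t ^ m + 1 / t ^ m) * t ^ l" using assms(1) by (intro mult_right_mono) simp_all
  finally show ?thesis .
qed

context coxeter
begin

lemma simplex_length_eq: assumes "\<sigma> \<in> SX k" shows "simplex_length S M \<sigma> = lev \<sigma>"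
  unfolding simplex_length_def
proof (rule Least_equality)
  note b = base[OF assms]
  note T = hc_subset[OF b(4)]
  have f: "fst \<sigma> = cos (base \<sigma>) (hc (snd \<sigma>))" using arg_cong[OF b(2), of fst] by (simp add: smp_def)
  show "\<exists>w\<in>fst \<sigma>. len w = lev \<sigma>" using cos_self[OF b(1) T] f by (auto simp: lev_def)
  fix n assume "\<exists>w\<in>fst \<sigma>. len w = n"
  then obtain y where y: "y \<in> cos (base \<sigma>) (hc (snd \<sigma>))" "len y = n" using f by auto
  have "y \<in> W" using cos_subset_W[OF b(1) T] y(1) by blast
  then have "len (base \<sigma>) \<le> len y" by (rule smp_min_unique(2)[OF b(1,4,3) _ smp_eqI[OF b(1,4) y(1)]])
  then show "lev \<sigma> \<le> n" using y(2) by (simp add: lev_def)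
qed

lemma base_smp_right: assumes "w \<in> W" "c \<in> Ch k" shows "iv (base (smp w c)) \<odot> w \<in> WT (hc c)"
proof -
  note b = base[OF smp_in_SX[OF assms], unfolded snd_smp]
  note T = hc_subset[OF assms(2)]
  have "w \<in> cos (base (smp w c)) (hc c)" using cos_self[OF assms(1) T] b(2) by (simp add: smp_def)
  then show ?thesis using cos_iff[OF b(1) T] by blast
qed

lemma len_split_bounds: assumes "b \<in> W" "w \<in> W" "len (iv b \<odot> w) \<le> m" shows "len w \<le> len b + m" "len b \<le> len w + m"
proof -
  let ?h = "iv b \<odot> w"
  have h: "?h \<in> W" by (rule mul_closed[OF iv_closed[OF assms(1)] assms(2)])
  have w: "b \<odot> ?h = w" by (rule mul_iv_cancel[OF assms(1,2)])
  have "w \<odot> iv ?h = b \<odot> (?h \<odot> iv ?h)"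
    using w mul_assoc[OF assms(1) h iv_closed[OF h]] by (simp only:)
  also have "\<dots> = b" using mul_iv[OF h] mul_e[OF assms(1)] by (simp only:)
  finally have b: "w \<odot> iv ?h = b" .
  have "len (b \<odot> ?h) \<le> len b + len ?h" by (rule len_mul_le[OF assms(1) h])
  then show "len w \<le> len b + m" unfolding w using assms(3) by linarith
  have "len (w \<odot> iv ?h) \<le> len w + len (iv ?h)" by (rule len_mul_le[OF assms(2) iv_closed[OF h]])
  then show "len b \<le> len w + m" unfolding b len_iv[OF h] using assms(3) by linarith
qed

text \<open>Stabilisers of nonempty simplices are finite, so translating \<tau> by \<open>u\<close>
  is a finite-to-one map, and it changes the length by a bounded amount.\<close>

lemma orbit_summable:
  assumes t: "0 < t" and s: "\<tau> \<in> SX (Suc k)"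
    and f: "(\<lambda>\<sigma>. (norm (f \<sigma> :: complex))\<^sup>2 * t ^ lev \<sigma>) summable_on SX (Suc k)"
  shows "(\<lambda>u. t ^ len u * (norm (f (tr u \<tau>)))\<^sup>2) summable_on W"
proof -
  obtain D where D: "\<And>T x. spherical S M T \<Longrightarrow> x \<in> WT T \<Longrightarrow> len x \<le> D"
    using spherical_bound by blast
  note b = base[OF s]
  let ?x = "base \<tau>" and ?c = "snd \<tau>"
  let ?m = "len ?x + D"
  let ?B = "\<lambda>u. base (tr u \<tau>)"
  have tr: "tr u \<tau> = smp (u \<odot> ?x) ?c" if "u \<in> W" for u
    using tr_smp[OF that b(1,4)] b(2) by simp
  have trS: "tr u \<tau> \<in> SX (Suc k)" if "u \<in> W" for u by (rule tr_SX[OF that s])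
  have h: "iv (?B u) \<odot> (u \<odot> ?x) \<in> WT (hc ?c)" if "u \<in> W" for u
    unfolding tr[OF that] by (rule base_smp_right[OF mul_closed[OF that b(1)] b(4)])
  show ?thesis
  proof (rule summable_on_finite_to_one[where p = "\<lambda>u. tr u \<tau>" and q = "\<lambda>u. iv (?B u) \<odot> (u \<odot> ?x)"
        and K = "t ^ ?m + 1 / t ^ ?m"])
    show "finite (WT (hc ?c))" using hc_spherical[OF b(4)] by (simp add: spherical_def)
    show "inj_on (\<lambda>u. (tr u \<tau>, iv (?B u) \<odot> (u \<odot> ?x))) W"
    proof (rule inj_onI)
      fix u v assume u: "u \<in> W" and v: "v \<in> W"
        and eq: "(tr u \<tau>, iv (?B u) \<odot> (u \<odot> ?x)) = (tr v \<tau>, iv (?B v) \<odot> (v \<odot> ?x))"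
      have 1: "?B u \<odot> (iv (?B u) \<odot> (u \<odot> ?x)) = u \<odot> ?x" if "u \<in> W" for u
        by (rule mul_iv_cancel[OF base(1)[OF trS[OF that]] mul_closed[OF that b(1)]])
      have 2: "u \<odot> ?x \<odot> iv ?x = u" if "u \<in> W" for u
        using mul_assoc[OF that b(1) iv_closed[OF b(1)]] mul_iv[OF b(1)] mul_e[OF that] by simp
      have "?B u = ?B v" by (rule arg_cong[OF eq, of "\<lambda>y. base (fst y)", unfolded fst_conv])
      moreover have "iv (?B u) \<odot> (u \<odot> ?x) = iv (?B v) \<odot> (v \<odot> ?x)"
        by (rule arg_cong[OF eq, of snd, unfolded snd_conv])
      ultimately have "?B u \<odot> (iv (?B u) \<odot> (u \<odot> ?x)) = ?B v \<odot> (iv (?B v) \<odot> (v \<odot> ?x))" by (simp only:)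
      then have "u \<odot> ?x = v \<odot> ?x" unfolding 1[OF u] 1[OF v] .
      then have "u \<odot> ?x \<odot> iv ?x = v \<odot> ?x \<odot> iv ?x" by (rule arg_cong)
      then show "u = v" unfolding 2[OF u] 2[OF v] .
    qed
    fix u assume u: "u \<in> W"
    show "tr u \<tau> \<in> SX (Suc k)" by (rule trS[OF u])
    show "iv (?B u) \<odot> (u \<odot> ?x) \<in> WT (hc ?c)" by (rule h[OF u])
    have ux: "u \<odot> ?x \<in> W" by (rule mul_closed[OF u b(1)])
    note l = len_split_bounds[OF base(1)[OF trS[OF u]] ux D[OF hc_spherical[OF b(4)] h[OF u]]]
    have 2: "iv u \<odot> (u \<odot> ?x) = ?x" by (rule iv_mul_cancel[OF u b(1)])
    have "len (iv u \<odot> (u \<odot> ?x)) \<le> len ?x" unfolding 2 ..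
    note l' = len_split_bounds[OF u ux this]
    have "t ^ len u \<le> (t ^ ?m + 1 / t ^ ?m) * t ^ lev (tr u \<tau>)"
      by (rule power_shift_le[OF t]) (use l l' in \<open>simp_all add: lev_def\<close>)
    then have "t ^ len u * (norm (f (tr u \<tau>)))\<^sup>2 \<le> (t ^ ?m + 1 / t ^ ?m) * t ^ lev (tr u \<tau>) * (norm (f (tr u \<tau>)))\<^sup>2"
      by (rule mult_right_mono) simp
    then show "t ^ len u * (norm (f (tr u \<tau>)))\<^sup>2 \<le> (t ^ ?m + 1 / t ^ ?m) * ((norm (f (tr u \<tau>)))\<^sup>2 * t ^ lev (tr u \<tau>))"
      by (simp only: ac_simps)
  next
    show "(\<lambda>\<sigma>. (norm (f \<sigma>))\<^sup>2 * t ^ lev \<sigma>) summable_on SX (Suc k)" by (rule f)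
  qed (use t in simp_all)
qed

lemma htp_summable:
  assumes t: "0 < t" "ereal t < growth_radius S M"
    and f: "(\<lambda>\<sigma>. (norm (f \<sigma>))\<^sup>2 * t ^ lev \<sigma>) summable_on SX (Suc k)"
  shows "(\<lambda>\<sigma>. (norm (htp f k \<sigma>))\<^sup>2 * t ^ lev \<sigma>) summable_on SX k"
proof -
  obtain A C where A: "finite A" "A \<subseteq> SX (Suc k)" "0 \<le> C"
    and C: "\<And>f n \<sigma>. \<sigma> \<in> SX k \<Longrightarrow> norm (ev f (psi k n \<sigma>)) \<le> C * (\<Sum>\<tau>\<in>A. norm (f (tr (cb n \<sigma>) \<tau>)))"
    using ev_psi_bound[of k] by metis
  \<comment> \<open>The size of \<open>f\<close> near \<open>u\<close>. By
    \<open>ev_psi_bound\<close> these values at the prefixes of the base control the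
    homotopy.\<close>
  define a where "a u = (\<Sum>\<tau>\<in>A. norm (f (tr u \<tau>)))" for u
  have "(\<lambda>u. t ^ len u * (a u)\<^sup>2) summable_on W"
  proof (rule summable_on_comparison_test)
    have "(\<lambda>u. \<Sum>\<tau>\<in>A. t ^ len u * (norm (f (tr u \<tau>)))\<^sup>2) summable_on W"
      by (rule summable_on_finite_sum[OF A(1)]) (rule orbit_summable[OF t(1) subsetD[OF A(2)] f])
    then show "(\<lambda>u. real (card A) * (\<Sum>\<tau>\<in>A. t ^ len u * (norm (f (tr u \<tau>)))\<^sup>2)) summable_on W"
      by (rule summable_on_cmult_right)
    fix u
    have "(a u)\<^sup>2 \<le> (\<Sum>\<tau>\<in>A. (norm (f (tr u \<tau>)))\<^sup>2) * card A"
      unfolding a_def by (rule sum_squared_le_sum_of_squares)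
    then have "t ^ len u * (a u)\<^sup>2 \<le> t ^ len u * ((\<Sum>\<tau>\<in>A. (norm (f (tr u \<tau>)))\<^sup>2) * card A)"
      by (rule mult_left_mono) (use t(1) in simp)
    then show "t ^ len u * (a u)\<^sup>2 \<le> real (card A) * (\<Sum>\<tau>\<in>A. t ^ len u * (norm (f (tr u \<tau>)))\<^sup>2)"
      by (simp only: sum_distrib_left[symmetric] ac_simps)
    show "0 \<le> t ^ len u * (a u)\<^sup>2" using t(1) by simp
  qed
  note G = comb_sum_summable[OF t this]
  show ?thesis
  proof (rule summable_on_finite_to_one[where p = base and q = snd and K = "C\<^sup>2", OF _ _ _ finite_Ch _ _ _ _ G])
    show "inj_on (\<lambda>\<sigma>. (base \<sigma>, snd \<sigma>)) (SX k)"
    proof (rule inj_onI)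
      fix \<sigma> \<sigma>' assume s: "\<sigma> \<in> SX k" "\<sigma>' \<in> SX k" and eq: "(base \<sigma>, snd \<sigma>) = (base \<sigma>', snd \<sigma>')"
      have "smp (base \<sigma>) (snd \<sigma>) = smp (base \<sigma>') (snd \<sigma>')" using eq by simp
      then show "\<sigma> = \<sigma>'" using base(2)[OF s(1)] base(2)[OF s(2)] by simp
    qed
    fix \<sigma> assume s: "\<sigma> \<in> SX k"
    show "base \<sigma> \<in> W" "snd \<sigma> \<in> Ch k" using base[OF s] by simp_all
    have "norm (htp f k \<sigma>) \<le> (\<Sum>n\<le>lev \<sigma>. norm (ev f (psi k n \<sigma>)))" unfolding htp_def by (rule norm_sum)
    also have "\<dots> \<le> (\<Sum>n\<le>lev \<sigma>. C * a (cb n \<sigma>))" unfolding a_def by (rule sum_mono[OF C[OF s]])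
    also have "\<dots> = C * (\<Sum>n\<le>len (base \<sigma>). a (comb n (base \<sigma>)))" by (simp add: sum_distrib_left lev_def cb_def)
    finally have "(norm (htp f k \<sigma>))\<^sup>2 \<le> (C * (\<Sum>n\<le>len (base \<sigma>). a (comb n (base \<sigma>))))\<^sup>2"
      by (rule power_mono) simp
    then have "(norm (htp f k \<sigma>))\<^sup>2 * t ^ lev \<sigma> \<le> (C * (\<Sum>n\<le>len (base \<sigma>). a (comb n (base \<sigma>))))\<^sup>2 * t ^ lev \<sigma>"
      by (rule mult_right_mono) (use t(1) in simp)
    then show "(norm (htp f k \<sigma>))\<^sup>2 * t ^ lev \<sigma>
        \<le> C\<^sup>2 * (t ^ len (base \<sigma>) * (\<Sum>n\<le>len (base \<sigma>). a (comb n (base \<sigma>)))\<^sup>2)"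
      by (simp only: power_mult_distrib lev_def ac_simps)
    show "0 \<le> (norm (htp f k \<sigma>))\<^sup>2 * t ^ lev \<sigma>" using t(1) by simp
  qed (use t(1) in simp_all)
qed

section \<open>The pairing of coboundary and adjoint\<close>

lemma face_in_SX: assumes s: "\<sigma> \<in> SX (Suc (Suc m))" and j: "j < Suc (Suc m)"
  shows "face S M j \<sigma> \<in> SX (Suc m)"
    "iv (base (face S M j \<sigma>)) \<odot> base \<sigma> \<in> WT (hc (snd (face S M j \<sigma>)))"
    "snd (face S M j \<sigma>) \<in> Ch (Suc m)"
proof -
  note b = base[OF s]
  let ?c = "snd \<sigma>" let ?c' = "take j ?c @ drop (Suc j) ?c"
  have c: "length ?c = Suc (Suc m)" "\<forall>T\<in>set ?c. spherical S M T" "sorted_wrt (\<subset>) ?c"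
    using b(4) by (auto simp: Ch_def)
  have "sorted_wrt (\<subset>) (take j ?c @ ?c ! j # drop (Suc j) ?c)"
    using c(3) id_take_nth_drop[of j ?c] j c(1) by simp
  then have s': "sorted_wrt (\<subset>) ?c'" by (simp add: sorted_wrt_append)
  have "set ?c' \<subseteq> set ?c" using set_take_subset[of j ?c] set_drop_subset[of "Suc j" ?c] by simp
  then have "\<forall>T\<in>set ?c'. spherical S M T" using c(2) by blast
  then have c': "?c' \<in> Ch (Suc m)" using s' j c(1) by (simp add: Ch_def)
  have f: "face S M j \<sigma> = smp (base \<sigma>) ?c'"
    using face_smp[OF b(1,4), of j] b(2) j c(1) by simp
  show "face S M j \<sigma> \<in> SX (Suc m)" unfolding f by (rule smp_in_SX[OF b(1) c'])
  show "iv (base (face S M j \<sigma>)) \<odot> base \<sigma> \<in> WT (hc (snd (face S M j \<sigma>)))"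
    unfolding f snd_smp by (rule base_smp_right[OF b(1) c'])
  show "snd (face S M j \<sigma>) \<in> Ch (Suc m)" unfolding f snd_smp by (rule c')
qed

text \<open>A simplex is determined by a face, its chain and an element of bounded length. So there
  are finitely many cofaces, and taking a face is finite-to-one.\<close>

lemma coface_decompose:
  obtains D where "\<And>\<sigma> j m. \<sigma> \<in> SX (Suc (Suc m)) \<Longrightarrow> j < Suc (Suc m) \<Longrightarrow>
    iv (base (face S M j \<sigma>)) \<odot> base \<sigma> \<in> {w \<in> W. len w \<le> D} \<and>
    \<sigma> = smp (base (face S M j \<sigma>) \<odot> (iv (base (face S M j \<sigma>)) \<odot> base \<sigma>)) (snd \<sigma>)"
proof -
  obtain D where D: "\<And>T x. spherical S M T \<Longrightarrow> x \<in> WT T \<Longrightarrow> len x \<le> D"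
    using spherical_bound by blast
  have "iv (base (face S M j \<sigma>)) \<odot> base \<sigma> \<in> {w \<in> W. len w \<le> D} \<and>
    \<sigma> = smp (base (face S M j \<sigma>) \<odot> (iv (base (face S M j \<sigma>)) \<odot> base \<sigma>)) (snd \<sigma>)"
    if s: "\<sigma> \<in> SX (Suc (Suc m))" and j: "j < Suc (Suc m)" for \<sigma> j m
  proof -
    note f = face_in_SX[OF s j]
    note bf = base(1)[OF f(1)] and b = base[OF s]
    have "iv (base (face S M j \<sigma>)) \<odot> base \<sigma> \<in> W" by (rule mul_closed[OF iv_closed[OF bf] b(1)])
    moreover have "len (iv (base (face S M j \<sigma>)) \<odot> base \<sigma>) \<le> D"
      by (rule D[OF hc_spherical[OF f(3)] f(2)])
    moreover have "base (face S M j \<sigma>) \<odot> (iv (base (face S M j \<sigma>)) \<odot> base \<sigma>) = base \<sigma>"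
      by (rule mul_iv_cancel[OF bf b(1)])
    ultimately show ?thesis using b(2) by simp
  qed
  then show thesis by (rule that)
qed

lemma finite_cofaces:
  "finite {\<sigma> \<in> SX (Suc (Suc m)). \<exists>j<length (snd \<sigma>). face S M j \<sigma> = \<eta>}"
proof -
  obtain D where D: "\<And>\<sigma> j m. \<sigma> \<in> SX (Suc (Suc m)) \<Longrightarrow> j < Suc (Suc m) \<Longrightarrow>
    iv (base (face S M j \<sigma>)) \<odot> base \<sigma> \<in> {w \<in> W. len w \<le> D} \<and>
    \<sigma> = smp (base (face S M j \<sigma>) \<odot> (iv (base (face S M j \<sigma>)) \<odot> base \<sigma>)) (snd \<sigma>)"
    by (rule coface_decompose) (rule that)
  let ?Y = "(\<lambda>(h, c). smp (base \<eta> \<odot> h) c) ` ({w \<in> W. len w \<le> D} \<times> Ch (Suc (Suc m)))"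
  have fY: "finite ?Y" by (intro finite_imageI finite_cartesian_product finite_len_le finite_Ch)
  have Y: "\<sigma> \<in> ?Y" if s: "\<sigma> \<in> SX (Suc (Suc m))" and j: "j < length (snd \<sigma>)" "face S M j \<sigma> = \<eta>" for \<sigma> j
  proof -
    have c: "snd \<sigma> \<in> Ch (Suc (Suc m))" by (rule base(4)[OF s])
    then have "j < Suc (Suc m)" using j(1) by (simp add: Ch_def)
    from D[OF s this] have "(iv (base \<eta>) \<odot> base \<sigma>, snd \<sigma>) \<in> {w \<in> W. len w \<le> D} \<times> Ch (Suc (Suc m))"
      and eq: "\<sigma> = smp (base \<eta> \<odot> (iv (base \<eta>) \<odot> base \<sigma>)) (snd \<sigma>)"
      using c j(2) by auto
    from imageI[OF this(1), of "\<lambda>(h, c). smp (base \<eta> \<odot> h) c"] show ?thesis using eq by simp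
  qed
  have "{\<sigma> \<in> SX (Suc (Suc m)). \<exists>j<length (snd \<sigma>). face S M j \<sigma> = \<eta>} \<subseteq> ?Y"
  proof
    fix \<sigma> assume "\<sigma> \<in> {\<sigma> \<in> SX (Suc (Suc m)). \<exists>j<length (snd \<sigma>). face S M j \<sigma> = \<eta>}"
    then obtain j where "\<sigma> \<in> SX (Suc (Suc m))" "j < length (snd \<sigma>)" "face S M j \<sigma> = \<eta>" by blast
    then show "\<sigma> \<in> ?Y" by (rule Y)
  qed
  then show ?thesis using fY by (rule finite_subset)
qed

lemma face_pull_summable:
  assumes t: "0 < t" and j: "j < Suc (Suc m)"
    and h: "(\<lambda>\<eta>. (norm (h \<eta> :: complex))\<^sup>2 * t ^ lev \<eta>) summable_on SX (Suc m)"
  shows "(\<lambda>\<sigma>. (norm (h (face S M j \<sigma>)))\<^sup>2 * t ^ lev \<sigma>) summable_on SX (Suc (Suc m))"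
proof -
  obtain D where D: "\<And>\<sigma> j m. \<sigma> \<in> SX (Suc (Suc m)) \<Longrightarrow> j < Suc (Suc m) \<Longrightarrow>
    iv (base (face S M j \<sigma>)) \<odot> base \<sigma> \<in> {w \<in> W. len w \<le> D} \<and>
    \<sigma> = smp (base (face S M j \<sigma>) \<odot> (iv (base (face S M j \<sigma>)) \<odot> base \<sigma>)) (snd \<sigma>)"
    by (rule coface_decompose) (rule that)
  let ?p = "face S M j" let ?q = "\<lambda>\<sigma>. (iv (base (?p \<sigma>)) \<odot> base \<sigma>, snd \<sigma>)"
  show ?thesis
  proof (rule summable_on_finite_to_one[where p = ?p and q = ?q and K = "t ^ D + 1 / t ^ D"
        and B = "{w \<in> W. len w \<le> D} \<times> Ch (Suc (Suc m))", OF _ _ _ _ _ _ _ _ h])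
    show "inj_on (\<lambda>\<sigma>. (?p \<sigma>, ?q \<sigma>)) (SX (Suc (Suc m)))"
    proof (rule inj_onI)
      fix \<sigma> \<sigma>' assume s: "\<sigma> \<in> SX (Suc (Suc m))" "\<sigma>' \<in> SX (Suc (Suc m))" and eq: "(?p \<sigma>, ?q \<sigma>) = (?p \<sigma>', ?q \<sigma>')"
      let ?r = "\<lambda>(\<eta>, h, c). smp (base \<eta> \<odot> h) c"
      have "\<sigma> = ?r (?p \<sigma>, ?q \<sigma>)" using conjunct2[OF D[OF s(1) j]] by simp
      also have "\<dots> = ?r (?p \<sigma>', ?q \<sigma>')" by (rule arg_cong[OF eq])
      also have "\<dots> = \<sigma>'" using conjunct2[OF D[OF s(2) j]] by simp
      finally show "\<sigma> = \<sigma>'" .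
    qed
    show "finite ({w \<in> W. len w \<le> D} \<times> Ch (Suc (Suc m)))"
      by (rule finite_cartesian_product[OF finite_len_le finite_Ch])
    fix \<sigma> assume s: "\<sigma> \<in> SX (Suc (Suc m))"
    show "?p \<sigma> \<in> SX (Suc m)" by (rule face_in_SX(1)[OF s j])
    show "?q \<sigma> \<in> {w \<in> W. len w \<le> D} \<times> Ch (Suc (Suc m))"
      by (rule SigmaI[OF conjunct1[OF D[OF s j]] base(4)[OF s]])
    have l: "len (iv (base (?p \<sigma>)) \<odot> base \<sigma>) \<le> D" using conjunct1[OF D[OF s j]] by simp
    note lb = len_split_bounds[OF base(1)[OF face_in_SX(1)[OF s j]] base(1)[OF s] l]
    have "t ^ lev \<sigma> \<le> (t ^ D + 1 / t ^ D) * t ^ lev (?p \<sigma>)"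
      by (rule power_shift_le[OF t]) (use lb in \<open>simp_all add: lev_def\<close>)
    then have "(norm (h (?p \<sigma>)))\<^sup>2 * t ^ lev \<sigma> \<le> (norm (h (?p \<sigma>)))\<^sup>2 * ((t ^ D + 1 / t ^ D) * t ^ lev (?p \<sigma>))"
      by (rule mult_left_mono) simp
    then show "(norm (h (?p \<sigma>)))\<^sup>2 * t ^ lev \<sigma> \<le> (t ^ D + 1 / t ^ D) * ((norm (h (?p \<sigma>)))\<^sup>2 * t ^ lev (?p \<sigma>))"
      by (simp only: ac_simps)
  qed (use t in simp_all)
qed

section \<open>Comparison with the simplices of the definitions, and the pairing\<close>

lemma chamber_Ch: "chamber_simplices S M i = Ch (Suc i)"
  unfolding chamber_simplices_def Ch_def by simp

lemma davis_SX: "davis_simplices S M i = SX (Suc i)"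
proof -
  have *: "smp w c = (cos w (hd c), c)" if "c \<in> Ch (Suc i)" for w c
  proof -
    have "c \<noteq> []" using that by (auto simp: Ch_def)
    then show ?thesis by (simp add: smp_def hc_def)
  qed
  show ?thesis unfolding davis_simplices_def SX_def chamber_Ch
  proof (intro Collect_cong iff_exI)
    show "\<sigma> = (cos w (hd c), c) \<and> w \<in> W \<and> c \<in> Ch (Suc i) \<longleftrightarrow> \<sigma> = smp w c \<and> w \<in> W \<and> c \<in> Ch (Suc i)" for \<sigma> w c
      by (cases "c \<in> Ch (Suc i)") (simp_all add: *)
  qed
qed

text \<open>The fibre of the face map over \<eta> collects the conjugate of the adjoint of
  \<open>f\<close> at \<eta>, times \<open>h \<eta>\<close> and the weight of \<eta>.\<close>

lemma pairing_fibre: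
  assumes t: "0 < t" and e: "\<eta> \<in> SX (Suc m)" and adj: "adjoint_t S M t m f \<eta> = 0"
  shows "(\<Sum>y | y \<in> SX (Suc (Suc m)) \<times> {..<Suc (Suc m)} \<and> face S M (snd y) (fst y) = \<eta>.
      (-1) ^ snd y * h (face S M (snd y) (fst y)) * cnj (f (fst y)) * complex_of_real (t ^ lev (fst y))) = 0"
proof -
  let ?C = "{\<sigma> \<in> SX (Suc (Suc m)). \<exists>j<length (snd \<sigma>). face S M j \<sigma> = \<eta>}"
  let ?N = "Suc (Suc m)"
  let ?F = "{y. y \<in> SX ?N \<times> {..<?N} \<and> face S M (snd y) (fst y) = \<eta>}"
  let ?g = "\<lambda>y. (-1) ^ snd y * h (face S M (snd y) (fst y)) * cnj (f (fst y)) * complex_of_real (t ^ lev (fst y))"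
  have len: "length (snd \<sigma>) = ?N" if "\<sigma> \<in> SX ?N" for \<sigma> using base(4)[OF that] by (simp add: Ch_def)
  have "sum ?g ?F = (\<Sum>y\<in>?C \<times> {..<?N}. if face S M (snd y) (fst y) = \<eta> then ?g y else 0)"
  proof (rule sum.mono_neutral_cong_left)
    show "finite (?C \<times> {..<?N})" using finite_cofaces by simp
    show "?F \<subseteq> ?C \<times> {..<?N}" using len by auto
  qed auto
  also have "\<dots> = (\<Sum>\<sigma>\<in>?C. \<Sum>j<?N. if face S M j \<sigma> = \<eta> then ?g (\<sigma>, j) else 0)"
    by (simp only: sum.cartesian_product' fst_conv snd_conv)
  also have "\<dots> = (\<Sum>\<sigma>\<in>?C. h \<eta> * complex_of_real (t ^ lev \<eta>) * cnj (incidence S M \<eta> \<sigma> *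
        complex_of_real (t ^ simplex_length S M \<sigma> / t ^ simplex_length S M \<eta>) * f \<sigma>))"
  proof (rule sum.cong[OF HOL.refl])
    fix \<sigma> assume "\<sigma> \<in> ?C"
    then have s: "\<sigma> \<in> SX ?N" by blast
    have i: "cnj (incidence S M \<eta> \<sigma>) = (\<Sum>j<?N. if face S M j \<sigma> = \<eta> then (-1) ^ j else 0)"
      unfolding incidence_def len[OF s] cnj_sum by (rule sum.cong) simp_all
    have "(\<Sum>j<?N. if face S M j \<sigma> = \<eta> then ?g (\<sigma>, j) else 0)
        = (\<Sum>j<?N. (if face S M j \<sigma> = \<eta> then (-1) ^ j else 0) * (h \<eta> * cnj (f \<sigma>) * complex_of_real (t ^ lev \<sigma>)))"
      by (rule sum.cong) simp_all
    also have "\<dots> = cnj (incidence S M \<eta> \<sigma>) * (h \<eta> * cnj (f \<sigma>) * complex_of_real (t ^ lev \<sigma>))"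
      unfolding i by (rule sum_distrib_right[symmetric])
    also have "\<dots> = h \<eta> * complex_of_real (t ^ lev \<eta>) * cnj (incidence S M \<eta> \<sigma> *
        complex_of_real (t ^ lev \<sigma> / t ^ lev \<eta>) * f \<sigma>)"
    proof -
      have "t ^ lev \<eta> * (t ^ lev \<sigma> / t ^ lev \<eta>) = t ^ lev \<sigma>" using t by simp
      then have T: "complex_of_real (t ^ lev \<sigma>) = complex_of_real (t ^ lev \<eta>) * complex_of_real (t ^ lev \<sigma> / t ^ lev \<eta>)"
        by (simp only: of_real_mult[symmetric])
      show ?thesis unfolding T complex_cnj_mult complex_cnj_complex_of_real by (simp only: ac_simps)
    qed
    finally show "(\<Sum>j<?N. if face S M j \<sigma> = \<eta> then ?g (\<sigma>, j) else 0)
        = h \<eta> * complex_of_real (t ^ lev \<eta>) * cnj (incidence S M \<eta> \<sigma> *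
        complex_of_real (t ^ simplex_length S M \<sigma> / t ^ simplex_length S M \<eta>) * f \<sigma>)"
      unfolding simplex_length_eq[OF s] simplex_length_eq[OF e] .
  qed
  also have "\<dots> = h \<eta> * complex_of_real (t ^ lev \<eta>) * cnj (adjoint_t S M t m f \<eta>)"
    unfolding adjoint_t_def davis_SX cnj_sum sum_distrib_left ..
  finally show ?thesis using adj by simp
qed

text \<open>One absolutely convergent sum over pairs of a simplex and a face index is evaluated
  twice: by simplices it is the squared norm of \<open>f\<close>, as \<open>f\<close> is the
  coboundary of \<open>h\<close>; by faces it is zero, as the adjoint kills
  \<open>f\<close>.\<close>

lemma pairing_vanishes:
  assumes t: "0 < t"
    and f: "(\<lambda>\<sigma>. (norm (f \<sigma>))\<^sup>2 * t ^ lev \<sigma>) summable_on SX (Suc (Suc m))"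
    and h: "(\<lambda>\<eta>. (norm (h \<eta>))\<^sup>2 * t ^ lev \<eta>) summable_on SX (Suc m)"
    and hf: "\<And>\<sigma>. \<sigma> \<in> SX (Suc (Suc m)) \<Longrightarrow> coboundary S M h \<sigma> = f \<sigma>"
    and adj: "\<And>\<eta>. \<eta> \<in> SX (Suc m) \<Longrightarrow> adjoint_t S M t m f \<eta> = 0"
    and s: "\<sigma> \<in> SX (Suc (Suc m))"
  shows "f \<sigma> = 0"
proof -
  let ?N = "Suc (Suc m)"
  let ?X = "SX ?N" and ?J = "{..<Suc (Suc m)}"
  define g where "g = (\<lambda>y. (-1) ^ snd y * h (face S M (snd y) (fst y)) * cnj (f (fst y)) * complex_of_real (t ^ lev (fst y)))"
  have len: "length (snd \<sigma>) = ?N" if "\<sigma> \<in> ?X" for \<sigma> using base(4)[OF that] by (simp add: Ch_def)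
  \<comment> \<open>Domination by 2ab \<le> a^2 + b^2, which justifies the rearrangement
    below.\<close>
  have ng: "norm (g (\<sigma>, j)) \<le> (norm (h (face S M j \<sigma>)))\<^sup>2 * t ^ lev \<sigma> + (norm (f \<sigma>))\<^sup>2 * t ^ lev \<sigma>" for \<sigma> j
  proof -
    have "0 \<le> (norm (h (face S M j \<sigma>)) - norm (f \<sigma>))\<^sup>2" by simp
    then have "2 * (norm (h (face S M j \<sigma>)) * norm (f \<sigma>)) \<le> (norm (h (face S M j \<sigma>)))\<^sup>2 + (norm (f \<sigma>))\<^sup>2"
      by (simp add: power2_diff)
    moreover have "0 \<le> norm (h (face S M j \<sigma>)) * norm (f \<sigma>)" by simp
    ultimately have "norm (h (face S M j \<sigma>)) * norm (f \<sigma>) \<le> (norm (h (face S M j \<sigma>)))\<^sup>2 + (norm (f \<sigma>))\<^sup>2" by linarith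
    then have "norm (h (face S M j \<sigma>)) * norm (f \<sigma>) * t ^ lev \<sigma> \<le> ((norm (h (face S M j \<sigma>)))\<^sup>2 + (norm (f \<sigma>))\<^sup>2) * t ^ lev \<sigma>"
      by (rule mult_right_mono) (use t in simp)
    then show ?thesis using t by (simp add: g_def norm_mult norm_power distrib_right)
  qed
  have abs: "(\<lambda>y. norm (g y)) summable_on Sigma ?X (\<lambda>_. ?J)"
    unfolding Infinite_Sum.abs_summable_on_Sigma_iff
  proof (intro conjI ballI)
    have "(\<lambda>\<sigma>. \<Sum>j\<in>?J. norm (g (\<sigma>, j))) summable_on ?X"
    proof (rule summable_on_finite_sum)
      fix j assume "j \<in> ?J"
      then have j: "j < ?N" by simp
      show "(\<lambda>\<sigma>. norm (g (\<sigma>, j))) summable_on ?X"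
        by (rule summable_on_comparison_test[OF summable_on_add[OF face_pull_summable[OF t j h] f] ng]) simp
    qed simp
    then show "(\<lambda>\<sigma>. norm (infsum (\<lambda>j. norm (g (\<sigma>, j))) ?J)) summable_on ?X"
      by (simp add: sum_nonneg)
  qed simp
  have sm: "g summable_on Sigma ?X (\<lambda>_. ?J)" by (rule abs_summable_summable[OF abs])
  let ?Fib = "\<lambda>\<eta>. {y. y \<in> ?X \<times> ?J \<and> face S M (snd y) (fst y) = \<eta>}"
  have bij: "bij_betw snd (Sigma (SX (Suc m)) ?Fib) (Sigma ?X (\<lambda>_. ?J))"
    unfolding bij_betw_def
  proof
    show "inj_on snd (Sigma (SX (Suc m)) ?Fib)" by (rule inj_onI) auto
    show "snd ` Sigma (SX (Suc m)) ?Fib = Sigma ?X (\<lambda>_. ?J)"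
    proof
      show "Sigma ?X (\<lambda>_. ?J) \<subseteq> snd ` Sigma (SX (Suc m)) ?Fib"
      proof
        fix y assume y: "y \<in> Sigma ?X (\<lambda>_. ?J)"
        then have "face S M (snd y) (fst y) \<in> SX (Suc m)" by (intro face_in_SX(1)) auto
        then have "(face S M (snd y) (fst y), y) \<in> Sigma (SX (Suc m)) ?Fib" using y by simp
        from imageI[OF this, of snd] show "y \<in> snd ` Sigma (SX (Suc m)) ?Fib" by simp
      qed
    qed auto
  qed
  have "infsum g (Sigma ?X (\<lambda>_. ?J)) = infsum (\<lambda>x. g (snd x)) (Sigma (SX (Suc m)) ?Fib)"
    by (rule infsum_reindex_bij_betw[OF bij, symmetric])
  also have "\<dots> = infsum (\<lambda>\<eta>. infsum (\<lambda>y. g (snd (\<eta>, y))) (?Fib \<eta>)) (SX (Suc m))"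
    by (rule infsum_Sigma_banach[symmetric]) (use summable_on_reindex_bij_betw[OF bij, of g] sm in simp)
  also have "\<dots> = 0"
  proof (rule infsum_0)
    fix \<eta> assume e: "\<eta> \<in> SX (Suc m)"
    have "?Fib \<eta> \<subseteq> {\<sigma> \<in> ?X. \<exists>j<length (snd \<sigma>). face S M j \<sigma> = \<eta>} \<times> ?J" using len by auto
    then have "finite (?Fib \<eta>)" by (rule finite_subset) (use finite_cofaces in simp)
    then show "infsum (\<lambda>y. g (snd (\<eta>, y))) (?Fib \<eta>) = 0"
      using pairing_fibre[OF t e adj[OF e], of h] by (simp add: g_def)
  qed
  finally have 0: "infsum g (Sigma ?X (\<lambda>_. ?J)) = 0" .
  let ?w = "\<lambda>\<sigma>. (norm (f \<sigma>))\<^sup>2 * t ^ lev \<sigma>"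
  have "infsum g (Sigma ?X (\<lambda>_. ?J)) = infsum (\<lambda>\<sigma>. infsum (\<lambda>j. g (\<sigma>, j)) ?J) ?X"
    by (rule infsum_Sigma_banach[OF sm, symmetric])
  also have "\<dots> = infsum (\<lambda>\<sigma>. complex_of_real (?w \<sigma>)) ?X"
  proof (rule infsum_cong)
    fix \<sigma> assume s: "\<sigma> \<in> ?X"
    have "(\<Sum>j<?N. (-1) ^ j * h (face S M j \<sigma>)) = f \<sigma>"
      using hf[OF s] by (simp only: coboundary_def len[OF s])
    then have "(\<Sum>j<?N. g (\<sigma>, j)) = f \<sigma> * cnj (f \<sigma>) * complex_of_real (t ^ lev \<sigma>)"
      unfolding g_def fst_conv snd_conv sum_distrib_right[symmetric] by (simp only:)
    also have "\<dots> = complex_of_real (?w \<sigma>)"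
      by (simp only: complex_norm_square of_real_mult)
    finally show "infsum (\<lambda>j. g (\<sigma>, j)) ?J = complex_of_real (?w \<sigma>)" by simp
  qed
  also have "\<dots> = complex_of_real (infsum ?w ?X)"
    by (rule infsumI) (simp only: has_sum_of_real_iff has_sum_infsum[OF f])
  finally have "infsum ?w ?X = 0" using 0 by simp
  then have "?w \<sigma> = 0" by (intro nonneg_infsum_le_0D[OF _ f _ s]) (use t in simp_all)
  then show ?thesis using t by simp
qed

lemma harmonic_zero:
  assumes t: "0 < t" "ereal t < growth_radius S M"
  shows "harmonic_cochains S M t (Suc m) = {\<lambda>_. 0}"
proof
  show "harmonic_cochains S M t (Suc m) \<subseteq> {\<lambda>_. 0}"
  proof
    fix f assume "f \<in> harmonic_cochains S M t (Suc m)"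
    then have f0: "\<And>\<sigma>. \<sigma> \<notin> SX (Suc (Suc m)) \<Longrightarrow> f \<sigma> = 0"
      and fs: "(\<lambda>\<sigma>. (norm (f \<sigma>))\<^sup>2 * t ^ simplex_length S M \<sigma>) summable_on SX (Suc (Suc m))"
      and fc: "\<And>\<sigma>. \<sigma> \<in> SX (Suc (Suc (Suc m))) \<Longrightarrow> coboundary S M f \<sigma> = 0"
      and fa: "\<And>\<eta>. \<eta> \<in> SX (Suc m) \<Longrightarrow> adjoint_t S M t m f \<eta> = 0"
      by (auto simp: harmonic_cochains_def cochain_L2_def davis_SX)
    have fs': "(\<lambda>\<sigma>. (norm (f \<sigma>))\<^sup>2 * t ^ lev \<sigma>) summable_on SX (Suc (Suc m))"
      using fs summable_on_cong[of "SX (Suc (Suc m))" "\<lambda>\<sigma>. (norm (f \<sigma>))\<^sup>2 * t ^ simplex_length S M \<sigma>"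
          "\<lambda>\<sigma>. (norm (f \<sigma>))\<^sup>2 * t ^ lev \<sigma>"] simplex_length_eq by simp
    have "f \<sigma> = 0" if s: "\<sigma> \<in> SX (Suc (Suc m))" for \<sigma>
    proof (rule pairing_vanishes[OF t(1) fs' htp_summable[OF t fs'] _ fa s])
      fix \<sigma> assume s: "\<sigma> \<in> SX (Suc (Suc m))"
      show "coboundary S M (htp f (Suc m)) \<sigma> = f \<sigma>"
        unfolding coboundary_eq[OF s]
        by (rule htp_coboundary[OF _ s]) (use fc coboundary_eq in simp)
    qed
    then show "f \<in> {\<lambda>_. 0}" using f0 by blast
  qed
  show "{\<lambda>_. 0} \<subseteq> harmonic_cochains S M t (Suc m)"
    by (simp add: harmonic_cochains_def cochain_L2_def coboundary_def adjoint_t_def)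
qed

section \<open>Degree zero\<close>

lemma cocycle_edge:
  assumes f: "\<And>\<sigma>. \<sigma> \<in> SX (Suc (Suc 0)) \<Longrightarrow> coboundary S M f \<sigma> = 0" and w: "w \<in> W" and T: "spherical S M T"
  shows "f (smp w [T]) = f (smp w [{}])"
proof (cases "T = {}")
  case False
  have c: "[{}, T] \<in> Ch (Suc (Suc 0))" using False T spherical_empty by (auto simp: Ch_def)
  have "coboundary S M f (smp w [{}, T]) = ev f (bd (smp w [{}, T]))"
    by (rule coboundary_eq[OF smp_in_SX[OF w c]])
  also have "\<dots> = f (smp w [T]) - f (smp w [{}])"
    unfolding bd_smp[OF w c] by (simp add: inc_def pre_def frag_extend_diff ev_diff)
  finally show ?thesis using f[OF smp_in_SX[OF w c]] by simp
qed simp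

text \<open>Inside a chamber every vertex is joined to that of the empty set, and the chambers
  \<open>w\<close> and w s share the vertex of {s}; so a cocycle is constant along words.\<close>

lemma cocycle_constant:
  assumes f: "\<And>\<sigma>. \<sigma> \<in> SX (Suc (Suc 0)) \<Longrightarrow> coboundary S M f \<sigma> = 0" and s: "\<sigma> \<in> SX (Suc 0)"
  shows "f \<sigma> = f (smp e [{}])"
proof -
  have step: "f (smp (w \<odot> g s) [{}]) = f (smp w [{}])" if w: "w \<in> W" and s: "s \<in> S" for w s
  proof -
    have "s \<in> rdesc (g s)" using s by (simp add: rdesc_def)
    then have T: "spherical S M {s}" by (intro spherical_mono[OF _ spherical_rdesc[of "g s"]]) (use s in simp_all)
    have c: "[{s}] \<in> Ch (Suc 0)" using T by (simp add: Ch_def)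
    have wg: "w \<odot> g s \<in> W" using w s by (simp add: mul_closed)
    have "iv w \<odot> (w \<odot> g s) = g s" by (rule iv_mul_cancel[OF w g_in_W[OF s]])
    then have "iv w \<odot> (w \<odot> g s) \<in> WT {s}" using WT_g[of s "{s}"] by simp
    then have "w \<odot> g s \<in> cos w {s}" using cos_iff[OF w, of "{s}"] wg s by simp
    then have eq: "smp (w \<odot> g s) [{s}] = smp w [{s}]" by (intro smp_eqI[OF w c]) (simp add: hc_def)
    have "f (smp (w \<odot> g s) [{}]) = f (smp (w \<odot> g s) [{s}])" by (rule cocycle_edge[OF f wg T, symmetric])
    also have "\<dots> = f (smp w [{s}])" unfolding eq ..
    also have "\<dots> = f (smp w [{}])" by (rule cocycle_edge[OF f w T])
    finally show ?thesis .
  qed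
  have word: "set u \<subseteq> S \<Longrightarrow> f (smp (cls u) [{}]) = f (smp e [{}])" for u
  proof (induction u rule: rev_induct)
    case Nil
    then show ?case by (simp add: cox_one_def)
  next
    case (snoc s u)
    then have u: "set u \<subseteq> S" "s \<in> S" by auto
    show ?case unfolding cls_snoc[OF u(2,1)] step[OF cls_in_W[OF u(1)] u(2)] by (rule snoc.IH[OF u(1)])
  qed
  obtain w c where w: "w \<in> W" "c \<in> Ch (Suc 0)" "\<sigma> = smp w c" by (rule SX_cases[OF s])
  obtain T where c: "c = [T]" "spherical S M T" using w(2) by (auto simp: Ch_def length_Suc_conv)
  obtain u where u: "set u \<subseteq> S" "w = cls u" using w(1) unfolding cox_group_def by blast
  have "f \<sigma> = f (smp w [{}])" unfolding w(3) c(1) by (rule cocycle_edge[OF f w(1) c(2)])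
  also have "\<dots> = f (smp e [{}])" unfolding u(2) by (rule word[OF u(1)])
  finally show ?thesis .
qed

text \<open>In degree zero there is no adjoint condition. Constants are square-summable because the
  growth series converges at t and a vertex is determined by its base and its type.\<close>

lemma harmonic_0:
  assumes t: "0 < t" "ereal t < growth_radius S M"
  shows "harmonic_cochains S M t 0 = (\<lambda>a \<sigma>. if \<sigma> \<in> SX (Suc 0) then a else 0) ` UNIV"
proof
  show "harmonic_cochains S M t 0 \<subseteq> (\<lambda>a \<sigma>. if \<sigma> \<in> SX (Suc 0) then a else 0) ` UNIV"
  proof
    fix f assume "f \<in> harmonic_cochains S M t 0"
    then have f: "\<And>\<sigma>. \<sigma> \<notin> SX (Suc 0) \<Longrightarrow> f \<sigma> = 0" "\<And>\<sigma>. \<sigma> \<in> SX (Suc (Suc 0)) \<Longrightarrow> coboundary S M f \<sigma> = 0"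
      by (auto simp: harmonic_cochains_def cochain_L2_def davis_SX)
    have "f = (\<lambda>\<sigma>. if \<sigma> \<in> SX (Suc 0) then f (smp e [{}]) else 0)"
    proof
      fix \<sigma> show "f \<sigma> = (if \<sigma> \<in> SX (Suc 0) then f (smp e [{}]) else 0)"
      proof (cases "\<sigma> \<in> SX (Suc 0)")
        case True
        then show ?thesis using cocycle_constant[OF f(2) True] by (simp only: if_True)
      qed (simp add: f(1))
    qed
    then show "f \<in> (\<lambda>a \<sigma>. if \<sigma> \<in> SX (Suc 0) then a else 0) ` UNIV" by (rule image_eqI) simp
  qed
  show "(\<lambda>a \<sigma>. if \<sigma> \<in> SX (Suc 0) then a else 0) ` UNIV \<subseteq> harmonic_cochains S M t 0"
  proof
    fix f :: "'s dsimplex \<Rightarrow> complex" assume "f \<in> (\<lambda>a \<sigma>. if \<sigma> \<in> SX (Suc 0) then a else 0) ` UNIV"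
    then obtain a where f: "f = (\<lambda>\<sigma>. if \<sigma> \<in> SX (Suc 0) then a else (0::complex))" by blast
    have "(\<lambda>\<sigma>. (norm (f \<sigma>))\<^sup>2 * t ^ simplex_length S M \<sigma>) summable_on SX (Suc 0)"
    proof (rule summable_on_finite_to_one[where p = base and q = snd and K = "(norm a)\<^sup>2",
          OF _ _ _ finite_Ch _ _ _ _ growth_summable[OF less_imp_le[OF t(1)] t(2)]])
      show "inj_on (\<lambda>\<sigma>. (base \<sigma>, snd \<sigma>)) (SX (Suc 0))"
      proof (rule inj_onI)
        fix \<sigma> \<sigma>' assume s: "\<sigma> \<in> SX (Suc 0)" "\<sigma>' \<in> SX (Suc 0)" and eq: "(base \<sigma>, snd \<sigma>) = (base \<sigma>', snd \<sigma>')"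
        have "smp (base \<sigma>) (snd \<sigma>) = smp (base \<sigma>') (snd \<sigma>')" using eq by simp
        then show "\<sigma> = \<sigma>'" using base(2)[OF s(1)] base(2)[OF s(2)] by simp
      qed
      fix \<sigma> assume s: "\<sigma> \<in> SX (Suc 0)"
      show "base \<sigma> \<in> W" "snd \<sigma> \<in> Ch (Suc 0)" using base[OF s] by simp_all
      show "(norm (f \<sigma>))\<^sup>2 * t ^ simplex_length S M \<sigma> \<le> (norm a)\<^sup>2 * t ^ len (base \<sigma>)"
        using s by (simp add: f simplex_length_eq lev_def)
    qed (use t(1) in simp_all)
    moreover have "coboundary S M f \<sigma> = 0" if s: "\<sigma> \<in> SX (Suc (Suc 0))" for \<sigma>
    proof -
      have l: "length (snd \<sigma>) = Suc (Suc 0)" using base(4)[OF s] by (simp add: Ch_def)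
      show ?thesis unfolding coboundary_def l
        using face_in_SX(1)[OF s, of 0] face_in_SX(1)[OF s, of "Suc 0"] by (simp add: f)
    qed
    ultimately show "f \<in> harmonic_cochains S M t 0"
      by (simp add: harmonic_cochains_def cochain_L2_def davis_SX) (simp add: f)
  qed
qed

section \<open>The Betti numbers\<close>

lemma betti_pos:
  assumes t: "0 < t" "ereal t < growth_radius S M"
  shows "weighted_betti S M t (Suc m) = 0"
proof -
  let ?ip = "L2sum_ip S M t (Suc m)"
  have V: "davis_embed S M t (Suc m) ` harmonic_cochains S M t (Suc m) = {\<lambda>_. 0}"
    unfolding harmonic_zero[OF t] by (auto simp: davis_embed_def fun_eq_iff)
  have "orth_proj ?ip {\<lambda>_. 0} x = (\<lambda>_. 0)" for x
    unfolding orth_proj_def by (rule the_equality) (auto simp: L2sum_ip_def)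
  then show ?thesis unfolding weighted_betti_def V by (simp add: L2sum_ip_def)
qed

lemma poincare_pos: assumes "0 < t" "spherical S M T" shows "0 < poincare S M T t"
proof -
  have f: "finite (WT T)" using assms(2) by (simp add: spherical_def)
  have "t ^ len e \<le> poincare S M T t"
    unfolding poincare_def by (rule member_le_sum[where f = "\<lambda>u. t ^ len u", OF WT_e _ f]) (use assms(1) in simp)
  then show ?thesis by simp
qed

text \<open>The harmonic space embeds as the line of \<open>v\<close>, whose entries r_c =
  W_T(t)^(-1/2) depend only on the type \<open>c\<close> of the vertex. With Q the squared norm of
  \<open>v\<close>, the unit vector at \<open>c\<close> projects to (r_c / Q) v, which contributes
  r_c^2 / Q to the trace.\<close>

lemma betti_0:
  assumes t: "0 < t" "ereal t < growth_radius S M"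
  shows "weighted_betti S M t 0 = complex_of_real (1 / growth_series S M t)"
proof -
  let ?C = "Ch (Suc 0)" let ?X = "?C \<times> W" let ?ip = "L2sum_ip S M t 0"
  let ?P = "\<lambda>c. poincare S M (hd c) t" and ?G = "growth_series S M t"
  define r where "r = (\<lambda>c. ?P c powr (-1/2))"
  define v where "v = (\<lambda>(c, w). if c \<in> ?C \<and> w \<in> W then complex_of_real (r c) else 0)"
  have P: "0 < ?P c" if "c \<in> ?C" for c
    using poincare_pos[OF t(1)] that by (auto simp: Ch_def length_Suc_conv)
  have r2: "r c * r c = 1 / ?P c" if "c \<in> ?C" for c
    using P[OF that] by (simp add: r_def powr_add[symmetric] powr_minus inverse_eq_divide)
  have gs: "(\<lambda>w. t ^ len w) summable_on W" by (rule growth_summable[OF less_imp_le[OF t(1)] t(2)])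
  have "1 \<le> ?G"
  proof -
    have "sum (\<lambda>w. t ^ len w) {e} \<le> infsum (\<lambda>w. t ^ len w) W"
      by (rule finite_sum_le_infsum[OF gs]) (use t(1) in simp_all)
    then show ?thesis by (simp add: growth_series_def)
  qed
  \<comment> \<open>\<open>Z\<close> is the sum of the r_c^2, and the sum over the group contributes
    the growth series to \<open>Q\<close>; the trace is Z / Q, in which \<open>Z\<close>
    cancels.\<close>
  define Z where "Z = (\<Sum>c\<in>?C. 1 / ?P c)"
  define Q where "Q = Z * ?G"
  have "0 < Z" unfolding Z_def
  proof (rule sum_pos)
    show "?C \<noteq> {}" using spherical_empty by (auto simp: Ch_def intro!: exI[of _ "[{}]"])
  qed (use finite_Ch P in simp_all)
  then have Q: "0 < Q" using \<open>1 \<le> ?G\<close> by (simp add: Q_def)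
  have hQ: "((\<lambda>x. complex_of_real (r (fst x) * r (fst x) * t ^ len (snd x))) has_sum complex_of_real Q) ?X"
  proof -
    have "((\<lambda>x. r (fst x) * r (fst x) * t ^ len (snd x)) has_sum Q) ?X"
    proof (rule has_sum_SigmaI)
      fix c assume c: "c \<in> ?C"
      have "((\<lambda>w. t ^ len w) has_sum ?G) W" unfolding growth_series_def by (rule has_sum_infsum[OF gs])
      from has_sum_cmult_right[OF this, of "r c * r c"]
      show "((\<lambda>w. r (fst (c, w)) * r (fst (c, w)) * t ^ len (snd (c, w))) has_sum (r c * r c * ?G)) W" by simp
    next
      have "Q = (\<Sum>c\<in>?C. r c * r c * ?G)"
        unfolding Q_def Z_def sum_distrib_right by (rule sum.cong) (simp_all add: r2)
      then show "((\<lambda>c. r c * r c * ?G) has_sum Q) ?C" using has_sum_finite[OF finite_Ch] by metis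
    next
      show "(\<lambda>x. r (fst x) * r (fst x) * t ^ len (snd x)) summable_on ?X"
      proof (rule summable_on_finite_to_one[where p = snd and q = fst and K = "\<Sum>c\<in>?C. r c * r c" and B = ?C,
            OF _ _ _ finite_Ch _ _ _ _ gs])
        fix x assume x: "x \<in> ?X"
        have "r (fst x) * r (fst x) \<le> (\<Sum>c\<in>?C. r c * r c)"
          by (rule member_le_sum[where f = "\<lambda>c. r c * r c", OF _ _ finite_Ch]) (use x in auto)
        then show "r (fst x) * r (fst x) * t ^ len (snd x) \<le> (\<Sum>c\<in>?C. r c * r c) * t ^ len (snd x)"
          by (rule mult_right_mono) (use t(1) in simp)
      qed (use t(1) in \<open>auto simp: inj_on_def intro!: sum_nonneg\<close>)
    qed
    then show ?thesis by (simp only: has_sum_of_real_iff)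
  qed
  have vx: "v x = complex_of_real (r (fst x))" if "x \<in> ?X" for x using that by (auto simp: v_def)
  have V: "davis_embed S M t 0 ` harmonic_cochains S M t 0 = range (\<lambda>a x. a * v x)"
  proof -
    have "davis_embed S M t 0 (\<lambda>\<sigma>. if \<sigma> \<in> SX (Suc 0) then a else 0) = (\<lambda>x. a * v x)" for a
    proof
      fix x :: "'s set list \<times> 's list set"
      obtain c w where x: "x = (c, w)" by (cases x)
      have "(cos w (hd c), c) \<in> SX (Suc 0)" if "c \<in> ?C" "w \<in> W"
        unfolding davis_SX[symmetric] davis_simplices_def chamber_Ch using that by blast
      then show "davis_embed S M t 0 (\<lambda>\<sigma>. if \<sigma> \<in> SX (Suc 0) then a else 0) x = a * v x"
        by (simp add: x davis_embed_def chamber_Ch v_def r_def)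
    qed
    then show ?thesis unfolding harmonic_0[OF t] image_image by simp
  qed
  have unit: "?ip (\<lambda>x. a * v x) (unit_vec S M c) = a * complex_of_real (r c)" if c: "c \<in> ?C" for a c
    unfolding L2sum_ip_def chamber_Ch
  \<comment> \<open>Only the term at (c, e) is nonzero, and its weight is t^0 = 1.\<close>
  proof (rule infsumI, rule has_sum_finite_neutralI[of "{(c, e)}"])
    show "a * complex_of_real (r c) = (\<Sum>x\<in>{(c, e)}. a * v x * cnj (unit_vec S M c x) * complex_of_real (t ^ len (snd x)))"
      using c by (simp add: unit_vec_def v_def)
    fix x assume "x \<in> ?X - {(c, e)}"
    then show "a * v x * cnj (unit_vec S M c x) * complex_of_real (t ^ len (snd x)) = 0"
      by (auto simp: unit_vec_def split: prod.splits)
  qed (use c in auto)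
  have ipd: "?ip (\<lambda>x. unit_vec S M c x - a * v x) (\<lambda>x. b * v x)
      = cnj b * (complex_of_real (r c) - a * complex_of_real Q)" if c: "c \<in> ?C" for a b c
    unfolding L2sum_ip_def chamber_Ch
  proof (rule infsumI)
    have 1: "((\<lambda>x. cnj b * (unit_vec S M c x * complex_of_real (r (fst x) * t ^ len (snd x))))
        has_sum (cnj b * complex_of_real (r c))) ?X"
    proof (rule has_sum_cmult_right, rule has_sum_finite_neutralI[of "{(c, e)}"])
      show "complex_of_real (r c) = (\<Sum>x\<in>{(c, e)}. unit_vec S M c x * complex_of_real (r (fst x) * t ^ len (snd x)))"
        by (simp add: unit_vec_def)
      fix x assume "x \<in> ?X - {(c, e)}"
      then show "unit_vec S M c x * complex_of_real (r (fst x) * t ^ len (snd x)) = 0"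
        by (auto simp: unit_vec_def split: prod.splits)
    qed (use c in auto)
    have 2: "((\<lambda>x. (- cnj b * a) * complex_of_real (r (fst x) * r (fst x) * t ^ len (snd x)))
        has_sum ((- cnj b * a) * complex_of_real Q)) ?X"
      by (rule has_sum_cmult_right[OF hQ])
    have s: "cnj b * complex_of_real (r c) + (- cnj b * a) * complex_of_real Q
        = cnj b * (complex_of_real (r c) - a * complex_of_real Q)" by (simp add: algebra_simps)
    have "((\<lambda>x. cnj b * (unit_vec S M c x * complex_of_real (r (fst x) * t ^ len (snd x)))
        + (- cnj b * a) * complex_of_real (r (fst x) * r (fst x) * t ^ len (snd x)))
      has_sum (cnj b * (complex_of_real (r c) - a * complex_of_real Q))) ?X"
      using has_sum_add[OF 1 2] unfolding s .
    moreover have "cnj b * (unit_vec S M c x * complex_of_real (r (fst x) * t ^ len (snd x)))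
        + (- cnj b * a) * complex_of_real (r (fst x) * r (fst x) * t ^ len (snd x))
      = (unit_vec S M c x - a * v x) * cnj (b * v x) * complex_of_real (t ^ len (snd x))" if "x \<in> ?X" for x
      unfolding vx[OF that] by (simp add: algebra_simps)
    ultimately show "((\<lambda>x. (unit_vec S M c x - a * v x) * cnj (b * v x) * complex_of_real (t ^ len (snd x)))
      has_sum (cnj b * (complex_of_real (r c) - a * complex_of_real Q))) ?X"
      by (rule has_sum_cong[THEN iffD1, rotated])
  qed
  have proj: "orth_proj ?ip (range (\<lambda>a x. a * v x)) (unit_vec S M c) = (\<lambda>x. complex_of_real (r c / Q) * v x)"
    if c: "c \<in> ?C" for c
    unfolding orth_proj_def
  proof (rule the_equality)
    have "r c = r c / Q * Q" using Q by simp
    then have 0: "complex_of_real (r c) - complex_of_real (r c / Q) * complex_of_real Q = 0"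
      by (simp only: of_real_mult[symmetric] diff_self)
    show "(\<lambda>x. complex_of_real (r c / Q) * v x) \<in> range (\<lambda>a x. a * v x) \<and>
       (\<forall>va\<in>range (\<lambda>a x. a * v x). ?ip (\<lambda>z. unit_vec S M c z - complex_of_real (r c / Q) * v z) va = 0)"
    proof (intro conjI ballI)
      fix y assume "y \<in> range (\<lambda>a x. a * v x)"
      then obtain b where y: "y = (\<lambda>x. b * v x)" by blast
      show "?ip (\<lambda>z. unit_vec S M c z - complex_of_real (r c / Q) * v z) y = 0"
        unfolding y ipd[OF c] 0 by simp
    qed (rule rangeI)
    fix y assume y: "y \<in> range (\<lambda>a x. a * v x) \<and> (\<forall>va\<in>range (\<lambda>a x. a * v x). ?ip (\<lambda>z. unit_vec S M c z - y z) va = 0)"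
    then obtain a where a: "y = (\<lambda>x. a * v x)" by blast
    \<comment> \<open>Uniqueness: orthogonality to \<open>v\<close> itself already fixes the
      coefficient \<open>a\<close>.\<close>
    have "(\<lambda>x. 1 * v x) \<in> range (\<lambda>a x. a * v x)" by (rule rangeI)
    from bspec[OF conjunct2[OF y] this] have rc: "complex_of_real (r c) = a * complex_of_real Q"
      unfolding a ipd[OF c] by simp
    have "complex_of_real Q \<noteq> 0" using Q by simp
    then have "a = complex_of_real (r c) / complex_of_real Q"
      unfolding rc by (rule nonzero_mult_div_cancel_right[symmetric])
    then have "a = complex_of_real (r c / Q)" by simp
    then show "y = (\<lambda>x. complex_of_real (r c / Q) * v x)" using a by simp
  qed
  have "weighted_betti S M t 0 = (\<Sum>c\<in>?C. complex_of_real (r c / Q) * complex_of_real (r c))"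
    unfolding weighted_betti_def V chamber_Ch by (rule sum.cong) (simp_all only: proj unit)
  also have "\<dots> = complex_of_real (\<Sum>c\<in>?C. (1 / ?P c) / Q)"
    unfolding of_real_sum by (rule sum.cong) (simp_all flip: of_real_mult add: r2)
  also have "(\<Sum>c\<in>?C. (1 / ?P c) / Q) = Z / Q" unfolding Z_def by (rule sum_divide_distrib[symmetric])
  also have "Z / Q = 1 / ?G" using \<open>0 < Z\<close> by (simp add: Q_def)
  finally show ?thesis .
qed

end

theorem theorem10p3:
  fixes S :: "'s set" and M :: "'s \<Rightarrow> 's \<Rightarrow> enat" and t :: real
  assumes "coxeter_matrix S M"
    and "0 < t"
    and "ereal t < growth_radius S M"
  shows "weighted_betti S M t 0 = complex_of_real (1 / growth_series S M t) \<and>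
         weighted_euler_char S M t = complex_of_real (1 / growth_series S M t) \<and>
         (\<forall>i>0. weighted_betti S M t i = 0)"
proof -
  interpret coxeter S M by unfold_locales (rule assms(1))
  have pos: "weighted_betti S M t i = 0" if "0 < i" for i
    using betti_pos[OF assms(2,3), of "i - 1"] that by simp
  have "weighted_euler_char S M t = (\<Sum>i\<in>{0}. (-1) ^ i * weighted_betti S M t i)"
    unfolding weighted_euler_char_def by (rule sum.mono_neutral_right) (use pos in auto)
  then show ?thesis using betti_0[OF assms(2,3)] pos by simp
qed

end
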